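(* Let $n, r$ be positive integers with $r \ge 2$. Then $$\widetilde{A}_{n,r}(t) \ = \ \widetilde{A}^+_{n,r}(t) \, + \, \widetilde{A}^-_{n,r}(t)$$ for some polynomials $\widetilde{A}^+_{n,r}(t)$ and $\widetilde{A}^-_{n,r}(t)$ such that (i) $\widetilde{A}^+_{n,r}(t)$ is a $\gamma$-positive polynomial with center $n/2$; (ii) $\widetilde{A}^-_{n,r}(t)$ is a $\gamma$-positive polynomial with center $(n+1)/2$ and zero constant term. Moreover, $\widetilde{A}^+_{n,r}(t)$ equals the $h$-polynomial of the boundary complex of an $n$-dimensional flag simplicial polytope (that is, an $n$-dimensional simplicial polytope whose boundary complex is a flag simplicial complex).
   Context: **Colored permutations.** Elements of the wreath product $\mathbb{Z}_r \wr \mathfrak{S}_n$ are represented as $r$-colored permutations, i.e. pairs $w = (\sigma, \varepsilon)$ with $\sigma \in \mathfrak{S}_n$ and $\varepsilon = (\varepsilon_1,\dots,\varepsilon_n) \in \{0,1,\dots,r-1\}^n$, where $\varepsilon_k$ is the color of $\sigma(k)$. An index $k \in \{1,\dots,n\}$ is a descent of $w$ if either $\varepsilon_k > \varepsilon_{k+1}$, or $\varepsilon_k = \varepsilon_{k+1}$ and $\sigma(k) > \sigma(k+1)$, where $\sigma(n+1) := n+1$ and $\varepsilon_{n+1} := 0$. The number of descents is $\mathrm{des}(w)$. **Polynomials.** Set $A_{n,r}(t) = \sum_{w \in \mathbb{Z}_r \wr \mathfrak{S}_n} t^{\mathrm{des}(w)}$ for $n \ge 1$, $A_{0,r}(t)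 = 1$, and $$\widetilde{A}_{n,r}(t) = \sum_{m=0}^n \binom{n}{m} t^{n-m} A_{m,r}(t).$$ **$\gamma$-positivity.** A polynomial $f(t)$ is $\gamma$-positive with center $d/2$ ($d\in\mathbb{N}$) if $f(t) = \sum_{i=0}^{\lfloor d/2 \rfloor} \gamma_i\, t^i (1+t)^{d-2i}$ for some nonnegative integers $\gamma_i$. **Simplicial complexes.** The $h$-polynomial of an $(n-1)$-dimensional simplicial complex $\Delta$ is $h(\Delta,t) = \sum_{i=0}^n f_{i-1}(\Delta)\, t^i (1-t)^{n-i}$, where $f_i(\Delta)$ is the number of $i$-dimensional faces. A simplicial complex is flag if it contains every simplex whose one-dimensional skeleton is a subcomplex. *)

theory Defs
  imports
    "HOL-Analysis.Analysis"
    "HOL-Computational_Algebra.Polynomial"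
    "HOL-Combinatorics.Permutations"
begin

section \<open>Colored permutations and Eulerian polynomials\<close>

text \<open>
  The permutation and the color vector are total functions on \<^typ>\<open>nat\<close>. Outside \<open>{1..n}\<close> the
  permutation is the identity and the color is 0. Hence every colored permutation has exactly
  one representation, and the conventions \<open>\<sigma> (n + 1) = n + 1\<close> and \<open>\<epsilon> (n + 1) = 0\<close> hold
  automatically.
\<close>

definition colored_permutations :: "nat \<Rightarrow> nat \<Rightarrow> ((nat \<Rightarrow> nat) \<times> (nat \<Rightarrow> nat)) set" where
  "colored_permutations n r =
     {(\<sigma>, \<epsilon>). \<sigma> permutes {1..n} \<and> (\<forall>k\<in>{1..n}. \<epsilon> k < r) \<and> (\<forall>k. k \<notin> {1..n} \<longrightarrow> \<epsilon> k = 0)}"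

definition is_descent :: "(nat \<Rightarrow> nat) \<times> (nat \<Rightarrow> nat) \<Rightarrow> nat \<Rightarrow> bool" where
  "is_descent w k \<longleftrightarrow>
     snd w k > snd w (k + 1) \<or> (snd w k = snd w (k + 1) \<and> fst w k > fst w (k + 1))"

definition des :: "nat \<Rightarrow> (nat \<Rightarrow> nat) \<times> (nat \<Rightarrow> nat) \<Rightarrow> nat" where
  "des n w = card {k \<in> {1..n}. is_descent w k}"

definition eulerian_A :: "nat \<Rightarrow> nat \<Rightarrow> int poly" where
  "eulerian_A n r = (\<Sum>w\<in>colored_permutations n r. monom 1 (des n w))"

lemma eulerian_A_0: "eulerian_A 0 r = 1"
proof -
  have "colored_permutations 0 r = {(id, \<lambda>_. 0)}"
    by (auto simp: colored_permutations_def)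
  then show ?thesis
    by (simp add: eulerian_A_def des_def)
qed

definition binomial_eulerian_A :: "nat \<Rightarrow> nat \<Rightarrow> int poly" where
  "binomial_eulerian_A n r =
     (\<Sum>m\<le>n. of_nat (n choose m) * monom 1 (n - m) * eulerian_A m r)"

section \<open>Gamma-positivity\<close>

text \<open>The center of symmetry is \<open>d / 2\<close>; the argument is \<open>d\<close>.\<close>

definition gamma_positive :: "nat \<Rightarrow> int poly \<Rightarrow> bool" where
  "gamma_positive d f \<longleftrightarrow>
     (\<exists>\<gamma> :: nat \<Rightarrow> nat.
        f = (\<Sum>i\<le>d div 2. of_nat (\<gamma> i) * monom 1 i * [:1, 1:] ^ (d - 2 * i)))"

section \<open>Simplicial complexes and polytopes\<close>

text \<open>
  A complex is a set of geometric simplices as in \<^const>\<open>simplicial_complex\<close>. The empty set is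
  a face, of dimension \<open>-1\<close>, of every nonempty complex.
\<close>

definition face_number :: "'a::euclidean_space set set \<Rightarrow> int \<Rightarrow> nat" where
  "face_number \<Delta> i = card {F \<in> \<Delta>. i simplex F}"

definition complex_dim :: "'a::euclidean_space set set \<Rightarrow> int" where
  "complex_dim \<Delta> = Max (aff_dim ` \<Delta>)"

definition h_polynomial :: "'a::euclidean_space set set \<Rightarrow> int poly" where
  "h_polynomial \<Delta> =
     (let n = nat (complex_dim \<Delta> + 1)
      in \<Sum>i\<le>n. of_nat (face_number \<Delta> (int i - 1)) * monom 1 i * [:1, -1:] ^ (n - i))"

text \<open>
  In the flag condition, \<open>V\<close> is the vertex set of an abstract simplex. It is not required to be
  affinely independent; the assumption says that the vertices and the edges of this simplex
  belong to \<open>\<Delta>\<close>.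
\<close>

definition flag_complex :: "'a::euclidean_space set set \<Rightarrow> bool" where
  "flag_complex \<Delta> \<longleftrightarrow>
     simplicial_complex \<Delta> \<and>
     (\<forall>V. finite V \<longrightarrow> (\<forall>G\<subseteq>V. card G \<le> 2 \<longrightarrow> convex hull G \<in> \<Delta>) \<longrightarrow> convex hull V \<in> \<Delta>)"

definition boundary_complex :: "'a::euclidean_space set \<Rightarrow> 'a set set" where
  "boundary_complex P = {F. F face_of P \<and> F \<noteq> P}"

definition simplicial_polytope :: "'a::euclidean_space set \<Rightarrow> bool" where
  "simplicial_polytope P \<longleftrightarrow>
     polytope P \<and> (\<forall>F. F face_of P \<and> F \<noteq> P \<longrightarrow> (\<exists>k. k simplex F))"

end

theory Submission
  imports
    Defs
    "HOL-Computational_Algebra.Formal_Power_Series"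
begin

text \<open>
  Let \<open>E_k\<close> be the \<open>h\<close>-polynomial of the boundary of the simplicial polytope dual to the permutohedron
  (\<open>perm_h\<close>), and define \<open>a_n\<close> (\<open>sphere_h\<close>) by \<open>a_0 = 1\<close> and
  \<open>a_(n+1) = (1 + t) a_n + t (\<Sum>j. (n choose j) (r^(j+1) - (r-1)^(j+1)) E_j a_(n-j))\<close>. This recurrence
  is the differential equation solved by
  \<open>e^x (1 - t e^((r-1)(1-t)x)) / (1 - t e^(r(1-t)x))\<close>; comparing with the generating function
  \<open>(1 - t) e^x / (1 - t e^(r(1-t)x))\<close> of the binomial Eulerian polynomials shows that these equal
  \<open>a_n + t (\<Sum>j. (n choose j) (r-1)^j E_j a_(n-j))\<close>, where both summands are visibly gamma-positive.

  The polynomial \<open>a_n\<close> is realised by subdividing edges of the cross-polytope. Subdividing an edge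
  preserves being flag and being the boundary of a simplicial polytope, and it adds \<open>t\<close> times the
  \<open>h\<close>-polynomial of the link of the edge. Given a sphere with \<open>h\<close>-polynomial \<open>a_n\<close> whose vertices
  include one vertex \<open>v_S\<close> for every nonempty \<open>S\<close> in \<open>[n]\<close>, with link of \<open>h\<close>-polynomial
  \<open>E_|S| a_(n-|S|)\<close>, one suspends it and subdivides, \<open>r^(|S|+1) - (r-1)^(|S|+1)\<close> times, the edge from
  one apex to \<open>v_S\<close>; this produces the right-hand side of the recurrence. The subdivisions can be
  ordered in such a way that the new sphere has such vertices for all nonempty subsets of \<open>[n+1]\<close>.
\<close>

section \<open>Edge subdivisions\<close>

text \<open>The obstacle is the induction on the dimension. Subdividing an edge at the apex changes
  the link of every face that is disjoint from the edge and spans a face with it, so the links of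
  single vertices cannot be followed in isolation. Hence the induction prescribes the links of all
  chains \<open>S_1 < ... < S_k\<close>: their \<open>h\<close>-polynomials are
  \<open>E_(s_1) E_(s_2 - s_1) ... a_(n - s_k)\<close>, with \<open>s_i\<close> the size of
  \<open>S_i\<close>. Vertices of incomparable sets are kept nonadjacent, so that only sets
  comparable with the whole chain contribute. The step works because \<open>E\<close> obeys a
  recurrence of the same shape, \<open>E_(k+1) = (1 + t) E_k + t (\<Sum>j. (k choose j) E_j
  E_(k-j))\<close> for \<open>k \<ge> 1\<close>: subdividing once for each set inside a gap of the
  chain enlarges that gap by one, and subdividing with the prescribed multiplicities for the sets
  above the chain replaces \<open>a_m\<close> by \<open>a_(m+1)\<close>. A link stops changing once
  its face is no longer joined to the apex; the labels for the next dimension are caught at suitable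
  moments of this kind.\<close>

definition h_term :: "nat \<Rightarrow> nat \<Rightarrow> nat \<Rightarrow> int poly" where
  "h_term d g f = monom 1 (f - g) * [:1, -1:] ^ (d - f)"

text \<open>The \<open>h\<close>-polynomial of the link of \<open>G\<close>, expressed by the faces containing \<open>G\<close>.\<close>

definition star_h :: "nat \<Rightarrow> 'a set set \<Rightarrow> 'a set \<Rightarrow> int poly" where
  "star_h d K G = (\<Sum>F\<in>{F\<in>K. G \<subseteq> F}. h_term d (card G) (card F))"

definition abs_complex :: "nat \<Rightarrow> 'a set set \<Rightarrow> bool" where
  "abs_complex d K \<longleftrightarrow> finite K \<and> {} \<in> K \<and> (\<forall>F\<in>K. finite F \<and> card F \<le> d) \<and> (\<forall>F\<in>K. \<forall>G\<subseteq>F. G \<in> K)"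

text \<open>Stellar subdivision of the edge \<open>{a, b}\<close> at the new vertex
  \<open>x\<close>. In the second part \<open>G\<close> may contain one of the two endpoints, which
  gives the faces through \<open>x\<close> and an endpoint.\<close>

definition sdiv :: "'a set set \<Rightarrow> 'a \<Rightarrow> 'a \<Rightarrow> 'a \<Rightarrow> 'a set set" where
  "sdiv K a b x = {G\<in>K. \<not> {a, b} \<subseteq> G} \<union>
     insert x ` {G. insert a (insert b G) \<in> K \<and> \<not> {a, b} \<subseteq> G}"

lemma sdiv_newI: "insert a (insert b H) \<in> K \<Longrightarrow> \<not> {a, b} \<subseteq> H \<Longrightarrow> insert x H \<in> sdiv K a b x"
  by (auto simp: sdiv_def)

lemma sdiv_oldI: "G \<in> K \<Longrightarrow> \<not> {a, b} \<subseteq> G \<Longrightarrow> G \<in> sdiv K a b x"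
  by (auto simp: sdiv_def)

lemma abs_complexD:
  assumes "abs_complex d K"
  shows "finite K" "{} \<in> K" "F \<in> K \<Longrightarrow> finite F" "F \<in> K \<Longrightarrow> card F \<le> d"
    "F \<in> K \<Longrightarrow> G \<subseteq> F \<Longrightarrow> G \<in> K"
  using assms unfolding abs_complex_def by blast+

text \<open>Each face of size \<open>r\<close> in the link of the edge turns one removed face of
  size \<open>r + 2\<close> into one face of size \<open>r + 1\<close> and two of size
  \<open>r + 2\<close>. The surplus is governed by \<open>(1 - t) + t = 1\<close>, the star of the
  new vertex by \<open>(1 - t) + 2 t = 1 + t\<close>.\<close>

lemma h_term_rel:
  assumes "g \<le> r" "r + 2 \<le> d"
  shows "h_term d g (r + 1) + h_term d g (r + 2) = [:0, 1:] * h_term d (g + 2) (r + 2)"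
    and "h_term d (g + 1) (r + 1) + 2 * h_term d (g + 1) (r + 2) = [:1, 1:] * h_term d (g + 2) (r + 2)"
proof -
  obtain q where q: "r = g + q" using assms(1) by (metis le_Suc_ex)
  obtain e where e: "d = r + 2 + e" using assms(2) by (metis le_Suc_ex)
  define X Y :: "int poly" where "X = [:0, 1:]" and "Y = [:1, -1:]"
  have m: "monom (1::int) (Suc q) = X * monom 1 q" for q
    by (simp add: monom_Suc X_def)
  have XY: "X + Y = 1" "Y + 2 * X = [:1, 1:]" by (simp_all add: X_def Y_def numeral_poly)
  have "h_term d g (r + 1) + h_term d g (r + 2) = X * (X + Y) * (monom 1 q * Y ^ e)"
    unfolding h_term_def q e Y_def[symmetric] by (simp add: m algebra_simps)
  then show "h_term d g (r + 1) + h_term d g (r + 2) = [:0, 1:] * h_term d (g + 2) (r + 2)"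
    unfolding XY by (simp add: h_term_def q e X_def Y_def)
  have "h_term d (g + 1) (r + 1) + 2 * h_term d (g + 1) (r + 2) = (Y + 2 * X) * (monom 1 q * Y ^ e)"
    unfolding h_term_def q e Y_def[symmetric] by (simp add: m algebra_simps)
  then show "h_term d (g + 1) (r + 1) + 2 * h_term d (g + 1) (r + 2) = [:1, 1:] * h_term d (g + 2) (r + 2)"
    unfolding XY by (simp add: h_term_def q e Y_def)
qed

lemma insert2_Diff2: "insert a (insert b (F - {a, b})) = insert a (insert b F)"
  by auto

lemma sum_Un4:
  fixes f :: "'b \<Rightarrow> 'c::comm_monoid_add"
  assumes "finite A" "finite B" "finite C" "finite D" "A \<inter> B = {}" "A \<inter> C = {}" "A \<inter> D = {}"
    "B \<inter> C = {}" "B \<inter> D = {}" "C \<inter> D = {}"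
  shows "sum f (A \<union> (B \<union> (C \<union> D))) = sum f A + (sum f B + (sum f C + sum f D))"
  using assms by (subst sum.union_disjoint; (simp add: Int_Un_distrib)?)+

context
  fixes d :: nat and K :: "'a set set" and a b x :: 'a
  assumes K: "abs_complex d K" and x: "x \<notin> \<Union>K" and ab: "a \<noteq> b"
    and abK: "{a, b} \<in> K"
begin

lemma x_neq: "x \<noteq> a" "x \<noteq> b" "F \<in> K \<Longrightarrow> x \<notin> F"
  using x abK by auto

text \<open>Faces of the link of the edge. Every face removed or created by the subdivision is the
  union of such an \<open>R\<close> with a subset of \<open>{a, b, x}\<close>, so all stars can be
  summed over the same index set.\<close>

definition "edge_core G = {R. a \<notin> R \<and> b \<notin> R \<and> insert a (insert b R) \<in> K \<and> G \<subseteq> R}"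

lemma edge_core_D:
  assumes "R \<in> edge_core G"
  shows "finite R" "x \<notin> R" "a \<notin> R" "b \<notin> R" "card R + 2 \<le> d" "G \<subseteq> R" "card G \<le> card R"
    "insert a (insert b R) \<in> K"
proof -
  have 1: "insert a (insert b R) \<in> K" "a \<notin> R" "b \<notin> R" "G \<subseteq> R" using assms by (auto simp: edge_core_def)
  then have "finite (insert a (insert b R))" "card (insert a (insert b R)) \<le> d"
    using abs_complexD[OF K] by blast+
  then show "finite R" "card R + 2 \<le> d" using 1 ab by auto
  then show "card G \<le> card R" using 1 by (simp add: card_mono)
  show "x \<notin> R" using x_neq(3)[OF 1(1)] by auto
  show "a \<notin> R" "b \<notin> R" "G \<subseteq> R" "insert a (insert b R) \<in> K" using 1 by auto
qed

lemma finite_core: "finite (edge_core G)"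
proof -
  have "edge_core G \<subseteq> (\<lambda>F. F - {a,b}) ` K"
  proof
    fix R assume R: "R \<in> edge_core G"
    then have "R = insert a (insert b R) - {a, b}" using edge_core_D(3,4)[OF R] by auto
    then show "R \<in> (\<lambda>F. F - {a,b}) ` K" using edge_core_D(8)[OF R] by blast
  qed
  then show ?thesis using abs_complexD(1)[OF K] by (meson finite_imageI finite_subset)
qed

lemma sum_core:
  assumes "Z \<subseteq> {a, b, x}"
  shows "(\<Sum>F\<in>(\<lambda>R. R \<union> Z) ` edge_core G. h_term d g (card F)) = (\<Sum>R\<in>edge_core G. h_term d g (card R + card Z))"
proof -
  have i: "inj_on (\<lambda>R. R \<union> Z) (edge_core G)"
  proof (rule inj_onI)
    fix R S assume R: "R \<in> edge_core G" and S: "S \<in> edge_core G" and eq: "R \<union> Z = S \<union> Z"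
    have "R \<inter> Z = {}" "S \<inter> Z = {}" using edge_core_D(2-4)[OF R] edge_core_D(2-4)[OF S] assms by auto
    then show "R = S" using eq by blast
  qed
  have c: "card (R \<union> Z) = card R + card Z" if R: "R \<in> edge_core G" for R
    using edge_core_D(1-4)[OF R] assms finite_subset[OF assms] by (intro card_Un_disjoint) auto
  show ?thesis by (subst sum.reindex[OF i]) (simp add: c)
qed

lemma star_union:
  assumes "H \<inter> {a, b} = {}"
  shows "{F\<in>K. H \<union> {a, b} \<subseteq> F} = (\<lambda>R. R \<union> {a, b}) ` edge_core H"
proof (intro equalityI subsetI)
  fix F assume F: "F \<in> {F\<in>K. H \<union> {a, b} \<subseteq> F}"
  then have "F = (F - {a,b}) \<union> {a,b}" "F - {a,b} \<in> edge_core H"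
    using assms by (auto simp: edge_core_def insert2_Diff2 insert_absorb)
  then show "F \<in> (\<lambda>R. R \<union> {a, b}) ` edge_core H" by blast
qed (auto simp: edge_core_def)

lemma star_h_ab:
  assumes "H \<inter> {a, b} = {}" "finite H"
  shows "star_h d K (H \<union> {a, b}) = (\<Sum>R\<in>edge_core H. h_term d (card H + 2) (card R + 2))"
proof -
  have "card (H \<union> {a, b}) = card H + 2" using assms ab by (subst card_Un_disjoint) auto
  then show ?thesis unfolding star_h_def star_union[OF assms(1)]
    using sum_core[of "{a,b}" "card H + 2" H] ab by simp
qed

lemma star_split:
  assumes "finite (G::'a set)"
  shows "star_h d K G = (\<Sum>F\<in>{F\<in>K. G \<subseteq> F \<and> \<not> {a,b} \<subseteq> F}. h_term d (card G) (card F)) +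
     (\<Sum>R\<in>edge_core (G - {a, b}). h_term d (card G) (card R + 2))"
proof -
  have e: "{F\<in>K. G \<subseteq> F} = {F\<in>K. G \<subseteq> F \<and> \<not> {a,b} \<subseteq> F} \<union> {F\<in>K. (G-{a,b}) \<union> {a,b} \<subseteq> F}"
    by auto
  have fin: "finite K" using abs_complexD[OF K] by blast
  show ?thesis unfolding star_h_def
    apply (subst e, subst sum.union_disjoint)
    using fin apply auto[3]
    apply (subst star_union)
     apply simp
    using sum_core[of "{a,b}" "card G" "G - {a,b}"] ab by simp
qed

text \<open>The conditions on \<open>a\<close> and \<open>b\<close> record which of the shapes
  \<open>R \<union> {x}\<close>, \<open>R \<union> {a, x}\<close>, \<open>R \<union> {b, x}\<close>
  can contain the part of \<open>G\<close> that lies in the edge.\<close>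

lemma sdiv_star_old:
  assumes "G \<in> K" "\<not> {a, b} \<subseteq> G"
  shows "{F\<in>sdiv K a b x. G \<subseteq> F} = {F\<in>K. G \<subseteq> F \<and> \<not> {a,b} \<subseteq> F} \<union>
     ((if a \<notin> G \<and> b \<notin> G then (\<lambda>R. R \<union> {x}) ` edge_core (G - {a, b}) else {}) \<union>
     ((if b \<notin> G then (\<lambda>R. R \<union> {a, x}) ` edge_core (G - {a, b}) else {}) \<union>
      (if a \<notin> G then (\<lambda>R. R \<union> {b, x}) ` edge_core (G - {a, b}) else {})))" (is "_ = ?A \<union> (?B \<union> (?C \<union> ?D))")
proof (intro equalityI subsetI)
  fix F assume F: "F \<in> {F\<in>sdiv K a b x. G \<subseteq> F}"
  show "F \<in> ?A \<union> (?B \<union> (?C \<union> ?D))"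
  proof (cases "x \<in> F")
    case False then show ?thesis using F by (auto simp: sdiv_def)
  next
    case True
    then obtain H where H: "F = insert x H" "insert a (insert b H) \<in> K" "\<not> {a, b} \<subseteq> H"
      using F x_neq by (auto simp: sdiv_def)
    have GH: "G \<subseteq> H" using F H x_neq(3)[OF assms(1)] by auto
    have c: "H - {a, b} \<in> edge_core (G - {a, b})" using H GH by (auto simp: edge_core_def insert2_Diff2 insert_absorb)
    consider "a \<notin> H" "b \<notin> H" | "a \<in> H" "b \<notin> H" | "a \<notin> H" "b \<in> H" using H(3) by blast
    then show ?thesis
    proof cases
      case 1 then have "F = (H - {a,b}) \<union> {x}" using H by auto
      then have "F \<in> ?B" using c 1 GH by auto
      then show ?thesis by blast
    next
      case 2 then have "F = (H - {a,b}) \<union> {a, x}" using H by auto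
      then have "F \<in> ?C" using c 2 GH by auto
      then show ?thesis by blast
    next
      case 3 then have "F = (H - {a,b}) \<union> {b, x}" using H by auto
      then have "F \<in> ?D" using c 3 GH by auto
      then show ?thesis by blast
    qed
  qed
next
  fix F assume "F \<in> ?A \<union> (?B \<union> (?C \<union> ?D))"
  then consider "F \<in> ?A" | R where "F = insert x R" "R \<in> edge_core (G - {a, b})" "a \<notin> G" "b \<notin> G"
    | R where "F = insert x (insert a R)" "R \<in> edge_core (G - {a, b})" "b \<notin> G"
    | R where "F = insert x (insert b R)" "R \<in> edge_core (G - {a, b})" "a \<notin> G"
    by (auto split: if_splits)
  then show "F \<in> {F\<in>sdiv K a b x. G \<subseteq> F}"
  proof cases
    case 1 then show ?thesis by (auto intro: sdiv_oldI)
  next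
    case (2 R)
    then have "F \<in> sdiv K a b x" using edge_core_D[OF 2(2)] by (auto intro: sdiv_newI)
    then show ?thesis using edge_core_D(6)[OF 2(2)] 2 by auto
  next
    case (3 R)
    have "insert a (insert b (insert a R)) \<in> K" using edge_core_D(8)[OF 3(2)] by (simp add: insert_commute)
    then have "F \<in> sdiv K a b x" using edge_core_D(3,4)[OF 3(2)] 3 ab by (auto intro!: sdiv_newI)
    then show ?thesis using edge_core_D(6)[OF 3(2)] 3 by auto
  next
    case (4 R)
    have "insert a (insert b (insert b R)) \<in> K" using edge_core_D(8)[OF 4(2)] by simp
    then have "F \<in> sdiv K a b x" using edge_core_D(3,4)[OF 4(2)] 4 ab by (auto intro!: sdiv_newI)
    then show ?thesis using edge_core_D(6)[OF 4(2)] 4 by auto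
  qed
qed

lemma core_images:
  shows "(\<lambda>R. R \<union> {x}) ` edge_core G \<inter> (\<lambda>R. R \<union> {a, x}) ` edge_core G = {}"
    "(\<lambda>R. R \<union> {x}) ` edge_core G \<inter> (\<lambda>R. R \<union> {b, x}) ` edge_core G = {}"
    "(\<lambda>R. R \<union> {a, x}) ` edge_core G \<inter> (\<lambda>R. R \<union> {b, x}) ` edge_core G = {}"
    "(\<lambda>R. R \<union> {x}) ` edge_core G \<inter> K = {}"
    "(\<lambda>R. R \<union> {a, x}) ` edge_core G \<inter> K = {}" "(\<lambda>R. R \<union> {b, x}) ` edge_core G \<inter> K = {}"
proof -
  have disj: "f ` X \<inter> Y = {}" if "\<And>R. R \<in> X \<Longrightarrow> p \<in> f R" "\<And>R. R \<in> Y \<Longrightarrow> p \<notin> R"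
    for f :: "'a set \<Rightarrow> 'a set" and X Y p
    using that by fastforce
  have abx: "a \<notin> R \<union> {x}" "b \<notin> R \<union> {x}" "b \<notin> R \<union> {a, x}" if "R \<in> edge_core G" for R
    using edge_core_D[OF that] x_neq ab by auto
  have "(\<lambda>R. R \<union> {a, x}) ` edge_core G \<inter> (\<lambda>R. R \<union> {x}) ` edge_core G = {}"
    by (rule disj[of _ a]) (use abx in auto)
  then show "(\<lambda>R. R \<union> {x}) ` edge_core G \<inter> (\<lambda>R. R \<union> {a, x}) ` edge_core G = {}"
    by (simp only: Int_commute)
  have "(\<lambda>R. R \<union> {b, x}) ` edge_core G \<inter> (\<lambda>R. R \<union> {x}) ` edge_core G = {}"
    by (rule disj[of _ b]) (use abx in auto)
  then show "(\<lambda>R. R \<union> {x}) ` edge_core G \<inter> (\<lambda>R. R \<union> {b, x}) ` edge_core G = {}"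
    by (simp only: Int_commute)
  have "(\<lambda>R. R \<union> {b, x}) ` edge_core G \<inter> (\<lambda>R. R \<union> {a, x}) ` edge_core G = {}"
    by (rule disj[of _ b]) (use abx in auto)
  then show "(\<lambda>R. R \<union> {a, x}) ` edge_core G \<inter> (\<lambda>R. R \<union> {b, x}) ` edge_core G = {}"
    by (simp only: Int_commute)
  show "(\<lambda>R. R \<union> {x}) ` edge_core G \<inter> K = {}"
    "(\<lambda>R. R \<union> {a, x}) ` edge_core G \<inter> K = {}" "(\<lambda>R. R \<union> {b, x}) ` edge_core G \<inter> K = {}"
    by (rule disj[of _ x]; use x_neq(3) in simp)+
qed

lemma core_sums:
  "(\<Sum>F\<in>(\<lambda>R. R \<union> {x}) ` edge_core G. h_term d g (card F)) = (\<Sum>R\<in>edge_core G. h_term d g (card R + 1))"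
  "(\<Sum>F\<in>(\<lambda>R. R \<union> {a, x}) ` edge_core G. h_term d g (card F)) = (\<Sum>R\<in>edge_core G. h_term d g (card R + 2))"
  "(\<Sum>F\<in>(\<lambda>R. R \<union> {b, x}) ` edge_core G. h_term d g (card F)) = (\<Sum>R\<in>edge_core G. h_term d g (card R + 2))"
proof -
  have "card {a, x} = 2" "card {b, x} = 2" using x_neq by auto
  then show "(\<Sum>F\<in>(\<lambda>R. R \<union> {x}) ` edge_core G. h_term d g (card F)) = (\<Sum>R\<in>edge_core G. h_term d g (card R + 1))"
  "(\<Sum>F\<in>(\<lambda>R. R \<union> {a, x}) ` edge_core G. h_term d g (card F)) = (\<Sum>R\<in>edge_core G. h_term d g (card R + 2))"
  "(\<Sum>F\<in>(\<lambda>R. R \<union> {b, x}) ` edge_core G. h_term d g (card F)) = (\<Sum>R\<in>edge_core G. h_term d g (card R + 2))"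
    by (subst sum_core; simp)+
qed

lemma star_h_sdiv_old:
  assumes G: "G \<in> K" "\<not> {a, b} \<subseteq> G"
  shows "star_h d (sdiv K a b x) G = (\<Sum>F\<in>{F\<in>K. G \<subseteq> F \<and> \<not> {a,b} \<subseteq> F}. h_term d (card G) (card F)) +
     ((if a \<notin> G \<and> b \<notin> G then (\<Sum>R\<in>edge_core (G - {a, b}). h_term d (card G) (card R + 1)) else 0) +
     ((if b \<notin> G then (\<Sum>R\<in>edge_core (G - {a, b}). h_term d (card G) (card R + 2)) else 0) +
     (if a \<notin> G then (\<Sum>R\<in>edge_core (G - {a, b}). h_term d (card G) (card R + 2)) else 0)))"
proof -
  have fin: "finite K" using abs_complexD[OF K] by blast
  define A where "A = {F\<in>K. G \<subseteq> F \<and> \<not> {a,b} \<subseteq> F}"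
  have A: "finite A" "A \<inter> Z = {}" if "Z \<inter> K = {}" for Z using that fin by (auto simp: A_def)
  have A': "A \<inter> (if P then (\<lambda>R. R \<union> {x}) ` edge_core (G - {a, b}) else {}) = {}"
    "A \<inter> (if P then (\<lambda>R. R \<union> {a, x}) ` edge_core (G - {a, b}) else {}) = {}"
    "A \<inter> (if P then (\<lambda>R. R \<union> {b, x}) ` edge_core (G - {a, b}) else {}) = {}" for P
    using A(2)[OF core_images(4)] A(2)[OF core_images(5)] A(2)[OF core_images(6)] by simp_all
  have if_disj: "(if P then X else {}) \<inter> (if Q then Y else {}) = {}" if "X \<inter> Y = {}" for P Q and X Y :: "'a set set"
    using that by auto
  have if_sum: "sum f (if P then X else {}) = (if P then sum f X else 0)" for P and X :: "'a set set" and f :: "'a set \<Rightarrow> int poly"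
    by simp
  have fini: "finite (if P then (\<lambda>R. R \<union> Z) ` edge_core (G - {a, b}) else {})" for P Z
    using finite_core by simp
  have "finite A" using A(1) by blast
  then show ?thesis
    unfolding star_h_def sdiv_star_old[OF G] A_def[symmetric]
    by (simp only: sum_Un4 fini A' if_disj core_images core_sums if_sum)
qed

text \<open>One of the two new families of size \<open>card R + 2\<close> makes up for the removed
  faces through the edge. The other one and the family of size \<open>card R + 1\<close> are the
  surplus, evaluated by \<open>h_term_rel(1)\<close>.\<close>

lemma star_h_sdiv_out:
  assumes "G \<in> K" "a \<notin> G" "b \<notin> G"
  shows "star_h d (sdiv K a b x) G = star_h d K G + [:0, 1:] * star_h d K (G \<union> {a, b})"
proof -
  have f: "finite G" using assms abs_complexD[OF K] by blast
  have gab: "G - {a, b} = G" using assms by auto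
  have "(\<Sum>R\<in>edge_core G. h_term d (card G) (card R + 1)) + (\<Sum>R\<in>edge_core G. h_term d (card G) (card R + 2))
     = [:0, 1:] * (\<Sum>R\<in>edge_core G. h_term d (card G + 2) (card R + 2))"
    unfolding sum.distrib[symmetric] sum_distrib_left
    by (intro sum.cong refl h_term_rel(1)) (use edge_core_D in auto)
  then show ?thesis
    using assms by (simp add: star_h_sdiv_old star_split[OF f] star_h_ab f gab algebra_simps del: Un_insert_right)
qed

text \<open>Around a face through \<open>a\<close> the new vertex \<open>x\<close> takes over the
  role of \<open>b\<close>, so the link is only renamed.\<close>

lemma star_h_sdiv_end:
  assumes "G \<in> K" "a \<in> G" "b \<notin> G"
  shows "star_h d (sdiv K a b x) G = star_h d K G"
proof -
  have f: "finite G" using assms abs_complexD[OF K] by blast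
  show ?thesis
    using assms by (simp add: star_h_sdiv_old star_split[OF f] f)
qed

lemma star_h_sdiv_end':
  assumes "G \<in> K" "b \<in> G" "a \<notin> G"
  shows "star_h d (sdiv K a b x) G = star_h d K G"
proof -
  have f: "finite G" using assms abs_complexD[OF K] by blast
  show ?thesis
    using assms by (simp add: star_h_sdiv_old star_split[OF f] f)
qed

text \<open>The link of \<open>x\<close> is the suspension, with apexes \<open>a\<close> and
  \<open>b\<close>, of the link of the edge, and a suspension multiplies the
  \<open>h\<close>-polynomial by \<open>1 + t\<close>.\<close>

lemma star_h_sdiv_new:
  assumes "H \<union> {a, b} \<in> K" "a \<notin> H" "b \<notin> H"
  shows "star_h d (sdiv K a b x) (insert x H) = [:1, 1:] * star_h d K (H \<union> {a, b})"
proof -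
  have f: "finite H" using assms abs_complexD(3)[OF K assms(1)] by auto
  have xH: "x \<notin> H" using x_neq(3)[OF assms(1)] by auto
  have e: "{F\<in>sdiv K a b x. insert x H \<subseteq> F} = {} \<union> ((\<lambda>R. R \<union> {x}) ` edge_core H \<union>
     ((\<lambda>R. R \<union> {a, x}) ` edge_core H \<union> (\<lambda>R. R \<union> {b, x}) ` edge_core H))" (is "?L = ?R")
  proof -
    have "?L = {F\<in>sdiv K a b x. H \<subseteq> F} \<inter> {F. x \<in> F}" by auto
    also have "\<dots> = ?R"
      using assms abs_complexD(5)[OF K assms(1), of H] x_neq(3)
      by (subst sdiv_star_old) auto
    finally show ?thesis .
  qed
  have "star_h d (sdiv K a b x) (insert x H) = 
     (\<Sum>R\<in>edge_core H. h_term d (card H + 1) (card R + 1)) + ((\<Sum>R\<in>edge_core H. h_term d (card H + 1) (card R + 2)) +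
     (\<Sum>R\<in>edge_core H. h_term d (card H + 1) (card R + 2)))"
    unfolding star_h_def e using f xH finite_core
    by (subst sum_Un4) (simp_all only: finite_imageI core_images core_sums
         finite.emptyI Int_empty_right Int_empty_left sum.empty card_insert_disjoint not_False_eq_True Suc_eq_plus1 add_0_left)
  also have "\<dots> = (\<Sum>R\<in>edge_core H. h_term d (card H + 1) (card R + 1) + 2 * h_term d (card H + 1) (card R + 2))"
    by (simp add: sum.distrib sum_distrib_left)
  also have "\<dots> = [:1, 1:] * (\<Sum>R\<in>edge_core H. h_term d (card H + 2) (card R + 2))"
    unfolding sum_distrib_left
    by (intro sum.cong refl h_term_rel(2)) (use edge_core_D in auto)
  finally show ?thesis using assms f by (subst star_h_ab) auto
qed

text \<open>Only the family \<open>R \<union> {b, x}\<close> contains both \<open>x\<close> and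
  \<open>b\<close>, and its members have the sizes of the former faces
  \<open>R \<union> {a, b}\<close>.\<close>

lemma star_h_sdiv_new_end:
  assumes "H \<union> {a, b} \<in> K" "a \<notin> H" "b \<notin> H"
  shows "star_h d (sdiv K a b x) (insert x (insert b H)) = star_h d K (H \<union> {a, b})"
proof -
  have f: "finite H" using assms abs_complexD(3)[OF K assms(1)] by auto
  have xH: "x \<notin> H" using x_neq(3)[OF assms(1)] by auto
  have bH: "insert b H \<in> K" by (rule abs_complexD(5)[OF K assms(1)]) auto
  have e: "{F\<in>sdiv K a b x. insert x (insert b H) \<subseteq> F} = (\<lambda>R. R \<union> {b, x}) ` edge_core H" (is "?L = ?R")
  proof -
    have g: "insert b H - {a,b} = H" using assms by auto
    have "?L = {F\<in>sdiv K a b x. insert b H \<subseteq> F} \<inter> {F. x \<in> F}" by auto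
    also have "\<dots> = ?R"
      using assms bH x_neq(3) ab g
      by (subst sdiv_star_old) auto
    finally show ?thesis .
  qed
  note core_sums(3)[of "card H + 2" H]
  moreover have "card (insert x (insert b H)) = card H + 2" using f xH assms x_neq by simp
  ultimately show ?thesis using assms f unfolding star_h_def[of d "sdiv K a b x"] e by (subst star_h_ab) auto
qed

end

section \<open>Realization by polytopes\<close>

definition flag_abs :: "'a set set \<Rightarrow> bool" where
  "flag_abs K \<longleftrightarrow> (\<forall>V. finite V \<longrightarrow> (\<forall>G\<subseteq>V. card G \<le> 2 \<longrightarrow> G \<in> K) \<longrightarrow> V \<in> K)"

definition cone_of :: "'a::real_vector set \<Rightarrow> 'a set" where
  "cone_of F = {y. \<exists>l. (\<forall>v\<in>F. 0 \<le> l v) \<and> y = (\<Sum>v\<in>F. l v *\<^sub>R v)}"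

text \<open>
  The faces span a complete simplicial fan, and the functional of a facet exposes this facet as a
  face of the convex hull of all vertices.
\<close>

definition realizes :: "'a::euclidean_space set set \<Rightarrow> bool" where
  "realizes K \<longleftrightarrow> abs_complex DIM('a) K \<and> flag_abs K \<and>
     (\<forall>G\<in>K. \<exists>F\<in>K. G \<subseteq> F \<and> card F = DIM('a)) \<and>
     (\<forall>F\<in>K. card F = DIM('a) \<longrightarrow> independent F \<and>
        (\<exists>f::'a \<Rightarrow> real. linear f \<and> (\<forall>v\<in>F. f v = 1) \<and> (\<forall>v\<in>\<Union>K - F. f v < 1))) \<and>
     (\<forall>y. \<exists>F\<in>K. y \<in> cone_of F)"

section \<open>Edge subdivision of realized complexes\<close>

lemma sdiv_commute: "sdiv K a b x = sdiv K b a x"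
  by (simp add: sdiv_def insert_commute)

lemma Union_sdiv: "\<Union>(sdiv K a b x) \<subseteq> insert x (\<Union>K)"
  by (auto simp: sdiv_def)

lemma abs_complex_sdiv:
  assumes K: "abs_complex d K" and "a \<noteq> b"
  shows "abs_complex d (sdiv K a b x)"
proof -
  note KD = abs_complexD[OF K]
  have "finite (sdiv K a b x)"
  proof -
    have "{G. insert a (insert b G) \<in> K \<and> \<not> {a, b} \<subseteq> G} \<subseteq> \<Union>(Pow ` K)" by auto
    moreover have "finite (\<Union>(Pow ` K))" using KD by simp
    ultimately show ?thesis using KD unfolding sdiv_def by (simp add: finite_subset)
  qed
  moreover have "{} \<in> sdiv K a b x" using KD by (auto simp: sdiv_def)
  moreover have "finite F \<and> card F \<le> d" if F: "F \<in> sdiv K a b x" for F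
  proof (cases "F \<in> K")
    case False
    then obtain G where G: "F = insert x G" "insert a (insert b G) \<in> K" "\<not> {a, b} \<subseteq> G"
      using F by (auto simp: sdiv_def)
    have fin: "finite G" using KD(3)[OF G(2)] by simp
    have "card F \<le> card G + 1" using fin G by (simp add: card_insert_if)
    also have "\<dots> \<le> card (insert a (insert b G))" using fin G assms(2) by (auto simp: card_insert_if)
    finally show ?thesis using KD(4)[OF G(2)] fin G by simp
  qed (use KD in auto)
  moreover have "G \<in> sdiv K a b x" if F: "F \<in> sdiv K a b x" and GF: "G \<subseteq> F" for F G
  proof -
    consider "F \<in> K" "\<not> {a, b} \<subseteq> F" | H where "F = insert x H" "insert a (insert b H) \<in> K" "\<not> {a, b} \<subseteq> H"
      using F by (auto simp: sdiv_def)
    then show ?thesis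
    proof cases
      case 1 then show ?thesis using KD(5) GF by (intro sdiv_oldI) blast+
    next
      case (2 H)
      show ?thesis
      proof (cases "x \<in> G")
        case True
        have "insert a (insert b (G \<inter> H)) \<in> K" by (rule KD(5)[OF 2(2)]) auto
        then have "insert x (G \<inter> H) \<in> sdiv K a b x" using 2 by (intro sdiv_newI) auto
        moreover have "insert x (G \<inter> H) = G" using True GF 2 by auto
        ultimately show ?thesis by simp
      next
        case False
        then have "G \<subseteq> H" using GF 2 by auto
        then show ?thesis using KD(5)[OF 2(2), of G] 2 by (intro sdiv_oldI) auto
      qed
    qed
  qed
  ultimately show ?thesis unfolding abs_complex_def by blast
qed

text \<open>Each further vertex of a clique through \<open>x\<close> spans a face of
  \<open>K\<close> with the edge. So the clique, with \<open>x\<close> replaced by \<open>a\<close>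
  and \<open>b\<close>, is a clique and hence a face of \<open>K\<close>. It cannot contain both
  endpoints, because they are no longer adjacent.\<close>

lemma flag_sdiv:
  assumes K: "abs_complex d K" and flag: "flag_abs K" and x: "x \<notin> \<Union>K" and ab: "a \<noteq> b" "{a, b} \<in> K"
  shows "flag_abs (sdiv K a b x)"
  unfolding flag_abs_def
proof (intro allI impI)
  fix V assume fin: "finite V" and V: "\<forall>G\<subseteq>V. card G \<le> 2 \<longrightarrow> G \<in> sdiv K a b x"
  note KD = abs_complexD[OF K]
  have xK: "x \<notin> F" if "F \<in> K" for F using x that by blast
  have old: "F \<in> K \<and> \<not> {a, b} \<subseteq> F" if "F \<in> sdiv K a b x" "x \<notin> F" for F
    using that by (auto simp: sdiv_def)
  have xab: "x \<noteq> a" "x \<noteq> b" using xK[OF ab(2)] by auto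
  show "V \<in> sdiv K a b x"
  proof (cases "x \<in> V")
    case False
    have "V \<in> K" using flag fin V old False unfolding flag_abs_def by blast
    moreover have "\<not> {a, b} \<subseteq> V"
    proof
      assume s: "{a, b} \<subseteq> V"
      then have "{a,b} \<in> sdiv K a b x" using V ab by (simp add: card_insert_if)
      then show False using old xab by blast
    qed
    ultimately show ?thesis by (rule sdiv_oldI)
  next
    case True
    define H where "H = V - {x}"
    have VH: "V = insert x H" "x \<notin> H" using True by (auto simp: H_def)
    have "insert a (insert b {v}) \<in> K" if "v \<in> H" for v
    proof -
      have "{x, v} \<in> sdiv K a b x" using V that VH by (auto simp: card_insert_if)
      then obtain G where G: "{x, v} = insert x G" "insert a (insert b G) \<in> K"
        using xK by (auto simp: sdiv_def)
      then have "v \<in> G" using that VH by auto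
      then show ?thesis by (intro KD(5)[OF G(2)]) auto
    qed
    moreover have "insert a (insert b {v}) = {a, b}" if "v = a \<or> v = b" for v using that by auto
    ultimately have v3: "insert a (insert b {v}) \<in> K" if "v \<in> H \<or> v = a \<or> v = b" for v
      using that ab by metis
    have "insert a (insert b H) \<in> K"
    proof -
      have "G \<in> K" if G: "G \<subseteq> insert a (insert b H)" "card G \<le> 2" for G
      proof (cases "G \<subseteq> H")
        case True
        then show ?thesis using V old G VH by blast
      next
        case False
        have fG: "finite G" using G fin VH by (meson finite_insert finite_subset)
        from False obtain p where p: "p \<in> G" "p = a \<or> p = b" using G by auto
        have "card (G - {p}) \<le> 1" using p G fG by simp
        then obtain q where "G - {p} \<subseteq> {q}" "q \<in> insert a (insert b H)"
        proof (cases "G - {p} = {}")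
          case False
          then obtain q where q: "q \<in> G - {p}" by blast
          then have "G - {p} = {q}" using \<open>card (G - {p}) \<le> 1\<close> fG
            by (metis One_nat_def card_1_singletonE card_gt_0_iff empty_iff finite_Diff le_antisym Suc_leI singletonD)
          then show thesis using that[of q] q G by blast
        qed blast
        then have "G \<subseteq> insert a (insert b {q})" "q \<in> H \<or> q = a \<or> q = b" using p by auto
        then show ?thesis using KD(5)[OF v3] by blast
      qed
      then show ?thesis using flag fin VH unfolding flag_abs_def by (metis finite_insert)
    qed
    moreover have "\<not> {a, b} \<subseteq> H"
    proof
      assume s: "{a, b} \<subseteq> H"
      then have "{a,b} \<in> sdiv K a b x" using V ab VH by (simp add: card_insert_if)
      then show False using old xab by blast
    qed
    ultimately show ?thesis unfolding VH(1) by (rule sdiv_newI)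
  qed
qed

lemma cone_ofI: "(\<And>v. v \<in> F \<Longrightarrow> 0 \<le> l v) \<Longrightarrow> y = (\<Sum>v\<in>F. l v *\<^sub>R v) \<Longrightarrow> y \<in> cone_of F"
  unfolding cone_of_def by blast

lemma cone_insert:
  assumes "finite F" "p \<notin> F"
  shows "y \<in> cone_of (insert p F) \<longleftrightarrow> (\<exists>t z. 0 \<le> t \<and> z \<in> cone_of F \<and> y = t *\<^sub>R p + z)"
proof
  assume "y \<in> cone_of (insert p F)"
  then obtain l where l: "\<forall>v\<in>insert p F. 0 \<le> l v" "y = (\<Sum>v\<in>insert p F. l v *\<^sub>R v)"
    unfolding cone_of_def by auto
  then show "\<exists>t z. 0 \<le> t \<and> z \<in> cone_of F \<and> y = t *\<^sub>R p + z"
    using assms by (intro exI[of _ "l p"] exI[of _ "\<Sum>v\<in>F. l v *\<^sub>R v"]) (auto intro: cone_ofI)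
next
  assume "\<exists>t z. 0 \<le> t \<and> z \<in> cone_of F \<and> y = t *\<^sub>R p + z"
  then obtain t l where l: "0 \<le> t" "\<forall>v\<in>F. 0 \<le> l v" "y = t *\<^sub>R p + (\<Sum>v\<in>F. l v *\<^sub>R v)"
    unfolding cone_of_def by auto
  have "(\<Sum>v\<in>F. l v *\<^sub>R v) = (\<Sum>v\<in>F. (l(p := t)) v *\<^sub>R v)"
    using assms by (intro sum.cong) auto
  then show "y \<in> cone_of (insert p F)"
    using l assms by (intro cone_ofI[of _ "l(p := t)"]) auto
qed

text \<open>From \<open>l a + m b = (l - m) a + m (a + b)\<close>: for \<open>m \<le> l\<close> the
  point lies in the half of the cone next to \<open>a\<close>. The other half is obtained by
  exchanging \<open>a\<close> and \<open>b\<close>.\<close>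

lemma cone_sdiv_aux:
  assumes K: "abs_complex d K" and x: "x \<notin> \<Union>K" "x = s *\<^sub>R (a + b)" "s > 0" and ab: "a \<noteq> b"
    and R: "insert a (insert b R) \<in> K" "a \<notin> R" "b \<notin> R"
    and y: "y = l *\<^sub>R a + (m *\<^sub>R b + z)" "z \<in> cone_of R" "0 \<le> m" "m \<le> l"
  shows "\<exists>F\<in>sdiv K a b x. y \<in> cone_of F"
proof -
  have fR: "finite R" using abs_complexD(3)[OF K R(1)] by simp
  have xR: "x \<notin> insert a (insert b R)" using x R by blast
  have "insert a (insert b (insert a R)) \<in> K" using R(1) by (simp add: insert_commute)
  then have "insert x (insert a R) \<in> sdiv K a b x" using R ab by (intro sdiv_newI) auto
  moreover have "(l - m) *\<^sub>R a + z \<in> cone_of (insert a R)"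
    using fR R y by (subst cone_insert) (auto intro!: exI[of _ "l - m"])
  then have "(m / s) *\<^sub>R x + ((l - m) *\<^sub>R a + z) \<in> cone_of (insert x (insert a R))"
    using fR xR x y by (subst cone_insert) (auto intro!: exI[of _ "m / s"])
  moreover have "y = (m / s) *\<^sub>R x + ((l - m) *\<^sub>R a + z)"
    using x y by (simp add: algebra_simps)
  ultimately show ?thesis by auto
qed

lemma cone_sdiv:
  assumes K: "abs_complex d K" and x: "x \<notin> \<Union>K" "x = s *\<^sub>R (a + b)" "s > 0" and ab: "a \<noteq> b"
    and cov: "\<exists>F\<in>K. y \<in> cone_of F"
  shows "\<exists>F\<in>sdiv K a b x. y \<in> cone_of F"
proof -
  obtain F where F: "F \<in> K" "y \<in> cone_of F" using cov by blast
  show ?thesis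
  proof (cases "{a, b} \<subseteq> F")
    case False then show ?thesis using sdiv_oldI[OF F(1) False, of x] F(2) by blast
  next
    case True
    define R where "R = F - {a, b}"
    have FR: "F = insert a (insert b R)" "a \<notin> R" "b \<notin> R" using True by (auto simp: R_def)
    have fR: "finite R" using abs_complexD(3)[OF K F(1)] by (simp add: R_def)
    obtain l m z where z: "0 \<le> l" "0 \<le> m" "z \<in> cone_of R" "y = l *\<^sub>R a + (m *\<^sub>R b + z)"
      using F(2) FR fR ab by (auto simp: cone_insert)
    show ?thesis
    proof (cases "m \<le> l")
      case True
      then show ?thesis using cone_sdiv_aux[OF K x ab _ FR(2,3) z(4,3,2)] F FR by simp
    next
      case False
      have "x = s *\<^sub>R (b + a)" "y = m *\<^sub>R b + (l *\<^sub>R a + z)" using x z by (simp_all add: algebra_simps)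
      moreover have "insert b (insert a R) \<in> K" using F FR by (simp add: insert_commute)
      ultimately show ?thesis
        using cone_sdiv_aux[OF K x(1) _ x(3) ab[symmetric] _ FR(3,2) _ z(3,1)] False
        by (simp add: sdiv_commute[of K a b])
    qed
  qed
qed

lemma independent_swap:
  assumes "independent (insert a (insert b R))" "a \<notin> insert b R" "x = s *\<^sub>R (a + b)" "s \<noteq> 0"
  shows "independent (insert x (insert b R))"
proof -
  have i: "independent (insert b R)" "a \<notin> span (insert b R)"
    using assms(1,2) by (auto simp: independent_insert)
  have x: "x \<notin> span (insert b R)"
  proof
    assume "x \<in> span (insert b R)"
    then have "(1 / s) *\<^sub>R x - b \<in> span (insert b R)"
      by (meson insertI1 span_base span_diff span_scale)
    moreover have "(1 / s) *\<^sub>R x - b = a" using assms(3,4) by simp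
    ultimately show False using i(2) by simp
  qed
  then have "x \<notin> insert b R" using span_base by blast
  then show ?thesis using i(1) x independent_insert[of x "insert b R"] by presburger
qed

lemma realizesD:
  fixes K :: "'a::euclidean_space set set"
  assumes "realizes K"
  shows "abs_complex DIM('a) K" "flag_abs K" "G \<in> K \<Longrightarrow> \<exists>F\<in>K. G \<subseteq> F \<and> card F = DIM('a)"
    "F \<in> K \<Longrightarrow> card F = DIM('a) \<Longrightarrow> independent F"
    "F \<in> K \<Longrightarrow> card F = DIM('a) \<Longrightarrow> 
        \<exists>f::'a \<Rightarrow> real. linear f \<and> (\<forall>v\<in>F. f v = 1) \<and> (\<forall>v\<in>\<Union>K - F. f v < 1)"
    "\<exists>F\<in>K. y \<in> cone_of F"
  using assms unfolding realizes_def by blast+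

text \<open>
  Here \<open>g\<close> is the coordinate of \<open>a\<close> in the basis \<open>F\<close>: the functional \<open>f - \<delta> g\<close> still has the value 1
  on \<open>F - {a}\<close>, and the scaling of \<open>x\<close> makes its value at \<open>x\<close> equal to 1 as well.
\<close>

lemma facet_swap:
  fixes K :: "'a::euclidean_space set set"
  assumes R: "F \<in> K" "F = insert a (insert b R)" "a \<notin> insert b R" "b \<notin> R"
    and ind: "independent F"
    and x: "x = (1 / (2 - \<delta>)) *\<^sub>R (a + b)" "0 < \<delta>" "\<delta> < 1"
    and f: "linear f" "\<forall>v\<in>F. f v = 1" "\<forall>v\<in>\<Union>K - F. f v < 1"
    and g: "linear g" "g a = 1" "\<forall>v\<in>F - {a}. g v = 0"
    and small: "\<forall>v\<in>\<Union>K - F. f v - \<delta> * g v < 1"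
  shows "independent (insert x (insert b R)) \<and>
        (\<exists>f::'a \<Rightarrow> real. linear f \<and> (\<forall>v\<in>insert x (insert b R). f v = 1) \<and>
          (\<forall>v\<in>insert x (\<Union>K) - insert x (insert b R). f v < 1))"
proof (intro conjI exI ballI)
  show "independent (insert x (insert b R))"
    using independent_swap[OF ind[unfolded R(2)] R(3) x(1)] x by simp
  show "linear (\<lambda>v. f v - \<delta> * g v)"
    using linear_compose_sub[OF f(1) linear_compose_scale_right[OF g(1), of \<delta>]] by simp
  fix v
  have fab: "f a = 1" "f b = 1" "g b = 0" using f g R by auto
  have fgx: "f x = 2 / (2 - \<delta>)" "g x = 1 / (2 - \<delta>)"
    using x fab g(2) by (simp_all add: linear_scale[OF f(1)] linear_scale[OF g(1)] linear_add[OF f(1)] linear_add[OF g(1)])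
  show "f v - \<delta> * g v = 1" if "v \<in> insert x (insert b R)"
  proof (cases "v = x")
    case True
    have "2 / u - \<delta> / u = 1" if "u = 2 - \<delta>" "u \<noteq> 0" for u
      using that by (simp add: diff_divide_distrib[symmetric])
    then have "f x - \<delta> * g x = 1" unfolding fgx using x by simp
    then show ?thesis using True by simp
  next
    case False
    then have "v \<in> F" "v \<noteq> a" using that R by auto
    then show ?thesis using f g by simp
  qed
  show "f v - \<delta> * g v < 1" if "v \<in> insert x (\<Union>K) - insert x (insert b R)"
  proof (cases "v = a")
    case True
    then show ?thesis using fab g x by simp
  next
    case False
    then show ?thesis using that R small by auto
  qed
qed

lemma dual_functional:
  fixes F :: "'a::euclidean_space set"
  assumes "independent F" "p \<in> F"
  shows "\<exists>g::'a \<Rightarrow> real. linear g \<and> g p = 1 \<and> (\<forall>v\<in>F - {p}. g v = 0)"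
proof -
  obtain g :: "'a \<Rightarrow> real" where "linear g" "\<forall>v\<in>F. g v = (if v = p then 1 else 0)"
    using linear_independent_extend[OF assms(1), of "\<lambda>v. if v = p then 1 else 0 :: real"] by blast
  then show ?thesis using assms by (intro exI[of _ g]) auto
qed

lemma eventually_small:
  fixes u w :: real
  assumes "u < 1"
  shows "eventually (\<lambda>\<delta>. u - \<delta> * w < 1) (at_right 0)"
proof -
  have "((\<lambda>\<delta>. u - \<delta> * w) \<longlongrightarrow> u - 0 * w) (at_right 0)" by (intro tendsto_intros)
  then show ?thesis using assms by (simp add: order_tendstoD)
qed

text \<open>The vertex \<open>x\<close> is the midpoint of the edge pushed outwards by the factor
  \<open>2 / (2 - \<delta>)\<close>. It has to lie beyond the facets through the edge and beneath
  all others, and the tilted functionals must stay below 1 at the remaining vertices. These are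
  finitely many strict inequalities which hold at \<open>\<delta> = 0\<close> or for every positive
  \<open>\<delta> < 1\<close>, so a small \<open>\<delta>\<close> serves them all.\<close>

lemma realizes_sdiv:
  fixes K :: "'a::euclidean_space set set"
  assumes real: "realizes K" and ab: "a \<noteq> b" "{a, b} \<in> K"
  shows "\<exists>x. x \<notin> \<Union>K \<and> realizes (sdiv K a b x)"
proof -
  note K = realizesD(1)[OF real]
  note KD = abs_complexD[OF K]
  define \<F> where "\<F> = {F\<in>K. card F = DIM('a)}"
  have fin: "finite \<F>" "finite (\<Union>K)" using KD by (auto simp: \<F>_def)
  obtain f where f: "\<And>F. F \<in> \<F> \<Longrightarrow> linear (f F :: 'a \<Rightarrow> real)" 
    "\<And>F. F \<in> \<F> \<Longrightarrow> \<forall>v\<in>F. f F v = 1" "\<And>F. F \<in> \<F> \<Longrightarrow> \<forall>v\<in>\<Union>K - F. f F v < 1"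
    using realizesD(5)[OF real] unfolding \<F>_def by (metis (mono_tags, lifting) mem_Collect_eq)
  have ind: "independent F" if "F \<in> \<F>" for F using realizesD(4)[OF real] that by (auto simp: \<F>_def)
  obtain g where g: "\<And>F p. F \<in> \<F> \<Longrightarrow> p \<in> F \<Longrightarrow> linear (g F p :: 'a \<Rightarrow> real) \<and> g F p p = 1 \<and> (\<forall>v\<in>F - {p}. g F p v = 0)"
    using dual_functional[OF ind] by metis
  have fless: "f F v < 1" if "F \<in> \<F>" "v \<in> \<Union>K" "v \<notin> F" for F v
    using f(3)[OF that(1)] that by simp
  have fle: "f F v \<le> 1" if "F \<in> \<F>" "v \<in> \<Union>K" for F v
    using fless[OF that] f(2)[OF that(1)] by (cases "v \<in> F") simp_all
  have abU: "a \<in> \<Union>K" "b \<in> \<Union>K" using ab(2) by blast+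
  have "eventually (\<lambda>\<delta>. \<forall>F\<in>\<F>. \<forall>p\<in>{a, b}. \<forall>v\<in>\<Union>K - F. f F v - \<delta> * g F p v < 1) (at_right (0::real))"
  proof (intro eventually_ball_finite ballI eventually_small)
    show "f F v < 1" if "F \<in> \<F>" "v \<in> \<Union>K - F" for F v using fless that by blast
  qed (use fin in auto)
  \<comment> \<open>This is \<open>f a + f b < 2 - \<delta>\<close> in the shape of
    \<open>eventually_small\<close>; it places \<open>x\<close> beneath the facets that miss an
    endpoint.\<close>
  moreover have "eventually (\<lambda>\<delta>. \<forall>F\<in>{F\<in>\<F>. \<not> {a,b} \<subseteq> F}. f F a + f F b - 1 - \<delta> * (-1) < 1) (at_right (0::real))"
  proof (intro eventually_ball_finite ballI eventually_small)
    fix F assume F: "F \<in> {F\<in>\<F>. \<not> {a,b} \<subseteq> F}"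
    then have F': "F \<in> \<F>" and "a \<notin> F \<or> b \<notin> F" by auto
    then show "f F a + f F b - 1 < 1" 
      using fless[OF F' abU(1)] fless[OF F' abU(2)] fle[OF F' abU(1)] fle[OF F' abU(2)] by linarith
  qed (use fin in auto)
  moreover have "eventually (\<lambda>\<delta>. 0 < \<delta> \<and> \<delta> < 1) (at_right (0::real))"
    by (auto simp: eventually_at_right_field intro!: exI[of _ 1])
  ultimately have "eventually (\<lambda>\<delta>. (\<forall>F\<in>\<F>. \<forall>p\<in>{a, b}. \<forall>v\<in>\<Union>K - F. f F v - \<delta> * g F p v < 1) \<and>
      (\<forall>F\<in>{F\<in>\<F>. \<not> {a,b} \<subseteq> F}. f F a + f F b - 1 - \<delta> * (-1) < 1) \<and> 0 < \<delta> \<and> \<delta> < 1) (at_right (0::real))"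
    by (rule eventually_conj[OF _ eventually_conj])
  from eventually_happens'[OF trivial_limit_at_right_real this] obtain \<delta> :: real where 
    \<delta>3: "(\<forall>F\<in>\<F>. \<forall>p\<in>{a, b}. \<forall>v\<in>\<Union>K - F. f F v - \<delta> * g F p v < 1) \<and>
      (\<forall>F\<in>{F\<in>\<F>. \<not> {a,b} \<subseteq> F}. f F a + f F b - 1 - \<delta> * (-1) < 1) \<and> 0 < \<delta> \<and> \<delta> < 1"
    by blast
  then have \<delta>: "0 < \<delta>" "\<delta> < 1"
    and s1: "\<And>F p. F \<in> \<F> \<Longrightarrow> p \<in> {a, b} \<Longrightarrow> \<forall>v\<in>\<Union>K - F. f F v - \<delta> * g F p v < 1"
    by blast+
  have s2: "f F a + f F b + \<delta> < 2" if "F \<in> \<F>" "\<not> {a,b} \<subseteq> F" for F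
    using \<delta>3 that by fastforce
  define x where "x = (1 / (2 - \<delta>)) *\<^sub>R (a + b)"
  have x': "x = (1 / (2 - \<delta>)) *\<^sub>R (b + a)" by (simp add: x_def add.commute)
  have fx: "f F x = (f F a + f F b) / (2 - \<delta>)" if "F \<in> \<F>" for F
    using f(1)[OF that] by (simp add: x_def linear_scale linear_add add_divide_distrib)
  have xK: "x \<notin> \<Union>K"
  proof
    assume x: "x \<in> \<Union>K"
    obtain F where F: "F \<in> \<F>" "{a, b} \<subseteq> F" using realizesD(3)[OF real ab(2)] by (auto simp: \<F>_def)
    have "f F x = 2 / (2 - \<delta>)" using F f(2)[OF F(1)] fx by simp
    also have "\<dots> > 1" using \<delta> by simp
    finally show False using fle[OF F(1) x] by simp
  qed
  have U: "\<Union>(sdiv K a b x) \<subseteq> insert x (\<Union>K)" by (rule Union_sdiv)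
  let ?P = "\<lambda>F. independent F \<and>
        (\<exists>f::'a \<Rightarrow> real. linear f \<and> (\<forall>v\<in>F. f v = 1) \<and> (\<forall>v\<in>insert x (\<Union>K) - F. f v < 1))"
  have facet: "?P F" if F: "F \<in> sdiv K a b x" "card F = DIM('a)" for F
  proof -
    consider "F \<in> K" "\<not> {a, b} \<subseteq> F" | H where "F = insert x H" "insert a (insert b H) \<in> K" "\<not> {a, b} \<subseteq> H"
      using F by (auto simp: sdiv_def)
    then show ?thesis
    proof cases
      case 1
      then have FF: "F \<in> \<F>" using F by (simp add: \<F>_def)
      have "f F x < 1" using fx[OF FF] s2[OF FF 1(2)] \<delta> by simp
      then show ?thesis using f[OF FF] ind[OF FF] by (intro conjI exI[of _ "f F"]) auto
    next
      case (2 H)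
      have fH: "finite H" "x \<notin> H" using KD(3)[OF 2(2)] xK 2(2) by auto
      then have cH: "card H + 1 = DIM('a)" using F 2 by simp
      \<comment> \<open>A new facet consists of \<open>x\<close>, exactly one endpoint and a face of
        the link: with neither endpoint in \<open>H\<close>, adding both would exceed the maximal
        face size.\<close>
      have ne: "a \<in> H \<or> b \<in> H"
      proof (rule ccontr)
        assume "\<not> (a \<in> H \<or> b \<in> H)"
        then have "card (insert a (insert b H)) = card H + 2" using fH ab by simp
        then show False using KD(4)[OF 2(2)] cH by simp
      qed
      define R where "R = H - {a, b}"
      have FF: "insert a (insert b H) \<in> \<F>"
        using 2 ne cH fH by (auto simp: \<F>_def insert_absorb)
      show ?thesis
      proof (cases "b \<in> H")
        case True
        then have H: "H = insert b R" "a \<notin> insert b R" "b \<notin> R" using 2 ab by (auto simp: R_def)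
        have e: "insert a (insert b H) = insert a (insert b R)" using H by auto
        show ?thesis unfolding 2(1) H(1)
          by (rule facet_swap[OF 2(2) e H(2,3) ind[OF FF] x_def \<delta> f[OF FF], of "g (insert a (insert b H)) a"])
             (use g[OF FF] s1[OF FF] in auto)
      next
        case False
        then have H: "H = insert a R" "b \<notin> insert a R" "a \<notin> R" using ne ab by (auto simp: R_def)
        have e: "insert a (insert b H) = insert b (insert a R)" using H by auto
        show ?thesis unfolding 2(1) H(1)
          by (rule facet_swap[OF 2(2) e H(2,3) ind[OF FF] x' \<delta> f[OF FF], of "g (insert a (insert b H)) b"])
             (use g[OF FF] s1[OF FF] in auto)
      qed
    qed
  qed
  have pure: "\<exists>F\<in>sdiv K a b x. G \<subseteq> F \<and> card F = DIM('a)" if G: "G \<in> sdiv K a b x" for G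
  proof -
    \<comment> \<open>Extend \<open>H\<close> together with the edge to a facet of \<open>K\<close>,
      then trade an endpoint \<open>p\<close> outside \<open>H\<close> for \<open>x\<close>.\<close>
    have new: "\<exists>F\<in>sdiv K a b x. insert x H \<subseteq> F \<and> card F = DIM('a)"
      if H: "insert a (insert b H) \<in> K" "\<not> {a, b} \<subseteq> H" for H
    proof -
      obtain F where F: "F \<in> K" "insert a (insert b H) \<subseteq> F" "card F = DIM('a)" using realizesD(3)[OF real H(1)] by blast
      obtain p where p: "p \<in> {a, b}" "p \<notin> H" using H by auto
      have fF: "finite F" "x \<notin> F" "p \<in> F" using KD(3) F xK p by auto
      have "insert a (insert b (F - {p})) = F" "\<not> {a,b} \<subseteq> F - {p}" using p F by auto
      then have "insert x (F - {p}) \<in> sdiv K a b x" using F by (intro sdiv_newI) auto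
      moreover have "card (insert x (F - {p})) = DIM('a)" 
        using fF F by (metis card_Suc_Diff1 card_insert_disjoint finite_Diff DiffD1)
      moreover have "insert x H \<subseteq> insert x (F - {p})" using F p by auto
      ultimately show ?thesis by blast
    qed
    consider "G \<in> K" "\<not> {a, b} \<subseteq> G" | H where "G = insert x H" "insert a (insert b H) \<in> K" "\<not> {a, b} \<subseteq> H"
      using G by (auto simp: sdiv_def)
    then show ?thesis
    proof cases
      case 1
      obtain F where F: "F \<in> K" "G \<subseteq> F" "card F = DIM('a)" using realizesD(3)[OF real 1(1)] by blast
      show ?thesis
      proof (cases "{a, b} \<subseteq> F")
        case False then show ?thesis using sdiv_oldI[OF F(1) False, of x] F(2,3) by blast
      next
        case True
        then have "insert a (insert b G) \<in> K" using KD(5)[OF F(1)] F by auto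
        then show ?thesis using new[of G] 1 by blast
      qed
    next
      case (2 H) then show ?thesis using new by blast
    qed
  qed
  have "realizes (sdiv K a b x)"
    unfolding realizes_def
  proof (intro conjI ballI allI impI)
    show "abs_complex DIM('a) (sdiv K a b x)" by (rule abs_complex_sdiv[OF K ab(1)])
    show "flag_abs (sdiv K a b x)" by (rule flag_sdiv[OF K realizesD(2)[OF real] xK ab])
    show "\<exists>F\<in>sdiv K a b x. G \<subseteq> F \<and> card F = DIM('a)" if "G \<in> sdiv K a b x" for G using pure[OF that] .
    show "independent F" if "F \<in> sdiv K a b x" "card F = DIM('a)" for F using facet[OF that] by blast
    show "\<exists>f::'a \<Rightarrow> real. linear f \<and> (\<forall>v\<in>F. f v = 1) \<and> (\<forall>v\<in>\<Union>(sdiv K a b x) - F. f v < 1)"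
      if "F \<in> sdiv K a b x" "card F = DIM('a)" for F using facet[OF that] U by blast
    show "\<exists>F\<in>sdiv K a b x. y \<in> cone_of F" for y
      using cone_sdiv[OF K xK x_def _ ab(1) realizesD(6)[OF real]] \<delta> by simp
  qed
  then show ?thesis using xK by blast
qed

section \<open>The convex hull of the vertices of a realized complex\<close>

lemma linear_functional_inner:
  fixes f :: "'a::euclidean_space \<Rightarrow> real"
  assumes "linear f"
  shows "\<exists>w. \<forall>v. f v = w \<bullet> v"
proof (intro exI allI)
  fix v
  have "f v = f (\<Sum>b\<in>Basis. (v \<bullet> b) *\<^sub>R b)" by (simp add: euclidean_representation)
  also have "\<dots> = (\<Sum>b\<in>Basis. (v \<bullet> b) * f b)"
    by (simp add: linear_sum[OF assms] linear_scale[OF assms])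
  also have "\<dots> = (\<Sum>b\<in>Basis. f b *\<^sub>R b) \<bullet> v"
    by (simp add: inner_sum_left inner_commute[of v] mult.commute)
  finally show "f v = (\<Sum>b\<in>Basis. f b *\<^sub>R b) \<bullet> v" .
qed

context
  fixes K :: "'a::euclidean_space set set"
  assumes K: "realizes K"
begin

lemmas KD = abs_complexD[OF realizesD(1)[OF K]]

lemma finite_vertices: "finite (\<Union>K)"
  using KD by blast

text \<open>Expand \<open>w\<close> itself in a cone of the fan: then \<open>w \<bullet> w\<close>
  is a nonnegative combination of the numbers \<open>w \<bullet> v\<close>. Geometrically, the
  origin is an interior point of the hull of the vertices.\<close>

lemma positive_vertex:
  assumes "w \<noteq> (0::'a)"
  shows "\<exists>v\<in>\<Union>K. 0 < w \<bullet> v"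
proof (rule ccontr)
  assume neg: "\<not> (\<exists>v\<in>\<Union>K. 0 < w \<bullet> v)"
  obtain F l where F: "F \<in> K" "\<forall>v\<in>F. 0 \<le> l v" "w = (\<Sum>v\<in>F. l v *\<^sub>R v)"
    using realizesD(6)[OF K, of w] unfolding cone_of_def by blast
  have "w \<bullet> w = (\<Sum>v\<in>F. l v * (w \<bullet> v))"
    by (subst (2) F(3)) (simp add: inner_sum_right)
  also have "\<dots> \<le> 0"
    using F neg by (intro sum_nonpos mult_nonneg_nonpos) (auto simp: not_less)
  finally show False using assms inner_eq_zero_iff[of w] inner_ge_zero[of w] by auto
qed

lemma facet_normal:
  assumes "F \<in> K" "card F = DIM('a)"
  obtains w where "w \<noteq> 0" "\<forall>v\<in>F. w \<bullet> v = 1" "\<forall>v\<in>\<Union>K - F. w \<bullet> v < 1"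
proof -
  obtain f where "linear f" "\<forall>v\<in>F. f v = 1" "\<forall>v\<in>\<Union>K - F. f v < (1::real)"
    using realizesD(5)[OF K assms] by blast
  moreover obtain w where w: "\<forall>v. f v = w \<bullet> v"
    using linear_functional_inner calculation(1) by blast
  moreover have "F \<noteq> {}" using assms by auto
  ultimately show thesis using that[of w] by fastforce
qed

lemma simplex_independent:
  assumes "G \<in> K"
  shows "\<not> affine_dependent G"
proof -
  obtain F where "F \<in> K" "G \<subseteq> F" "card F = DIM('a)" using realizesD(3)[OF K assms] by blast
  then show ?thesis
    using realizesD(4)[OF K] affine_dependent_imp_dependent affine_dependent_subset by blast
qed

text \<open>The facet functional separates the affine hull of \<open>F\<close> from the hull of the
  other vertices. The face is proper because \<open>- w\<close> is positive at some vertex, which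
  therefore misses the hyperplane of \<open>F\<close>.\<close>

lemma hull_facet:
  assumes F: "F \<in> K" "card F = DIM('a)"
  shows "convex hull F face_of convex hull (\<Union>K)" "convex hull F \<noteq> convex hull (\<Union>K)"
proof -
  obtain w where w: "w \<noteq> 0" "\<forall>v\<in>F. w \<bullet> v = 1" "\<forall>v\<in>\<Union>K - F. w \<bullet> v < 1"
    using facet_normal[OF F] by blast
  have aff: "affine hull F \<subseteq> {x. w \<bullet> x = 1}"
    using w by (intro hull_minimal affine_hyperplane) auto
  have conv: "convex hull (\<Union>K - F) \<subseteq> {x. w \<bullet> x < 1}"
    using w by (intro hull_minimal convex_halfspace_lt) auto
  show "convex hull F face_of convex hull (\<Union>K)"
    using F aff conv by (intro face_of_convex_hulls finite_vertices) fastforce+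
  obtain v where v: "v \<in> \<Union>K" "0 < (- w) \<bullet> v" using positive_vertex[of "- w"] w by auto
  then have "v \<in> convex hull (\<Union>K)" by (meson hull_inc)
  moreover have "v \<notin> convex hull F" using aff convex_hull_subset_affine_hull[of F] v by fastforce
  ultimately show "convex hull F \<noteq> convex hull (\<Union>K)" by blast
qed

lemma hull_face:
  assumes G: "G \<in> K"
  shows "convex hull G face_of convex hull (\<Union>K)" "convex hull G \<noteq> convex hull (\<Union>K)"
proof -
  obtain F where F: "F \<in> K" "G \<subseteq> F" "card F = DIM('a)" using realizesD(3)[OF K G] by blast
  have "convex hull G face_of convex hull F"
    using face_of_convex_hull_affine_independent[OF simplex_independent[OF F(1)]] F(2) by blast
  then show "convex hull G face_of convex hull (\<Union>K)"
    using hull_facet(1)[OF F(1,3)] face_of_trans by blast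
  have "convex hull G \<subseteq> convex hull F" by (rule hull_mono[OF F(2)])
  then show "convex hull G \<noteq> convex hull (\<Union>K)"
    using hull_facet[OF F(1,3)] face_of_imp_subset by blast
qed

text \<open>A relative interior point \<open>x\<close> of \<open>Q\<close> lies in the cone of some
  \<open>G\<close>. The functional exposing \<open>Q\<close> shows that the coefficients of
  \<open>x\<close> add up to at least 1, and the functional of a facet through \<open>G\<close> that
  they add up to at most 1. So \<open>x\<close> lies in the simplex on \<open>G\<close>; this
  simplex is a face meeting the relative interior of \<open>Q\<close>, whence \<open>Q\<close> is a
  face of it.\<close>

lemma face_hull:
  assumes Q: "Q face_of convex hull (\<Union>K)" "Q \<noteq> convex hull (\<Union>K)"
  shows "\<exists>G\<in>K. Q = convex hull G"
proof (cases "Q = {}")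
  case True
  then show ?thesis using KD(2) by (intro bexI[of _ "{}"]) auto
next
  case False
  let ?P = "convex hull (\<Union>K)"
  have "polyhedron ?P" using finite_vertices by (simp add: polytope_convex_hull polytope_imp_polyhedron)
  then have "Q exposed_face_of ?P" using Q exposed_face_of_polyhedron by blast
  then obtain b \<beta> where b: "?P \<subseteq> {x. b \<bullet> x \<le> \<beta>}" "Q = ?P \<inter> {x. b \<bullet> x = \<beta>}"
    unfolding exposed_face_of_def by blast
  have "b \<noteq> 0" using b False Q(2) by auto
  then obtain v0 where "v0 \<in> \<Union>K" "0 < b \<bullet> v0" using positive_vertex by blast
  moreover have bV: "b \<bullet> v \<le> \<beta>" if "v \<in> \<Union>K" for v
    using b(1) hull_inc[OF that, of convex] by blast
  ultimately have \<beta>: "0 < \<beta>" by force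
  have "convex Q" using Q(1) face_of_imp_convex convex_convex_hull by blast
  then obtain x where x: "x \<in> rel_interior Q" using False rel_interior_eq_empty by blast
  then have xQ: "x \<in> Q" using rel_interior_subset by blast
  obtain G l where G: "G \<in> K" "\<forall>v\<in>G. 0 \<le> l v" "x = (\<Sum>v\<in>G. l v *\<^sub>R v)"
    using realizesD(6)[OF K, of x] unfolding cone_of_def by blast
  obtain F where F: "F \<in> K" "G \<subseteq> F" "card F = DIM('a)" using realizesD(3)[OF K G(1)] by blast
  obtain w where w: "w \<noteq> 0" "\<forall>v\<in>F. w \<bullet> v = 1" "\<forall>v\<in>\<Union>K - F. w \<bullet> v < 1"
    using facet_normal[OF F(1,3)] by blast
  have "w \<bullet> x = (\<Sum>v\<in>G. l v * (w \<bullet> v))" by (simp add: G(3) inner_sum_right)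
  also have "\<dots> = sum l G" using w F by (intro sum.cong) auto
  finally have wx: "w \<bullet> x = sum l G" .
  have "convex hull (\<Union>K) \<subseteq> {x. w \<bullet> x \<le> 1}"
    using w by (intro hull_minimal convex_halfspace_le) (force simp: less_imp_le)
  then have "sum l G \<le> 1" using xQ b(2) wx by auto
  moreover have "\<beta> \<le> \<beta> * sum l G"
  proof -
    have "\<beta> = b \<bullet> x" using xQ b by simp
    also have "\<dots> = (\<Sum>v\<in>G. l v * (b \<bullet> v))" by (simp add: G(3) inner_sum_right)
    also have "\<dots> \<le> (\<Sum>v\<in>G. l v * \<beta>)" using G bV by (intro sum_mono mult_left_mono) auto
    finally show ?thesis by (simp add: sum_distrib_left mult.commute)
  qed
  then have "1 \<le> sum l G" using \<beta> by simp
  ultimately have sum1: "sum l G = 1" by simp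
  have "x \<in> convex hull G"
    using G sum1 KD(3)[OF G(1)] by (auto simp: convex_hull_finite)
  then have "convex hull G \<inter> rel_interior Q \<noteq> {}" using x by blast
  then have "Q \<subseteq> convex hull G"
    using subset_of_face_of[OF hull_face(1)[OF G(1)]] face_of_imp_subset[OF Q(1)] by blast
  then have "Q face_of convex hull G"
    using Q(1) face_of_subset hull_face(1)[OF G(1)] face_of_imp_subset by blast
  then obtain H where "H \<subseteq> G" "Q = convex hull H"
    using face_of_convex_hull_affine_independent[OF simplex_independent[OF G(1)]] by blast
  then show ?thesis using KD(5)[OF G(1)] by blast
qed

lemma boundary_eq: "boundary_complex (convex hull (\<Union>K)) = (\<lambda>G. convex hull G) ` K"
  unfolding boundary_complex_def using hull_face face_hull by blast

lemma hull_inj: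
  assumes "\<not> affine_dependent G" "\<not> affine_dependent H" "convex hull G = convex hull H"
  shows "G = (H :: 'a set)"
proof -
  have "x \<in> G \<longleftrightarrow> x \<in> H" for x
    using extreme_point_of_convex_hull_affine_independent[OF assms(1), of x]
      extreme_point_of_convex_hull_affine_independent[OF assms(2), of x] assms(3) by simp
  then show ?thesis by blast
qed

lemma hull_simplex:
  assumes "G \<in> K"
  shows "i simplex (convex hull G) \<longleftrightarrow> i = int (card G) - 1"
proof -
  have s: "(int (card G) - 1) simplex (convex hull G)"
    by (rule simplex_convex_hull) (simp add: simplex_independent[OF assms])
  then show ?thesis using aff_dim_simplex[OF s] aff_dim_simplex[of i "convex hull G"] by auto
qed

lemma inj_hull: "inj_on (\<lambda>G. convex hull G) K"
  by (rule inj_onI) (meson hull_inj simplex_independent)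

lemma simplicial_boundary: "simplicial_polytope (convex hull (\<Union>K))"
  unfolding simplicial_polytope_def
  using finite_vertices polytope_convex_hull face_hull hull_simplex by blast

lemma aff_dim_hull: "aff_dim (convex hull (\<Union>K)) = int (DIM('a))"
proof (rule ccontr)
  assume "aff_dim (convex hull (\<Union>K)) \<noteq> int (DIM('a))"
  then have "aff_dim (\<Union>K) < int (DIM('a))" using aff_dim_le_DIM[of "\<Union>K"] by (simp add: aff_dim_convex_hull)
  then obtain a b where ab: "a \<noteq> 0" "\<Union>K \<subseteq> {x. a \<bullet> x = b}" using aff_lowdim_subset_hyperplane by blast
  obtain v where "v \<in> \<Union>K" "0 < a \<bullet> v" using positive_vertex ab by blast
  moreover obtain v' where "v' \<in> \<Union>K" "0 < (-a) \<bullet> v'" using positive_vertex[of "-a"] ab by auto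
  ultimately show False using ab by (smt (verit) inner_minus_left mem_Collect_eq subset_iff)
qed

text \<open>The flag condition of the polytope speaks of hulls. Sets of at most two points are
  affinely independent and thus determined by their hulls, so the hypothesis carries over to
  \<open>K\<close> itself, where \<open>flag_abs\<close> applies.\<close>

lemma flag_boundary: "flag_complex (boundary_complex (convex hull (\<Union>K)))"
proof -
  let ?P = "convex hull (\<Union>K)"
  let ?B = "boundary_complex ?P"
  have "simplicial_complex ?B"
    unfolding simplicial_complex_def
  proof (intro conjI allI impI ballI)
    show "finite ?B" using KD(1) by (simp add: boundary_eq)
    show "\<exists>n. n simplex S" if "S \<in> ?B" for S
      using that hull_simplex by (auto simp: boundary_eq)
    show "F \<in> ?B" if "S \<in> ?B \<and> F face_of S" for F S
    proof -
      have "S face_of ?P" "S \<noteq> ?P" using that by (auto simp: boundary_complex_def)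
      then show ?thesis using that face_of_trans face_of_imp_subset
        unfolding boundary_complex_def by (metis (mono_tags, lifting) mem_Collect_eq subset_antisym)
    qed
    show "(S \<inter> S') face_of S" if "S \<in> ?B \<and> S' \<in> ?B" for S S'
      using that face_of_Int[of S ?P S'] face_of_subset[of "S \<inter> S'" ?P S] face_of_imp_subset[of S ?P]
      unfolding boundary_complex_def by blast
  qed
  moreover have "convex hull V \<in> ?B" if fin: "finite V" and V: "\<forall>G\<subseteq>V. card G \<le> 2 \<longrightarrow> convex hull G \<in> ?B" for V
  proof -
    have "G \<in> K" if G: "G \<subseteq> V" "card G \<le> 2" for G
    proof -
      have "finite G" using G fin finite_subset by blast
      then have "card G = 0 \<or> card G = 1 \<or> card G = 2" using G by linarith
      then have "\<not> affine_dependent G"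
        using \<open>finite G\<close> by (auto simp: card_1_singleton_iff card_2_iff)
      moreover obtain H where "H \<in> K" "convex hull G = convex hull H" using V G by (auto simp: boundary_eq)
      ultimately show ?thesis using hull_inj simplex_independent by metis
    qed
    then have "V \<in> K" using realizesD(2)[OF K] fin unfolding flag_abs_def by blast
    then show ?thesis by (simp add: boundary_eq)
  qed
  ultimately show ?thesis unfolding flag_complex_def by blast
qed

lemma face_number_boundary:
  "face_number ((\<lambda>G. convex hull G) ` K) (int i - 1) = card {G\<in>K. card G = i}"
proof -
  have "{F \<in> (\<lambda>G. convex hull G) ` K. (int i - 1) simplex F} = (\<lambda>G. convex hull G) ` {G\<in>K. card G = i}"
    using hull_simplex by auto
  moreover have "inj_on (\<lambda>G. convex hull G) {G\<in>K. card G = i}"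
    by (rule inj_on_subset[OF inj_hull]) auto
  ultimately show ?thesis unfolding face_number_def by (simp add: card_image)
qed

lemma h_boundary: "h_polynomial (boundary_complex (convex hull (\<Union>K))) = star_h DIM('a) K {}"
proof -
  let ?n = "DIM('a)"
  have ad: "aff_dim (convex hull G) = int (card G) - 1" if "G \<in> K" for G
    using aff_dim_simplex hull_simplex[OF that] by blast
  have "complex_dim ((\<lambda>G. convex hull G) ` K) = int ?n - 1"
    unfolding complex_dim_def
  proof (rule Max_eqI)
    show "finite (aff_dim ` (\<lambda>G. convex hull G) ` K)" using KD(1) by simp
    show "y \<le> int ?n - 1" if "y \<in> aff_dim ` (\<lambda>G. convex hull G) ` K" for y
      using that ad KD(4) by force
    obtain F where "F \<in> K" "card F = ?n" using realizesD(3)[OF K KD(2)] by blast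
    then show "int ?n - 1 \<in> aff_dim ` (\<lambda>G. convex hull G) ` K" using ad by force
  qed
  then have "h_polynomial (boundary_complex (convex hull (\<Union>K))) =
     (\<Sum>i\<le>?n. of_nat (card {G\<in>K. card G = i}) * monom 1 i * [:1, -1:] ^ (?n - i))"
    unfolding h_polynomial_def boundary_eq Let_def face_number_boundary by simp
  also have "\<dots> = (\<Sum>i\<le>?n. \<Sum>G\<in>{G\<in>K. card G = i}. h_term ?n 0 (card G))"
    by (intro sum.cong refl) (simp add: h_term_def mult.assoc)
  also have "\<dots> = (\<Sum>G\<in>K. h_term ?n 0 (card G))"
    using KD by (intro sum.group) auto
  finally show ?thesis by (simp add: star_h_def)
qed

end

section \<open>Gamma-positivity and generating functions\<close>

lemma gamma_positive_0: "gamma_positive d 0"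
  unfolding gamma_positive_def by (intro exI[of _ "\<lambda>_. 0"]) simp

lemma gamma_positive_add:
  assumes "gamma_positive d f" "gamma_positive d g"
  shows "gamma_positive d (f + g)"
proof -
  obtain c e where "f = (\<Sum>i\<le>d div 2. of_nat (c i) * monom 1 i * [:1, 1:] ^ (d - 2 * i))"
    "g = (\<Sum>i\<le>d div 2. of_nat (e i) * monom 1 i * [:1, 1:] ^ (d - 2 * i))"
    using assms unfolding gamma_positive_def by blast
  then show ?thesis unfolding gamma_positive_def
    by (intro exI[of _ "\<lambda>i. c i + e i"]) (simp add: sum.distrib distrib_right)
qed

lemma gamma_positive_sum: "(\<And>i. i \<in> I \<Longrightarrow> gamma_positive d (f i)) \<Longrightarrow> gamma_positive d (sum f I)"
  by (induction I rule: infinite_finite_induct) (auto intro: gamma_positive_add gamma_positive_0)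

lemma gamma_positive_term:
  assumes "2 * i \<le> d"
  shows "gamma_positive d (of_nat c * monom 1 i * [:1, 1:] ^ (d - 2 * i))"
proof -
  have "(\<Sum>j\<le>d div 2. of_nat (if j = i then c else 0) * monom 1 j * [:1, 1:] ^ (d - 2 * j))
      = (\<Sum>j\<le>d div 2. if j = i then of_nat c * monom 1 i * [:1, 1:] ^ (d - 2 * i) else (0 :: int poly))"
    by (intro sum.cong) auto
  also have "\<dots> = of_nat c * monom 1 i * [:1, 1:] ^ (d - 2 * i)"
    using assms by simp
  finally show ?thesis unfolding gamma_positive_def
    by (intro exI[of _ "\<lambda>j. if j = i then c else 0"]) (rule sym)
qed

lemma gamma_positive_mult:
  assumes "gamma_positive d f" "gamma_positive e g"
  shows "gamma_positive (d + e) (f * g)"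
proof -
  obtain u v where f: "f = (\<Sum>i\<le>d div 2. of_nat (u i) * monom 1 i * [:1, 1:] ^ (d - 2 * i))"
    and g: "g = (\<Sum>i\<le>e div 2. of_nat (v i) * monom 1 i * [:1, 1:] ^ (e - 2 * i))"
    using assms unfolding gamma_positive_def by blast
  have "gamma_positive (d + e) ((of_nat (u i) * monom 1 i * [:1, 1:] ^ (d - 2 * i)) *
      (of_nat (v j) * monom 1 j * [:1, 1:] ^ (e - 2 * j)))"
    if "i \<le> d div 2" "j \<le> e div 2" for i j
  proof -
    have le: "2 * i \<le> d" "2 * j \<le> e" using that by linarith+
    then obtain p q where pq: "d = 2 * i + p" "e = 2 * j + q" by (auto simp: le_iff_add)
    have "(d - 2 * i) + (e - 2 * j) = (d + e) - 2 * (i + j)" unfolding pq by simp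
    then have "[:1, 1:] ^ (d - 2 * i) * [:1, 1:] ^ (e - 2 * j) = ([:1, 1:] :: int poly) ^ (d + e - 2 * (i + j))"
      by (metis power_add)
    moreover have "monom (1::int) i * monom 1 j = monom 1 (i + j)" by (simp add: mult_monom)
    moreover have six: "a * b * c * (a' * b' * c') = (a * a') * (b * b') * (c * c')" for a b c a' b' c' :: "int poly"
      by (simp only: ac_simps)
    ultimately have "(of_nat (u i) * monom 1 i * [:1, 1:] ^ (d - 2 * i)) * (of_nat (v j) * monom 1 j * [:1, 1:] ^ (e - 2 * j))
       = of_nat (u i * v j) * monom (1::int) (i + j) * [:1, 1:] ^ (d + e - 2 * (i + j))"
      unfolding of_nat_mult six by (simp only:)
    then show ?thesis using le by (simp only:) (intro gamma_positive_term, simp)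
  qed
  then show ?thesis unfolding f g sum_product
    by (intro gamma_positive_sum) (auto simp only: atMost_iff)
qed

lemma gamma_positive_of_nat: "gamma_positive 0 (of_nat c)"
  using gamma_positive_term[of 0 0 c] by (simp add: one_poly_def[symmetric])

lemma gamma_positive_basic: "gamma_positive 1 [:1, 1:]" "gamma_positive 2 [:0, 1:]"
  using gamma_positive_term[of 0 1 1] gamma_positive_term[of 1 2 1]
  by (simp_all add: monom_altdef one_pCons)

text \<open>For positive index these are the Eulerian polynomials \<open>1\<close>,
  \<open>1 + t\<close>, \<open>1 + 4 t + t^2\<close>, and so on. The value 0 at index 0, in place of
  the usual 1, cancels the terms in which a gap of a chain would be empty.\<close>

fun perm_h :: "nat \<Rightarrow> int poly" where
  "perm_h 0 = 0"
| "perm_h (Suc k) = (if k = 0 then 1 else 0) + [:1, 1:] * perm_h k +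
     [:0, 1:] * (\<Sum>j\<le>k. of_nat (k choose j) * perm_h j * perm_h (k - j))"

text \<open>The number comes from the logarithmic derivative of the closed form of
  \<open>sphere_h\<close>. With \<open>P\<close> the generating function of \<open>perm_h\<close>,
  the factor \<open>1 / (1 - t e^(r(1-t)x))\<close> contributes \<open>t r (1 + P(r x))\<close>, and
  the numerator contributes the same expression for \<open>r - 1\<close> with a minus sign. The
  coefficient of \<open>perm_h j\<close> is then \<open>r r^j - (r - 1) (r - 1)^j\<close>.\<close>

definition mult_at :: "nat \<Rightarrow> nat \<Rightarrow> nat" where
  "mult_at r j = r ^ (j + 1) - (r - 1) ^ (j + 1)"

fun sphere_h :: "nat \<Rightarrow> nat \<Rightarrow> int poly" where
  "sphere_h r 0 = 1"
| "sphere_h r (Suc n) = [:1, 1:] * sphere_h r n +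
     [:0, 1:] * (\<Sum>j\<le>n. of_nat (n choose j) * of_nat (mult_at r j) * perm_h j * sphere_h r (n - j))"

text \<open>Adding it to \<open>sphere_h\<close> multiplies the generating function by
  \<open>1 + t P((r-1) x) = (1 - t) / (1 - t e^((r-1)(1-t)x))\<close>, where \<open>P\<close>
  belongs to \<open>perm_h\<close>. This cancels the numerator of the closed form of
  \<open>sphere_h\<close>.\<close>

definition minus_h :: "nat \<Rightarrow> nat \<Rightarrow> int poly" where
  "minus_h r n = [:0, 1:] * (\<Sum>j\<le>n. of_nat (n choose j) * of_nat ((r - 1) ^ j) * perm_h j * sphere_h r (n - j))"

declare perm_h.simps(2) [simp del] sphere_h.simps(2) [simp del]

text \<open>A product \<open>perm_h j * perm_h (l - j)\<close> with both indices positive has center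
  parameter \<open>(j - 1) + (l - j - 1)\<close>, and the factor \<open>t\<close> adds 2. The
  boundary terms vanish since \<open>perm_h 0 = 0\<close>, which also settles the truncated
  \<open>k - 1\<close> at \<open>k = 0\<close>.\<close>

lemma gamma_positive_perm_h: "gamma_positive (k - 1) (perm_h k)"
proof (induction k rule: less_induct)
  case (less k)
  show ?case
  proof (cases k)
    case 0 then show ?thesis by (simp add: gamma_positive_0)
  next
    case (Suc l)
    have 1: "gamma_positive l (if l = 0 then 1 else 0)"
      using gamma_positive_of_nat[of 1] gamma_positive_0 by simp
    have 2: "gamma_positive l ([:1, 1:] * perm_h l)"
    proof (cases l)
      case 0 then show ?thesis using gamma_positive_0 by (simp del: mult_pCons_left)
    next
      case (Suc i)
      then show ?thesis using gamma_positive_mult[OF gamma_positive_basic(1) less[of l]] \<open>k = Suc l\<close> by simp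
    qed
    have 3: "gamma_positive l ([:0, 1:] * (of_nat (l choose j) * perm_h j * perm_h (l - j)))" if "j \<le> l" for j
    proof (cases "j = 0 \<or> j = l")
      case True
      then show ?thesis using gamma_positive_0 by (auto simp del: mult_pCons_left)
    next
      case False
      then have "gamma_positive (2 + (0 + (j - 1) + (l - j - 1))) ([:0, 1:] * (of_nat (l choose j) * perm_h j * perm_h (l - j)))"
        using less[of j] less[of "l - j"] Suc that
        by (intro gamma_positive_mult gamma_positive_basic gamma_positive_of_nat; simp)
      moreover have "2 + (0 + (j - 1) + (l - j - 1)) = l" using False that by linarith
      ultimately show ?thesis by (simp only:)
    qed
    have "gamma_positive l (perm_h (Suc l))"
      unfolding perm_h.simps(2) sum_distrib_left
      by (intro gamma_positive_add gamma_positive_sum 1 2 3) simp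
    then show ?thesis using Suc by simp
  qed
qed

text \<open>Serves both the recurrence of \<open>sphere_h (n + 1)\<close> and
  \<open>minus_h n\<close>: the factor \<open>t\<close> counts 2, \<open>perm_h j\<close> counts
  \<open>j - 1\<close> and \<open>f\<close> counts \<open>n - j\<close>.\<close>

lemma gamma_positive_perm_term:
  assumes "j \<le> n" "gamma_positive (n - j) f"
  shows "gamma_positive (n + 1) ([:0, 1:] * (of_nat a * of_nat b * perm_h j * f))"
proof (cases j)
  case 0
  then show ?thesis using gamma_positive_0 by (simp del: mult_pCons_left)
next
  case (Suc i)
  have "gamma_positive (2 + (0 + 0 + (j - 1) + (n - j))) ([:0, 1:] * (of_nat a * of_nat b * perm_h j * f))"
    using assms(2) by (intro gamma_positive_mult gamma_positive_basic gamma_positive_of_nat gamma_positive_perm_h)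
  moreover have "2 + (0 + 0 + (j - 1) + (n - j)) = n + 1" using Suc assms(1) by linarith
  ultimately show ?thesis by simp
qed

lemma gamma_positive_sphere_h: "gamma_positive n (sphere_h r n)"
proof (induction n rule: less_induct)
  case (less n)
  show ?case
  proof (cases n)
    case 0 then show ?thesis using gamma_positive_of_nat[of 1] by simp
  next
    case (Suc l)
    have 1: "gamma_positive (Suc l) ([:1, 1:] * sphere_h r l)"
      using gamma_positive_mult[OF gamma_positive_basic(1) less[of l]] Suc by simp
    have 2: "gamma_positive (Suc l) ([:0, 1:] * (of_nat (l choose j) * of_nat (mult_at r j) * perm_h j * sphere_h r (l - j)))"
      if "j \<le> l" for j
      using gamma_positive_perm_term[OF that less[of "l - j"]] Suc by simp
    show ?thesis unfolding Suc sphere_h.simps(2) sum_distrib_left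
      by (intro gamma_positive_add gamma_positive_sum 1 2) simp
  qed
qed

lemma gamma_positive_minus_h: "gamma_positive (n + 1) (minus_h r n)"
  unfolding minus_h_def sum_distrib_left
  by (intro gamma_positive_sum gamma_positive_perm_term gamma_positive_sphere_h) auto

lemma coeff_minus_h_0: "coeff (minus_h r n) 0 = 0"
  by (simp add: minus_h_def)

section \<open>Exponential generating functions and their differential equations\<close>

definition egf :: "int \<Rightarrow> (nat \<Rightarrow> int poly) \<Rightarrow> real fps" where
  "egf t p = Abs_fps (\<lambda>n. of_int (poly (p n) t) / fact n)"

text \<open>Uniqueness for a homogeneous linear differential equation, read off coefficient by
  coefficient. Closed forms are verified in multiplied-out form: the difference \<open>Q\<close> of
  the two sides satisfies such an equation.\<close>

lemma fps_deriv_zero_unique: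
  fixes Q :: "real fps"
  assumes "fps_deriv Q = Q * S" "fps_nth Q 0 = 0"
  shows "Q = 0"
proof -
  have "fps_nth Q n = 0" for n
  proof (induction n rule: less_induct)
    case (less n)
    show ?case
    proof (cases n)
      case (Suc m)
      have "real n * fps_nth Q n = fps_nth (fps_deriv Q) m" using Suc by simp
      also have "\<dots> = (\<Sum>i=0..m. fps_nth Q i * fps_nth S (m - i))" by (simp add: assms fps_mult_nth)
      also have "\<dots> = 0" using less Suc by (intro sum.neutral) auto
      finally show ?thesis using Suc by simp
    qed (use assms in simp)
  qed
  then show ?thesis by (simp add: fps_eq_iff)
qed

lemma egf_deriv: "fps_deriv (egf t p) = egf t (\<lambda>n. p (Suc n))"
proof (rule fps_ext)
  fix n
  have f: "fact (Suc n) = real (Suc n) * fact n" by simp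
  show "fps_nth (fps_deriv (egf t p)) n = fps_nth (egf t (\<lambda>n. p (Suc n))) n"
    unfolding fps_deriv_nth egf_def fps_nth_Abs_fps Suc_eq_plus1[symmetric] f by (simp del: of_nat_Suc)
qed

lemma egf_add: "egf t (\<lambda>n. p n + q n) = egf t p + egf t q"
  by (simp add: fps_eq_iff egf_def add_divide_distrib)

lemma egf_cmult: "egf t (\<lambda>n. c * p n) = fps_const (of_int (poly c t)) * egf t p"
  by (simp add: fps_eq_iff egf_def)

lemma egf_mult:
  "egf t p * egf t q = egf t (\<lambda>n. \<Sum>j\<le>n. of_nat (n choose j) * p j * q (n - j))"
proof (rule fps_ext)
  fix n
  have "fps_nth (egf t p * egf t q) n = (\<Sum>j\<le>n. of_int (poly (p j) t) / fact j * (of_int (poly (q (n - j)) t) / fact (n - j)))"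
    by (simp add: fps_mult_nth egf_def atLeast0AtMost)
  also have "\<dots> = (\<Sum>j\<le>n. real (n choose j) * of_int (poly (p j) t) * of_int (poly (q (n - j)) t) / fact n)"
    by (intro sum.cong refl) (simp add: binomial_fact field_simps)
  also have "\<dots> = fps_nth (egf t (\<lambda>n. \<Sum>j\<le>n. of_nat (n choose j) * p j * q (n - j))) n"
    by (simp add: egf_def poly_sum sum_divide_distrib mult.assoc)
  finally show "fps_nth (egf t p * egf t q) n = fps_nth (egf t (\<lambda>n. \<Sum>j\<le>n. of_nat (n choose j) * p j * q (n - j))) n" .
qed

lemma egf_power: "egf t (\<lambda>n. p ^ n) = fps_exp (of_int (poly p t))"
  by (simp add: fps_eq_iff egf_def poly_power)

lemma egf_scale: "egf t (\<lambda>n. of_nat (c ^ n) * p n) = fps_compose (egf t p) (fps_const (of_nat c) * fps_X)"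
  by (simp add: fps_eq_iff egf_def fps_compose_linear)

lemma egf_delta: "egf t (\<lambda>n. if n = 0 then 1 else 0) = 1"
  by (simp add: fps_eq_iff egf_def)

context
  fixes t :: int
begin

abbreviation "fps_t \<equiv> fps_const (real_of_int t)"

abbreviation "fps_e c \<equiv> fps_exp (real c * (1 - real_of_int t))"

text \<open>The recurrence is the Riccati equation \<open>P' = (1 + P) (1 + t P)\<close>. Along a
  solution the defect of the closed form obeys a linear equation with multiplier
  \<open>1 + t P\<close>.\<close>

lemma egf_perm_h: "egf t perm_h * (1 - fps_t * fps_e 1) = fps_e 1 - 1"
proof -
  define P e where "P = egf t perm_h" and "e = fps_e 1"
  let ?Q = "P * (1 - fps_t * e) - (e - 1)"
  have P': "fps_deriv P = 1 + (1 + fps_t) * P + fps_t * (P * P)"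
    unfolding P_def egf_deriv perm_h.simps(2) egf_add
    by (simp add: egf_cmult egf_mult mult.assoc egf_delta fps_const_add[symmetric] del: fps_const_add mult_pCons_left)
  have e': "fps_deriv e = (1 - fps_t) * e"
    unfolding e_def by (simp add: fps_const_sub[symmetric] del: fps_const_sub)
  have "fps_deriv ?Q = (fps_deriv P * (1 - fps_t * e) - P * (fps_t * fps_deriv e)) - fps_deriv e"
    by (simp add: algebra_simps)
  also have "\<dots> = ?Q * (1 + fps_t * P)"
    unfolding P' e' by algebra
  finally have "fps_deriv ?Q = ?Q * (1 + fps_t * P)" .
  moreover have "fps_nth ?Q 0 = 0" by (simp add: egf_def P_def e_def)
  ultimately have "?Q = 0" by (rule fps_deriv_zero_unique)
  then show ?thesis by (simp add: P_def e_def)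
qed

lemma egf_perm_h_scaled: "egf t (\<lambda>n. of_nat (c ^ n) * perm_h n) * (1 - fps_t * fps_e c) = fps_e c - 1"
proof -
  have "fps_compose (egf t perm_h * (1 - fps_t * fps_e 1)) (fps_const (of_nat c) * fps_X) =
    fps_compose (fps_e 1 - 1) (fps_const (of_nat c) * fps_X)"
    by (simp only: egf_perm_h)
  then show ?thesis
    unfolding egf_scale
    by (simp add: fps_compose_mult_distrib fps_compose_sub_distrib)
qed

lemma egf_sphere_h:
  assumes "r \<ge> 1"
  shows "egf t (sphere_h r) * (1 - fps_t * fps_e r) = fps_exp 1 * (1 - fps_t * fps_e (r - 1))"
proof -
  let ?G = "egf t (sphere_h r)"
  define Pr Ps where "Pr = egf t (\<lambda>n. of_nat (r ^ n) * perm_h n)"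
    and "Ps = egf t (\<lambda>n. of_nat ((r - 1) ^ n) * perm_h n)"
  define R S where "R = fps_const (real r)" and "S = fps_const (real (r - 1))"
  have RS: "R = S + 1" using assms by (simp add: R_def S_def of_nat_diff fps_eq_iff)
  have Pr: "Pr * (1 - fps_t * fps_e r) = fps_e r - 1" unfolding Pr_def by (rule egf_perm_h_scaled)
  have Ps: "Ps * (1 - fps_t * fps_e (r - 1)) = fps_e (r - 1) - 1" unfolding Ps_def by (rule egf_perm_h_scaled)
  have m: "egf t (\<lambda>n. of_nat (mult_at r n) * perm_h n) = R * Pr - S * Ps"
  proof -
    have le: "(r - 1) ^ (n + 1) \<le> r ^ (n + 1)" for n by (intro power_mono) auto
    have "real (mult_at r n) = real r * real r ^ n - real (r - 1) * real (r - 1) ^ n" for n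
      unfolding mult_at_def using le[of n] by (simp add: of_nat_diff)
    then show ?thesis
      unfolding Pr_def Ps_def R_def S_def
      by (simp add: fps_eq_iff egf_def left_diff_distrib diff_divide_distrib mult.assoc)
  qed
  have "fps_deriv ?G = (1 + fps_t) * ?G + fps_t * (egf t (\<lambda>n. of_nat (mult_at r n) * perm_h n) * ?G)"
    unfolding egf_deriv sphere_h.simps(2) egf_add egf_cmult egf_mult mult.assoc
    by (simp add: fps_const_add[symmetric] mult.assoc del: fps_const_add)
  then have G': "fps_deriv ?G = (1 + fps_t) * ?G + fps_t * ((R * Pr - S * Ps) * ?G)" unfolding m .
  have e': "fps_deriv (fps_e r) = R * (1 - fps_t) * fps_e r" "fps_deriv (fps_e (r - 1)) = S * (1 - fps_t) * fps_e (r - 1)"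
    unfolding R_def S_def
    by (simp_all add: fps_const_sub[symmetric] fps_const_mult[symmetric] right_diff_distrib del: fps_const_sub fps_const_mult)
  let ?Q = "?G * (1 - fps_t * fps_e r) - fps_exp 1 * (1 - fps_t * fps_e (r - 1))"
  have "fps_deriv ?Q = (fps_deriv ?G * (1 - fps_t * fps_e r) - ?G * (fps_t * fps_deriv (fps_e r))) -
     (fps_exp 1 * (1 - fps_t * fps_e (r - 1)) - fps_exp 1 * (fps_t * fps_deriv (fps_e (r - 1))))"
    by (simp add: algebra_simps)
  \<comment> \<open>The multiplier is the logarithmic derivative \<open>1 - t S (1 + Ps)\<close> of
    the right-hand side of the claim, rewritten with \<open>R = S + 1\<close>; the left-hand side
    has the same one by the recurrence.\<close>
  also have "\<dots> = ?Q * (1 + fps_t - fps_t * R - fps_t * S * Ps)"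
    unfolding G' e' using Pr Ps RS by algebra
  finally have "fps_deriv ?Q = ?Q * (1 + fps_t - fps_t * R - fps_t * S * Ps)" .
  moreover have "fps_nth ?Q 0 = 0" by (simp add: egf_def)
  ultimately have "?Q = 0" by (rule fps_deriv_zero_unique)
  then show ?thesis by simp
qed

lemma egf_minus_h: "egf t (minus_h r) = fps_t * (egf t (\<lambda>n. of_nat ((r - 1) ^ n) * perm_h n) * egf t (sphere_h r))"
  unfolding egf_mult minus_h_def egf_cmult by (simp add: mult.assoc)

lemma egf_binomial_eulerian: "egf t (\<lambda>n. binomial_eulerian_A n r) = egf t (\<lambda>n. eulerian_A n r) * fps_exp (real_of_int t)"
proof -
  have "fps_exp (real_of_int t) = egf t (\<lambda>n. monom 1 1 ^ n)" unfolding egf_power by (simp add: poly_monom)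
  also have "(\<lambda>n. monom 1 1 ^ n) = (\<lambda>n. monom (1::int) n)" by (simp add: monom_power)
  finally have e: "fps_exp (real_of_int t) = egf t (\<lambda>n. monom 1 n)" .
  show ?thesis unfolding e egf_mult binomial_eulerian_A_def by (simp only: ac_simps)
qed

text \<open>The assumption \<open>rec\<close>, established below as \<open>eulerian_A_rec\<close>,
  says \<open>t A = e^(r(t-1)x) A + (t - 1) e^((r-1)(t-1)x)\<close> for the generating function
  \<open>A\<close> of \<open>eulerian_A\<close>. Multiplied by \<open>e^(r(1-t)x)\<close> this
  becomes \<open>A (1 - t e^(r(1-t)x)) = (1 - t) e^((1-t)x)\<close>, and the factor
  \<open>e^(tx)\<close> of the binomial sum turns the last exponential into
  \<open>e^x\<close>.\<close>

lemma binomial_eulerian_eval: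
  assumes r: "r \<ge> 1" and t: "t \<noteq> 1"
    and rec: "\<And>n. [:0, 1:] * eulerian_A n r = (\<Sum>k\<le>n. of_nat (n choose k) * (of_nat r * [:-1, 1:]) ^ k * eulerian_A (n - k) r)
        + [:-1, 1:] * (of_nat (r - 1) * [:-1, 1:]) ^ n"
  shows "poly (binomial_eulerian_A n r) t = poly (sphere_h r n + minus_h r n) t"
proof -
  let ?A = "egf t (\<lambda>n. eulerian_A n r)" and ?F = "egf t (\<lambda>n. binomial_eulerian_A n r)" and ?G = "egf t (sphere_h r)"
  define Ps where "Ps = egf t (\<lambda>n. of_nat ((r - 1) ^ n) * perm_h n)"
  define iR iS where "iR = fps_exp (real r * (real_of_int t - 1))" and "iS = fps_exp (real (r - 1) * (real_of_int t - 1))"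
  have Ps: "Ps * (1 - fps_t * fps_e (r - 1)) = fps_e (r - 1) - 1" unfolding Ps_def by (rule egf_perm_h_scaled)
  have "egf t (\<lambda>n. [:0, 1:] * eulerian_A n r) = 
     egf t (\<lambda>n. (of_nat r * [:-1, 1:]) ^ n) * ?A + fps_const (of_int (t - 1)) * egf t (\<lambda>n. (of_nat (r - 1) * [:-1, 1:]) ^ n)"
    unfolding rec egf_add egf_mult egf_cmult by simp
  moreover have "real_of_int (poly (of_nat c * [:-1, 1:]) t) = real c * (real_of_int t - 1)" for c
    by (simp add: algebra_simps)
  ultimately have A: "fps_t * ?A = iR * ?A + (fps_t - 1) * iS"
    unfolding egf_cmult egf_power iR_def iS_def by (simp add: fps_const_sub[symmetric] del: fps_const_sub of_nat_diff mult_pCons_left mult_pCons_right)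
  have inv: "iR * fps_e r = 1" "iS * fps_e r = fps_e 1" "fps_exp 1 = fps_e 1 * fps_exp (real_of_int t)"
    unfolding iR_def iS_def fps_exp_add_mult[symmetric] using r by (simp_all add: of_nat_diff algebra_simps)
  have "?A * (1 - fps_t * fps_e r) = (1 - fps_t) * fps_e 1"
    using A inv by algebra
  then have F: "?F * (1 - fps_t * fps_e r) = (1 - fps_t) * fps_exp 1"
    unfolding egf_binomial_eulerian using inv(3) by algebra
  have "(?G + fps_t * (Ps * ?G)) * (1 - fps_t * fps_e r) = (1 - fps_t) * fps_exp 1"
    using egf_sphere_h[OF r] Ps by algebra
  then have "?F * (1 - fps_t * fps_e r) = (?G + fps_t * (Ps * ?G)) * (1 - fps_t * fps_e r)" using F by simp
  moreover have "fps_nth (1 - fps_t * fps_e r) 0 \<noteq> 0" using t by simp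
  then have "1 - fps_t * fps_e r \<noteq> 0" by (metis fps_zero_nth)
  ultimately have "?F = ?G + fps_t * (Ps * ?G)" by simp
  also have "\<dots> = egf t (\<lambda>n. sphere_h r n + minus_h r n)"
    unfolding egf_add egf_minus_h Ps_def ..
  finally have "fps_nth ?F n = fps_nth (egf t (\<lambda>n. sphere_h r n + minus_h r n)) n" by simp
  then show ?thesis by (simp add: egf_def flip: of_int_add)
qed

end

text \<open>The generating functions are formed at a fixed integer value of \<open>t\<close>, so the
  polynomial identity is recovered from infinitely many values. The value 1 is left out because the
  common denominator \<open>1 - t e^(r(1-t)x)\<close> is the zero series there.\<close>

lemma poly_eqI_infinite:
  fixes p q :: "int poly"
  assumes "\<And>t. t \<noteq> 1 \<Longrightarrow> poly p t = poly q t"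
  shows "p = q"
proof (rule ccontr)
  assume "p \<noteq> q"
  then have "finite {t. poly (p - q) t = 0}" by (intro poly_roots_finite) simp
  moreover have "- {1} \<subseteq> {t. poly (p - q) t = 0}" using assms by auto
  ultimately have "finite (- {1::int})" by (rule rev_finite_subset)
  then show False by (simp add: finite_compl infinite_UNIV_int)
qed

section \<open>Descents of colored permutations\<close>

text \<open>Letters are pairs of a color and a value, in this order, so a descent is a lexicographic
  comparison of adjacent letters.\<close>

definition letter_gt :: "nat \<times> nat \<Rightarrow> nat \<times> nat \<Rightarrow> bool" where
  "letter_gt p q \<longleftrightarrow> fst p > fst q \<or> (fst p = fst q \<and> snd p > snd q)"

lemma letter_gt_trans: "letter_gt p q \<Longrightarrow> letter_gt q s \<Longrightarrow> letter_gt p s"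
  by (auto simp: letter_gt_def)

lemma letter_gt_irrefl: "\<not> letter_gt p p"
  by (auto simp: letter_gt_def)

lemma letter_gt_total: "p \<noteq> q \<Longrightarrow> letter_gt p q \<or> letter_gt q p"
  by (cases p; cases q) (auto simp: letter_gt_def)

text \<open>After the last letter comes one of color 0 whose value exceeds all others; the last
  position is therefore a descent exactly for a positive color.\<close>

fun word_des :: "(nat \<times> nat) list \<Rightarrow> nat" where
  "word_des [] = 0"
| "word_des [p] = (if fst p > 0 then 1 else 0)"
| "word_des (p # q # ws) = (if letter_gt p q then 1 else 0) + word_des (q # ws)"

definition words :: "nat \<Rightarrow> nat set \<Rightarrow> (nat \<times> nat) list set" where
  "words r X = {ws. distinct (map snd ws) \<and> snd ` set ws = X \<and> fst ` set ws \<subseteq> {..<r}}"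

definition word_poly :: "nat \<Rightarrow> nat set \<Rightarrow> int poly" where
  "word_poly r X = (\<Sum>ws\<in>words r X. monom 1 (word_des ws))"

lemma desc_Cons:
  assumes "ws \<noteq> []"
  shows "sorted_wrt letter_gt (p # ws) \<longleftrightarrow> letter_gt p (hd ws) \<and> sorted_wrt letter_gt ws"
  using assms by (cases ws) (auto intro: letter_gt_trans)

text \<open>
  Replace the factor of each descent by \<open>1 + (t - 1)\<close>, position by position from the left, and stop at
  the first position where the summand 1 is chosen.
\<close>

lemma word_des_expand:
  "monom (1::int) (word_des ws) =
     (\<Sum>k<length ws. if sorted_wrt letter_gt (take (Suc k) ws)
        then [:-1, 1:] ^ k * monom 1 (word_des (drop (Suc k) ws)) else 0) +
     (if sorted_wrt letter_gt ws \<and> 0 \<notin> fst ` set ws then [:-1, 1:] ^ length ws else 0)"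
proof (induction ws)
  case Nil
  then show ?case by (simp add: monom_altdef)
next
  case (Cons p ws)
  show ?case
  proof (cases ws)
    case Nil
    have "monom (1::int) (Suc 0) = 1 + [:-1, 1:]" by (simp add: monom_altdef one_pCons)
    then show ?thesis using Nil by (auto simp: monom_altdef)
  next
    case (Cons q vs)
    then have ne: "ws \<noteq> []" and hd: "hd ws = q" by auto
    define y :: "int poly" where "y = [:-1, 1:]"
    define S where "S = (\<Sum>k<length ws. if sorted_wrt letter_gt (take (Suc k) ws)
        then y ^ k * monom 1 (word_des (drop (Suc k) ws)) else 0)"
    define E where "E = (if sorted_wrt letter_gt ws \<and> 0 \<notin> fst ` set ws then y ^ length ws else 0)"
    have IH: "monom (1::int) (word_des ws) = S + E" unfolding S_def E_def y_def by (rule Cons.IH)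
    have s1: "sorted_wrt letter_gt [p]" by simp
    have "(\<Sum>k<length (p # ws). if sorted_wrt letter_gt (take (Suc k) (p # ws))
        then y ^ k * monom 1 (word_des (drop (Suc k) (p # ws))) else 0) =
        monom 1 (word_des ws) + (\<Sum>k<length ws. if sorted_wrt letter_gt (p # take (Suc k) ws)
        then y ^ Suc k * monom 1 (word_des (drop (Suc k) ws)) else 0)"
      using s1 by (simp add: sum.lessThan_Suc_shift del: sum.lessThan_Suc sorted_wrt.simps(2) power_Suc cong: if_cong)
    also have "(\<Sum>k<length ws. if sorted_wrt letter_gt (p # take (Suc k) ws)
        then y ^ Suc k * monom 1 (word_des (drop (Suc k) ws)) else 0) = (if letter_gt p q then y * S else 0)"
    proof -
      have "sorted_wrt letter_gt (p # take (Suc k) ws) \<longleftrightarrow> letter_gt p q \<and> sorted_wrt letter_gt (take (Suc k) ws)" for k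
        using desc_Cons[of "take (Suc k) ws" p] Cons by simp
      then show ?thesis
        by (auto simp: S_def sum_distrib_left mult.assoc intro!: sum.cong simp del: sorted_wrt.simps(2))
    qed
    finally have 1: "(\<Sum>k<length (p # ws). if sorted_wrt letter_gt (take (Suc k) (p # ws))
        then y ^ k * monom 1 (word_des (drop (Suc k) (p # ws))) else 0) =
        monom 1 (word_des ws) + (if letter_gt p q then y * S else 0)" .
    \<comment> \<open>Colors decrease weakly along a descending word, so its last position is a
      descent exactly when the color 0 does not occur at all.\<close>
    have q0: "fst q \<noteq> 0 \<Longrightarrow> letter_gt p q \<Longrightarrow> fst p \<noteq> 0" by (auto simp: letter_gt_def)
    have 2: "(if sorted_wrt letter_gt (p # ws) \<and> 0 \<notin> fst ` set (p # ws) then y ^ length (p # ws) else 0) =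
       (if letter_gt p q then y * E else 0)"
      unfolding desc_Cons[OF ne] hd E_def using q0 Cons by auto
    have "monom (1::int) (word_des (p # ws)) = (if letter_gt p q then monom 1 1 else 1) * monom 1 (word_des ws)"
      using Cons by (simp add: mult_monom)
    also have "monom (1::int) 1 = 1 + y" by (simp add: monom_altdef one_pCons y_def)
    finally show ?thesis unfolding y_def[symmetric] 1 2
      by (simp add: IH algebra_simps)
  qed
qed

lemma desc_list_ex:
  assumes "finite L"
  shows "\<exists>l. sorted_wrt letter_gt l \<and> set l = L \<and> length l = card L"
  using assms
proof (induction "card L" arbitrary: L)
  case 0 then show ?case by simp
next
  case (Suc n)
  have "\<exists>p\<in>L. \<forall>q\<in>L - {p}. letter_gt p q"
  proof -
    have "finite L" "L \<noteq> {}" using Suc by auto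
    then show ?thesis
    proof (induction L rule: finite_ne_induct)
      case (insert x F)
      then obtain p where p: "p \<in> F" "\<forall>q\<in>F - {p}. letter_gt p q" by blast
      then have "x \<noteq> p" using insert by auto
      then consider "letter_gt x p" | "letter_gt p x" using letter_gt_total by blast
      then show ?case
      proof cases
        case 1
        then have "\<forall>q\<in>insert x F - {x}. letter_gt x q" using p letter_gt_trans by blast
        then show ?thesis by blast
      next
        case 2
        then have "\<forall>q\<in>insert x F - {p}. letter_gt p q" using p by blast
        then show ?thesis using p by blast
      qed
    qed simp
  qed
  then obtain p where p: "p \<in> L" "\<forall>q\<in>L - {p}. letter_gt p q" by blast
  moreover have c: "n = card (L - {p})" using Suc p by simp
  ultimately obtain l where "sorted_wrt letter_gt l" "set l = L - {p}" "length l = n"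
    using Suc.hyps(1)[OF c] Suc.prems by auto
  then show ?case using p Suc by (intro exI[of _ "p # l"]) auto
qed

lemma desc_list_unique:
  assumes "sorted_wrt letter_gt l" "sorted_wrt letter_gt l'" "set l = set l'"
  shows "l = l'"
  using assms
proof (induction l arbitrary: l')
  case Nil then show ?case by simp
next
  case (Cons p l)
  then obtain q m where l': "l' = q # m" by (cases l') auto
  have pq: "p = q"
  proof (rule ccontr)
    assume "p \<noteq> q"
    then have "q \<in> set l" "p \<in> set m" using Cons.prems(3) l' by auto
    then have "letter_gt p q" "letter_gt q p" using Cons.prems l' by auto
    then show False using letter_gt_trans letter_gt_irrefl by blast
  qed
  have "p \<notin> set l" "p \<notin> set m" using Cons.prems l' pq letter_gt_irrefl[of q] by auto
  then have "set l = set m" using Cons.prems l' pq by auto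
  then show ?case using Cons l' pq by auto
qed

definition desc_list :: "(nat \<times> nat) set \<Rightarrow> (nat \<times> nat) list" where
  "desc_list L = (SOME l. sorted_wrt letter_gt l \<and> set l = L \<and> length l = card L)"

lemma desc_list:
  assumes "finite L"
  shows "sorted_wrt letter_gt (desc_list L)" "set (desc_list L) = L" "length (desc_list L) = card L"
  using someI_ex[OF desc_list_ex[OF assms]] unfolding desc_list_def by blast+

lemma desc_list_set: "sorted_wrt letter_gt l \<Longrightarrow> desc_list (set l) = l"
  using desc_list[of "set l"] desc_list_unique by blast

text \<open>The graphs, as sets of letters, of the maps from \<open>A\<close> to \<open>C\<close>.
  Working with sets suits descending words, which are determined by their sets of letters.\<close>

definition colorings :: "nat set \<Rightarrow> nat set \<Rightarrow> (nat \<times> nat) set set" where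
  "colorings C A = {L. L \<subseteq> C \<times> A \<and> inj_on snd L \<and> snd ` L = A}"

lemma card_colorings:
  assumes "finite A" "finite C"
  shows "card (colorings C A) = card C ^ card A"
proof -
  let ?h = "\<lambda>f. (\<lambda>v. (f v, v)) ` A"
  have "colorings C A = ?h ` (A \<rightarrow>\<^sub>E C)"
  proof (intro equalityI subsetI)
    fix L assume L: "L \<in> colorings C A"
    define f where "f = restrict (\<lambda>v. fst (the_inv_into L snd v)) A"
    have inv: "the_inv_into L snd (snd p) = p" if "p \<in> L" for p
      using L that by (auto simp: colorings_def the_inv_into_f_f)
    have "p \<in> ?h f" if "p \<in> L" for p
      using inv[OF that] that L by (auto simp: f_def colorings_def image_iff intro!: bexI[of _ "snd p"])
    moreover have "p \<in> L" if "p \<in> ?h f" for p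
      using that L inv by (auto simp: f_def colorings_def)
    ultimately have "L = ?h f" by blast
    moreover have "f \<in> A \<rightarrow>\<^sub>E C"
      using L inv by (auto simp: f_def colorings_def)
    ultimately show "L \<in> ?h ` (A \<rightarrow>\<^sub>E C)" by blast
  next
    fix L assume "L \<in> ?h ` (A \<rightarrow>\<^sub>E C)"
    then show "L \<in> colorings C A"
      by (auto simp: colorings_def inj_on_def PiE_iff image_iff)
  qed
  moreover have "inj_on ?h (A \<rightarrow>\<^sub>E C)"
  proof (rule inj_onI)
    fix f g assume f: "f \<in> A \<rightarrow>\<^sub>E C" and g: "g \<in> A \<rightarrow>\<^sub>E C" and eq: "?h f = ?h g"
    show "f = g"
    proof (rule PiE_ext[OF f g])
      fix v assume "v \<in> A"
      then have "(f v, v) \<in> ?h g" using eq by blast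
      then show "f v = g v" by auto
    qed
  qed
  ultimately show ?thesis using assms by (simp add: card_image card_PiE)
qed

section \<open>Splitting off a descending prefix of a word\<close>

lemma finite_colorings: "finite A \<Longrightarrow> finite C \<Longrightarrow> finite (colorings C A)"
  by (rule finite_subset[of _ "Pow (C \<times> A)"]) (auto simp: colorings_def)

lemma finite_words: "finite X \<Longrightarrow> finite (words r X)"
proof (rule finite_subset)
  assume "finite X"
  then show "finite {ws. set ws \<subseteq> {..<r} \<times> X \<and> length ws = card X}"
    by (intro finite_lists_length_eq) auto
  show "words r X \<subseteq> {ws. set ws \<subseteq> {..<r} \<times> X \<and> length ws = card X}"
  proof
    fix ws assume w: "ws \<in> words r X"
    then have "card X = length ws" unfolding words_def by (metis (mono_tags, lifting) distinct_card length_map list.set_map mem_Collect_eq)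
    then show "ws \<in> {ws. set ws \<subseteq> {..<r} \<times> X \<and> length ws = card X}"
      using w by (force simp: words_def)
  qed
qed

lemma words_length: "ws \<in> words r X \<Longrightarrow> length ws = card X"
  unfolding words_def by (metis (mono_tags, lifting) distinct_card length_map list.set_map mem_Collect_eq)

text \<open>The descending prefix is given by the set \<open>A\<close> of its values and a coloring
  of \<open>A\<close>; what follows is an arbitrary word on the remaining values. Since
  \<open>f\<close> sees only the rest, the colorings merely contribute a count.\<close>

lemma words_block:
  assumes "finite X" "j \<le> card X"
  shows "(\<Sum>ws\<in>{ws\<in>words r X. sorted_wrt letter_gt (take j ws)}. f (drop j ws)) =
    (\<Sum>A\<in>{A. A \<subseteq> X \<and> card A = j}. (\<Sum>L\<in>colorings {..<r} A. (\<Sum>ws\<in>words r (X - A). (f ws :: int poly))))"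
proof -
  let ?I = "SIGMA A:{A. A \<subseteq> X \<and> card A = j}. colorings {..<r} A \<times> words r (X - A)"
  have finA: "finite A" if "A \<subseteq> X" for A using that assms finite_subset by blast
  have "(\<Sum>ws\<in>{ws\<in>words r X. sorted_wrt letter_gt (take j ws)}. f (drop j ws)) =
     (\<Sum>(A, L, ws)\<in>?I. f ws)"
  proof (rule sum.reindex_bij_witness[of _ "\<lambda>(A, L, ws). desc_list L @ ws" "\<lambda>ws. (snd ` set (take j ws), set (take j ws), drop j ws)"])
    fix ws assume ws: "ws \<in> {ws\<in>words r X. sorted_wrt letter_gt (take j ws)}"
    then have len: "length ws = card X" using words_length by blast
    have d: "distinct (map snd (take j ws) @ map snd (drop j ws))"
      using ws by (simp add: words_def flip: map_append)
    have s: "set (take j ws) \<union> set (drop j ws) = set ws" by (metis append_take_drop_id set_append)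
    show "(case (snd ` set (take j ws), set (take j ws), drop j ws) of (A, L, ws) \<Rightarrow> desc_list L @ ws) = ws"
      using ws by (simp add: desc_list_set)
    have "card (snd ` set (take j ws)) = j"
      using d len assms by (metis distinct_append distinct_card length_map length_take list.set_map min.absorb2)
    moreover have "inj_on snd (set (take j ws))" using d by (simp add: distinct_map)
    moreover have wX: "snd ` set ws = X" "fst ` set ws \<subseteq> {..<r}" using ws by (auto simp: words_def)
    have X: "X = snd ` set (take j ws) \<union> snd ` set (drop j ws)"
      unfolding image_Un[symmetric] s using wX by simp
    moreover have r: "fst p < r" if "p \<in> set ws" for p
      using wX(2) imageI[OF that, of fst] by blast
    have "set (take j ws) \<subseteq> {..<r} \<times> snd ` set (take j ws)"
    proof
      fix p assume p: "p \<in> set (take j ws)"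
      then have "fst p < r" "snd p \<in> snd ` set (take j ws)" using r s by (blast, simp)
      then show "p \<in> {..<r} \<times> snd ` set (take j ws)" by (simp add: mem_Times_iff)
    qed
    moreover have "fst ` set (drop j ws) \<subseteq> {..<r}" using wX(2) s by blast
    moreover have "snd ` set (drop j ws) = X - snd ` set (take j ws)"
      using d X by auto
    ultimately show "(snd ` set (take j ws), set (take j ws), drop j ws) \<in> ?I"
      using d by (auto simp: colorings_def words_def)
    show "(case (snd ` set (take j ws), set (take j ws), drop j ws) of (A, L, ws) \<Rightarrow> f ws) = f (drop j ws)" by simp
  next
    fix i assume "i \<in> ?I"
    then obtain A L ws where i: "i = (A, L, ws)" "A \<subseteq> X" "card A = j" "L \<in> colorings {..<r} A" "ws \<in> words r (X - A)"
      by auto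
    have L: "L \<subseteq> {..<r} \<times> A" "inj_on snd L" "snd ` L = A" using i by (auto simp: colorings_def)
    have fL: "finite L" using L(1) finA[OF i(2)] finite_subset by blast
    have cL: "card L = j" using card_image[OF L(2)] L(3) i(3) by simp
    note dl = desc_list[OF fL]
    have "distinct (desc_list L)" using dl cL by (simp add: card_distinct)
    then have "distinct (map snd (desc_list L))" using dl L by (simp add: distinct_map)
    then have "desc_list L @ ws \<in> words r X"
      using i L dl by (auto simp: words_def)
    then show "(case i of (A, L, ws) \<Rightarrow> desc_list L @ ws) \<in> {ws\<in>words r X. sorted_wrt letter_gt (take j ws)}"
      using i dl cL by simp
    show "(snd ` set (take j (case i of (A, L, ws) \<Rightarrow> desc_list L @ ws)), set (take j (case i of (A, L, ws) \<Rightarrow> desc_list L @ ws)), drop j (case i of (A, L, ws) \<Rightarrow> desc_list L @ ws)) = i"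
      using i dl cL L by simp
  qed
  also have "\<dots> = (\<Sum>A\<in>{A. A \<subseteq> X \<and> card A = j}. (\<Sum>p\<in>colorings {..<r} A \<times> words r (X - A). f (snd p)))"
    using assms finA finite_colorings finite_words
    by (subst sum.Sigma) (auto intro!: sum.cong)
  also have "\<dots> = (\<Sum>A\<in>{A. A \<subseteq> X \<and> card A = j}. (\<Sum>L\<in>colorings {..<r} A. (\<Sum>ws\<in>words r (X - A). f ws)))"
    unfolding sum.cartesian_product split_def by (rule refl)
  finally show ?thesis .
qed

lemma words_final:
  assumes "finite X"
  shows "card {ws\<in>words r X. sorted_wrt letter_gt ws \<and> 0 \<notin> fst ` set ws} = (r - 1) ^ card X"
proof -
  have "bij_betw set {ws\<in>words r X. sorted_wrt letter_gt ws \<and> 0 \<notin> fst ` set ws} (colorings {1..<r} X)"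
  proof (rule bij_betw_byWitness[of _ desc_list])
    show "\<forall>ws\<in>{ws\<in>words r X. sorted_wrt letter_gt ws \<and> 0 \<notin> fst ` set ws}. desc_list (set ws) = ws"
      using desc_list_set by auto
    have fin: "finite L" if "L \<in> colorings {1..<r} X" for L
    proof -
      have "L \<subseteq> {1..<r} \<times> X" using that unfolding colorings_def by blast
      then show ?thesis using assms by (simp add: finite_subset)
    qed
    then show "\<forall>L\<in>colorings {1..<r} X. set (desc_list L) = L" using desc_list by blast
    show "set ` {ws\<in>words r X. sorted_wrt letter_gt ws \<and> 0 \<notin> fst ` set ws} \<subseteq> colorings {1..<r} X"
      by (force simp: words_def colorings_def distinct_map Suc_le_eq)
    show "desc_list ` colorings {1..<r} X \<subseteq> {ws\<in>words r X. sorted_wrt letter_gt ws \<and> 0 \<notin> fst ` set ws}"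
    proof (rule image_subsetI)
      fix L assume L: "L \<in> colorings {1..<r} X"
      note dl = desc_list[OF fin[OF L]]
      have "distinct (desc_list L)" using dl by (simp add: card_distinct)
      then have "distinct (map snd (desc_list L))" using dl L by (simp add: distinct_map colorings_def)
      moreover have "fst p < r \<and> fst p \<noteq> 0" if "p \<in> L" for p using that L by (auto simp: colorings_def)
      ultimately show "desc_list L \<in> {ws\<in>words r X. sorted_wrt letter_gt ws \<and> 0 \<notin> fst ` set ws}"
        using dl L by (auto simp: words_def colorings_def)
    qed
  qed
  then show ?thesis using card_colorings[OF assms, of "{1..<r}"] by (simp add: bij_betw_same_card)
qed

lemma word_poly_rec:
  assumes "finite X"
  shows "word_poly r X = (\<Sum>k<card X. [:-1, 1:] ^ k * (of_nat (r ^ Suc k) * (\<Sum>A\<in>{A. A \<subseteq> X \<and> card A = Suc k}. word_poly r (X - A))))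
     + [:-1, 1:] ^ card X * of_nat ((r - 1) ^ card X)"
proof -
  let ?y = "[:-1, 1:] :: int poly"
  have fin: "finite (words r X)" by (rule finite_words[OF assms])
  have "word_poly r X = (\<Sum>ws\<in>words r X. (\<Sum>k<card X. if sorted_wrt letter_gt (take (Suc k) ws)
        then ?y ^ k * monom 1 (word_des (drop (Suc k) ws)) else 0) +
     (if sorted_wrt letter_gt ws \<and> 0 \<notin> fst ` set ws then ?y ^ card X else 0))"
    unfolding word_poly_def
  proof (intro sum.cong refl)
    fix ws assume "ws \<in> words r X"
    then have len: "length ws = card X" by (rule words_length)
    show "monom (1::int) (word_des ws) = (\<Sum>k<card X. if sorted_wrt letter_gt (take (Suc k) ws)
        then ?y ^ k * monom 1 (word_des (drop (Suc k) ws)) else 0) +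
     (if sorted_wrt letter_gt ws \<and> 0 \<notin> fst ` set ws then ?y ^ card X else 0)"
      using word_des_expand[of ws] unfolding len .
  qed
  also have "\<dots> = (\<Sum>k<card X. \<Sum>ws\<in>words r X. if sorted_wrt letter_gt (take (Suc k) ws)
        then ?y ^ k * monom 1 (word_des (drop (Suc k) ws)) else 0) + 
     (\<Sum>ws\<in>{ws\<in>words r X. sorted_wrt letter_gt ws \<and> 0 \<notin> fst ` set ws}. ?y ^ card X)"
    unfolding sum.distrib by (subst sum.swap) (simp only: sum.inter_filter[OF fin])
  also have "(\<Sum>ws\<in>{ws\<in>words r X. sorted_wrt letter_gt ws \<and> 0 \<notin> fst ` set ws}. ?y ^ card X) =
      ?y ^ card X * of_nat ((r - 1) ^ card X)"
    using words_final[OF assms] by (simp add: mult.commute)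
  also have "(\<Sum>k<card X. \<Sum>ws\<in>words r X. if sorted_wrt letter_gt (take (Suc k) ws)
        then ?y ^ k * monom 1 (word_des (drop (Suc k) ws)) else 0) =
     (\<Sum>k<card X. ?y ^ k * (\<Sum>ws\<in>{ws\<in>words r X. sorted_wrt letter_gt (take (Suc k) ws)}. monom 1 (word_des (drop (Suc k) ws))))"
    unfolding sum.inter_filter[OF fin, symmetric] sum_distrib_left by (intro sum.cong refl)
  also have "\<dots> = (\<Sum>k<card X. ?y ^ k * (of_nat (r ^ Suc k) * (\<Sum>A\<in>{A. A \<subseteq> X \<and> card A = Suc k}. word_poly r (X - A))))"
  proof (intro sum.cong refl arg_cong[where f = "\<lambda>z. _ * z"])
    fix k assume k: "k \<in> {..<card X}"
    have "(\<Sum>ws\<in>{ws\<in>words r X. sorted_wrt letter_gt (take (Suc k) ws)}. monom (1::int) (word_des (drop (Suc k) ws)))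
      = (\<Sum>A\<in>{A. A \<subseteq> X \<and> card A = Suc k}. (\<Sum>L\<in>colorings {..<r} A. word_poly r (X - A)))"
      unfolding word_poly_def using words_block[OF assms, where j = "Suc k" and f = "\<lambda>ws. monom 1 (word_des ws)"] k by simp
    also have "\<dots> = (\<Sum>A\<in>{A. A \<subseteq> X \<and> card A = Suc k}. of_nat (r ^ Suc k) * word_poly r (X - A))"
    proof (intro sum.cong refl)
      fix A assume A: "A \<in> {A. A \<subseteq> X \<and> card A = Suc k}"
      then have "card (colorings {..<r} A) = r ^ Suc k"
        using card_colorings[of A "{..<r}"] assms finite_subset by auto
      then show "(\<Sum>L\<in>colorings {..<r} A. word_poly r (X - A)) = of_nat (r ^ Suc k) * word_poly r (X - A)"
        by (simp only: sum_constant)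
    qed
    finally show "(\<Sum>ws\<in>{ws\<in>words r X. sorted_wrt letter_gt (take (Suc k) ws)}. monom (1::int) (word_des (drop (Suc k) ws)))
      = of_nat (r ^ Suc k) * (\<Sum>A\<in>{A. A \<subseteq> X \<and> card A = Suc k}. word_poly r (X - A))"
      by (simp only: sum_distrib_left)
  qed
  finally show ?thesis .
qed

text \<open>Both claims are proved in one induction: the recurrence for \<open>X\<close> involves
  sets \<open>X - A\<close>, and the first claim at their smaller sizes replaces these by initial
  intervals.\<close>

lemma word_poly_card:
  assumes "finite X"
  shows "word_poly r X = word_poly r {1..card X} \<and>
    word_poly r X = (\<Sum>k<card X. [:-1, 1:] ^ k * (of_nat (r ^ Suc k) * (of_nat (card X choose Suc k) * word_poly r {1..card X - Suc k})))
     + [:-1, 1:] ^ card X * of_nat ((r - 1) ^ card X)"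
  using assms
proof (induction "card X" arbitrary: X rule: less_induct)
  case less
  have *: "word_poly r Y = (\<Sum>k<card X. [:-1, 1:] ^ k * (of_nat (r ^ Suc k) * (of_nat (card X choose Suc k) * word_poly r {1..card X - Suc k})))
     + [:-1, 1:] ^ card X * of_nat ((r - 1) ^ card X)" if Y: "finite Y" "card Y = card X" for Y
  proof -
    have "(\<Sum>A\<in>{A. A \<subseteq> Y \<and> card A = Suc k}. word_poly r (Y - A)) = of_nat (card X choose Suc k) * word_poly r {1..card X - Suc k}"
      if k: "k < card X" for k
    proof -
      have "word_poly r (Y - A) = word_poly r {1..card X - Suc k}" if A: "A \<subseteq> Y" "card A = Suc k" for A
      proof -
        have "card (Y - A) = card X - Suc k" using A Y by (metis card_Diff_subset finite_subset)
        then show ?thesis using less(1)[of "Y - A"] Y k by auto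
      qed
      then have "(\<Sum>A\<in>{A. A \<subseteq> Y \<and> card A = Suc k}. word_poly r (Y - A)) =
         (\<Sum>A\<in>{A. A \<subseteq> Y \<and> card A = Suc k}. word_poly r {1..card X - Suc k})" by (intro sum.cong) auto
      then show ?thesis using n_subsets[OF Y(1), of "Suc k"] Y by simp
    qed
    then show ?thesis unfolding word_poly_rec[OF Y(1)] Y(2) by simp
  qed
  show ?case using *[of X] *[of "{1..card X}"] less(2) by simp
qed

lemma word_des_map:
  assumes "i \<le> Suc n"
  shows "word_des (map f [i..<Suc n]) = card {k\<in>{i..n}. if k < n then letter_gt (f k) (f (Suc k)) else fst (f k) > 0}"
  using assms
proof (induction rule: inc_induct)
  case base then show ?case by simp
next
  case (step m)
  let ?P = "\<lambda>k. if k < n then letter_gt (f k) (f (Suc k)) else fst (f k) > 0"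
  have "{k\<in>{m..n}. ?P k} = {k\<in>{Suc m..n}. ?P k} \<union> (if ?P m then {m} else {})"
    using step by (auto simp: le_less_Suc_eq not_less_eq_eq Suc_le_eq le_less)
  then have c: "card {k\<in>{m..n}. ?P k} = card {k\<in>{Suc m..n}. ?P k} + (if ?P m then 1 else 0)" by simp
  show ?case
  proof (cases "m = n")
    case True
    then show ?thesis unfolding c using step by simp
  next
    case False
    then have "[m..<Suc n] = m # Suc m # [Suc (Suc m)..<Suc n]" "[Suc m..<Suc n] = Suc m # [Suc (Suc m)..<Suc n]"
      using step by (simp_all add: upt_conv_Cons del: upt_Suc)
    then have "word_des (map f [m..<Suc n]) = (if letter_gt (f m) (f (Suc m)) then 1 else 0) + word_des (map f [Suc m..<Suc n])"
      by (simp del: upt_Suc)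
    then show ?thesis unfolding c step.IH using False step by simp
  qed
qed

lemma eulerian_A_words: "eulerian_A n r = word_poly r {1..n}"
  unfolding eulerian_A_def word_poly_def
proof (rule sum.reindex_bij_witness[of _
      "\<lambda>ws. (\<lambda>k. if k \<in> {1..n} then snd (ws ! (k - 1)) else k, \<lambda>k. if k \<in> {1..n} then fst (ws ! (k - 1)) else 0)"
      "\<lambda>(\<sigma>, \<epsilon>). map (\<lambda>k. (\<epsilon> k, \<sigma> k)) [1..<Suc n]"])
  fix w assume w: "w \<in> colored_permutations n r"
  obtain \<sigma> \<epsilon> where we: "w = (\<sigma>, \<epsilon>)" by (cases w)
  have \<sigma>: "\<sigma> permutes {1..n}" and \<epsilon>: "\<forall>k\<in>{1..n}. \<epsilon> k < r" "\<forall>k. k \<notin> {1..n} \<longrightarrow> \<epsilon> k = 0"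
    using w we by (auto simp: colored_permutations_def)
  have nth: "[1..<Suc n] ! (k - 1) = k" if "k \<in> {1..n}" for k using that by (simp del: upt_Suc)
  show "(\<lambda>ws. (\<lambda>k. if k \<in> {1..n} then snd (ws ! (k - 1)) else k, \<lambda>k. if k \<in> {1..n} then fst (ws ! (k - 1)) else 0))
     (case w of (\<sigma>, \<epsilon>) \<Rightarrow> map (\<lambda>k. (\<epsilon> k, \<sigma> k)) [1..<Suc n]) = w"
    unfolding we using nth \<epsilon>(2) permutes_not_in[OF \<sigma>]
    by (auto simp: fun_eq_iff simp del: upt_Suc)
  have "set [1..<Suc n] = {1..n}" by auto
  then show "(case w of (\<sigma>, \<epsilon>) \<Rightarrow> map (\<lambda>k. (\<epsilon> k, \<sigma> k)) [1..<Suc n]) \<in> words r {1..n}"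
    using \<epsilon> permutes_inj_on[OF \<sigma>, of "{1..n}"] permutes_image[OF \<sigma>] distinct_map[of \<sigma> "[1..<Suc n]"]
    unfolding we words_def by (auto simp: comp_def image_image simp del: upt_Suc distinct_map)
  have "is_descent w k \<longleftrightarrow> (if k < n then letter_gt (\<epsilon> k, \<sigma> k) (\<epsilon> (Suc k), \<sigma> (Suc k)) else \<epsilon> k > 0)" if "k \<in> {1..n}" for k
  proof (cases "k < n")
    case False
    then have k: "k = n" using that by simp
    have "\<sigma> n \<le> n" using permutes_in_image[OF \<sigma>, of n] k that by simp
    then show ?thesis unfolding we is_descent_def using k \<epsilon>(2) permutes_not_in[OF \<sigma>, of "Suc n"] by simp
  qed (simp add: we is_descent_def letter_gt_def)
  then have "{k \<in> {1..n}. is_descent w k} = {k\<in>{1..n}. if k < n then letter_gt (\<epsilon> k, \<sigma> k) (\<epsilon> (Suc k), \<sigma> (Suc k)) else \<epsilon> k > 0}"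
    by blast
  then show "monom 1 (word_des (case w of (\<sigma>, \<epsilon>) \<Rightarrow> map (\<lambda>k. (\<epsilon> k, \<sigma> k)) [1..<Suc n])) = monom (1::int) (des n w)"
    unfolding we des_def using word_des_map[of 1 n "\<lambda>k. (\<epsilon> k, \<sigma> k)"] by (simp del: upt_Suc)
next
  fix ws assume ws: "ws \<in> words r {1..n}"
  have len: "length ws = n" using words_length[OF ws] by simp
  have d: "distinct (map snd ws)" and s: "snd ` set ws = {1..n}" and c: "fst ` set ws \<subseteq> {..<r}"
    using ws by (auto simp: words_def)
  let ?\<sigma> = "\<lambda>k. if k \<in> {1..n} then snd (ws ! (k - 1)) else k"
  let ?\<epsilon> = "\<lambda>k. if k \<in> {1..n} then fst (ws ! (k - 1)) else 0"
  have "map (\<lambda>k. (?\<epsilon> k, ?\<sigma> k)) [1..<Suc n] = ws"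
    by (rule nth_equalityI) (simp_all add: len del: upt_Suc)
  then show "(case (\<lambda>k. if k \<in> {1..n} then snd (ws ! (k - 1)) else k, \<lambda>k. if k \<in> {1..n} then fst (ws ! (k - 1)) else 0)
      of (\<sigma>, \<epsilon>) \<Rightarrow> map (\<lambda>k. (\<epsilon> k, \<sigma> k)) [1..<Suc n]) = ws" by simp
  have "inj_on ?\<sigma> {1..n}"
  proof (rule inj_onI)
    fix i j assume ij: "i \<in> {1..n}" "j \<in> {1..n}" "?\<sigma> i = ?\<sigma> j"
    then have "i - 1 < length ws" "j - 1 < length ws" using len by auto
    then have "map snd ws ! (i - 1) = map snd ws ! (j - 1)" using ij by simp
    then have "i - 1 = j - 1" using nth_eq_iff_index_eq[OF d, of "i - 1" "j - 1"] ij len by auto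
    then show "i = j" using ij by auto
  qed
  moreover have "?\<sigma> ` {1..n} \<subseteq> {1..n}"
  proof (rule image_subsetI)
    fix k assume k: "k \<in> {1..n}"
    then have "ws ! (k - 1) \<in> set ws" using len by (intro nth_mem) auto
    then have "snd (ws ! (k - 1)) \<in> {1..n}" unfolding s[symmetric] by (rule imageI)
    then show "?\<sigma> k \<in> {1..n}" using k by simp
  qed
  ultimately have "bij_betw ?\<sigma> {1..n} {1..n}"
    using endo_inj_surj[of "{1..n}" ?\<sigma>] unfolding bij_betw_def by (intro conjI) simp_all
  then have "?\<sigma> permutes {1..n}" by (rule bij_imp_permutes) (rule if_not_P)
  moreover have "?\<epsilon> k < r" if k: "k \<in> {1..n}" for k
  proof -
    have "ws ! (k - 1) \<in> set ws" using k len by (intro nth_mem) auto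
    then have "fst (ws ! (k - 1)) \<in> {..<r}" using c by (meson imageI subsetD)
    then show ?thesis using k by simp
  qed
  ultimately show "(?\<sigma>, ?\<epsilon>) \<in> colored_permutations n r"
    unfolding colored_permutations_def by simp
qed

text \<open>Multiplication by \<open>t - 1\<close> makes the exponents of \<open>t - 1\<close> and
  of \<open>r\<close> agree, and \<open>t A = (t - 1) A + A\<close> supplies the term
  \<open>k = 0\<close>. In this form the sum is a full binomial convolution, hence a product of
  generating functions.\<close>

lemma eulerian_A_rec:
  "[:0, 1:] * eulerian_A n r = (\<Sum>k\<le>n. of_nat (n choose k) * (of_nat r * [:-1, 1:]) ^ k * eulerian_A (n - k) r)
        + [:-1, 1:] * (of_nat (r - 1) * [:-1, 1:]) ^ n"
proof -
  define y :: "int poly" where "y = [:-1, 1:]"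
  have "eulerian_A n r = (\<Sum>k<n. y ^ k * (of_nat (r ^ Suc k) * (of_nat (n choose Suc k) * eulerian_A (n - Suc k) r)))
     + y ^ n * of_nat ((r - 1) ^ n)"
    unfolding eulerian_A_words y_def using word_poly_card[of "{1..n}" r] by simp
  then have "y * eulerian_A n r = (\<Sum>k<n. of_nat (n choose Suc k) * (of_nat r * y) ^ Suc k * eulerian_A (n - Suc k) r)
     + y * (of_nat (r - 1) * y) ^ n"
    by (simp add: distrib_left sum_distrib_left power_mult_distrib mult_ac)
  moreover have "[:0, 1:] * eulerian_A n r = y * eulerian_A n r + eulerian_A n r"
    by (simp add: y_def)
  moreover have "(\<Sum>k\<le>n. of_nat (n choose k) * (of_nat r * y) ^ k * eulerian_A (n - k) r) =
      eulerian_A n r + (\<Sum>k<n. of_nat (n choose Suc k) * (of_nat r * y) ^ Suc k * eulerian_A (n - Suc k) r)"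
    by (simp add: sum.atMost_shift)
  ultimately show ?thesis unfolding y_def[symmetric] by simp
qed

section \<open>Repeated subdivision at an apex\<close>

lemma star_h_nonface:
  assumes "abs_complex d K" "G \<notin> K"
  shows "star_h d K G = 0"
proof -
  have e: "{F\<in>K. G \<subseteq> F} = {}" using abs_complexD(5)[OF assms(1)] assms(2) by blast
  show ?thesis unfolding star_h_def e by (rule sum.empty)
qed

lemma sdiv_old_iff: "x \<notin> G \<Longrightarrow> G \<in> sdiv K a b x \<longleftrightarrow> G \<in> K \<and> \<not> {a, b} \<subseteq> G"
  by (auto simp: sdiv_def)

lemma sdiv_new_iff:
  assumes "x \<notin> \<Union>K" "x \<notin> G"
  shows "insert x G \<in> sdiv K a b x \<longleftrightarrow> insert a (insert b G) \<in> K \<and> \<not> {a, b} \<subseteq> G"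
proof
  assume "insert x G \<in> sdiv K a b x"
  moreover have "insert x G \<notin> K" using assms by blast
  ultimately obtain H where H: "insert x G = insert x H" "insert a (insert b H) \<in> K" "\<not> {a, b} \<subseteq> H"
    unfolding sdiv_def by auto
  have "x \<notin> H" using assms(1) H(2) by blast
  then have "G = H" using H(1) assms(2) by (metis insert_ident)
  then show "insert a (insert b G) \<in> K \<and> \<not> {a, b} \<subseteq> G" using H by simp
qed (auto intro: sdiv_newI)

definition current :: "('a \<Rightarrow> nat \<Rightarrow> 'a) \<Rightarrow> 'a list \<Rightarrow> 'a set \<Rightarrow> 'a set" where
  "current ver us C = (\<lambda>v. ver v (count_list us v)) ` C"

definition nbrs :: "'a set set \<Rightarrow> 'a \<Rightarrow> 'a set" where
  "nbrs K0 N = {v. v \<noteq> N \<and> {N, v} \<in> K0}"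

definition base :: "'a::euclidean_space set set \<Rightarrow> 'a \<Rightarrow> 'a set \<Rightarrow> int poly" where
  "base K0 N C = star_h DIM('a) K0 (insert N C)"

text \<open>The summand \<open>[:1, 1:] * base K0 N C\<close> is the right value both at the start,
  by the hypothesis on \<open>CC\<close> below, and right after a member of \<open>C\<close> has
  fired, since the link of a new vertex is a suspension. This is why \<open>takeWhile\<close> can
  forget everything before the last firing inside \<open>C\<close>.\<close>

definition live :: "'a::euclidean_space set set \<Rightarrow> 'a \<Rightarrow> 'a list \<Rightarrow> 'a set \<Rightarrow> int poly" where
  "live K0 N us C = [:1, 1:] * base K0 N C +
     [:0, 1:] * (\<Sum>w\<leftarrow>takeWhile (\<lambda>w. w \<notin> C) (rev us). base K0 N (insert w C))"

text \<open>
  Firing a neighbour \<open>v\<close> of \<open>N\<close> subdivides the edge from \<open>N\<close> to the current version of \<open>v\<close>; the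
  new vertex becomes the current version, so the link of \<open>N\<close> never changes up to isomorphism.
  The complex \<open>K\<close> arises from \<open>K0\<close> by firing the entries of \<open>us\<close> in turn, and \<open>ver v i\<close> is the
  \<open>i\<close>-th version of \<open>v\<close>. The star of a face of current versions grows by one term for each vertex
  fired since the last firing of one of its own vertices (\<open>live\<close>), and it is frozen forever when
  one of its vertices fires.
\<close>

locale fired =
  fixes K0 :: "'a::euclidean_space set set" and N :: 'a and CC :: "'a set set"
    and us :: "'a list" and K :: "'a set set" and ver :: "'a \<Rightarrow> nat \<Rightarrow> 'a"
  assumes set_us: "set us \<subseteq> nbrs K0 N"
    and realized: "realizes K"
    and old_vertices: "\<Union>K0 \<subseteq> \<Union>K"
    and ver_0: "ver v 0 = v"
    and ver_vertex: "v \<in> nbrs K0 N \<Longrightarrow> i \<le> count_list us v \<Longrightarrow> ver v i \<in> \<Union>K"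
    and ver_not_apex: "v \<in> nbrs K0 N \<Longrightarrow> i \<le> count_list us v \<Longrightarrow> ver v i \<noteq> N"
    and ver_fresh: "v \<in> nbrs K0 N \<Longrightarrow> i \<le> count_list us v \<Longrightarrow> 0 < i \<Longrightarrow> ver v i \<notin> \<Union>K0"
    and ver_inj: "v \<in> nbrs K0 N \<Longrightarrow> w \<in> nbrs K0 N \<Longrightarrow> i \<le> count_list us v \<Longrightarrow> j \<le> count_list us w \<Longrightarrow>
      ver v i = ver w j \<Longrightarrow> v = w \<and> i = j"
    and frozen_vertex: "v \<in> nbrs K0 N \<Longrightarrow> i < count_list us v \<Longrightarrow> {N, ver v i} \<notin> K"
    and apex_face: "C \<subseteq> nbrs K0 N \<Longrightarrow> insert N (current ver us C) \<in> K \<longleftrightarrow> insert N C \<in> K0"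
    and apex_star: "C \<subseteq> nbrs K0 N \<Longrightarrow> star_h DIM('a) K (insert N (current ver us C)) = base K0 N C"
    and current_star: "C \<in> CC \<Longrightarrow> star_h DIM('a) K (current ver us C) = live K0 N us C"
    and old_nonface: "G \<subseteq> \<Union>K0 \<Longrightarrow> G \<notin> K0 \<Longrightarrow> G \<notin> K"
    and far_face: "G \<in> K0 \<Longrightarrow> N \<notin> G \<Longrightarrow> insert N G \<notin> K0 \<Longrightarrow> G \<in> K \<and> star_h DIM('a) K G = star_h DIM('a) K0 G"
    and frozen_face: "us = us' @ v # ws \<Longrightarrow> C \<in> CC \<Longrightarrow> v \<in> C \<Longrightarrow>
      current ver us' C \<in> K \<and> star_h DIM('a) K (current ver us' C) = live K0 N us' C \<and>
      insert (ver v (Suc (count_list us' v))) (current ver us' C) \<in> K \<and>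
      star_h DIM('a) K (insert (ver v (Suc (count_list us' v))) (current ver us' C)) = base K0 N C"
    and far_nonadjacent: "v \<in> nbrs K0 N \<Longrightarrow> i \<le> count_list us v \<Longrightarrow> 0 < i \<Longrightarrow> y \<in> \<Union>K0 \<Longrightarrow> y \<noteq> N \<Longrightarrow>
      {N, y} \<notin> K0 \<Longrightarrow> {ver v i, y} \<notin> K"
    and frozen_nonadjacent: "us = us' @ v # ws \<Longrightarrow> w \<in> nbrs K0 N \<Longrightarrow> i < count_list us' w \<Longrightarrow>
      {ver v (Suc (count_list us' v)), ver w i} \<notin> K"
    and nonadjacent: "v \<in> nbrs K0 N \<Longrightarrow> w \<in> nbrs K0 N \<Longrightarrow> {v, w} \<notin> K0 \<Longrightarrow> i \<le> count_list us v \<Longrightarrow>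
      j \<le> count_list us w \<Longrightarrow> {ver v i, ver w j} \<notin> K"
begin

lemmas facts = set_us realized old_vertices ver_0 ver_vertex ver_not_apex ver_fresh ver_inj
  frozen_vertex apex_face apex_star current_star old_nonface far_face frozen_face far_nonadjacent
  frozen_nonadjacent nonadjacent

end

context
  fixes K0 :: "'a::euclidean_space set set" and N :: 'a and CC :: "'a set set"
  assumes K0: "realizes K0"
    and CC: "\<And>C. C \<in> CC \<Longrightarrow> N \<notin> C \<and> insert N C \<in> K0 \<and>
        star_h DIM('a) K0 C = [:1, 1:] * star_h DIM('a) K0 (insert N C)"
begin

lemma CC_nbrs:
  assumes "C \<in> CC"
  shows "C \<subseteq> nbrs K0 N"
proof
  fix v assume v: "v \<in> C"
  have C: "N \<notin> C" "insert N C \<in> K0" using CC[OF assms] by blast+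
  have "{N, v} \<in> K0" by (rule abs_complexD(5)[OF realizesD(1)[OF K0] C(2)]) (use v in simp)
  then show "v \<in> nbrs K0 N" using v C(1) by (auto simp: nbrs_def)
qed

lemma fired_Nil: "fired K0 N CC [] K0 (\<lambda>v i. v)"
proof -
  have "v \<in> \<Union>K0" "v \<noteq> N" if "v \<in> nbrs K0 N" for v using that by (auto simp: nbrs_def)
  moreover have "star_h DIM('a) K0 C = live K0 N [] C" if "C \<in> CC" for C
    using CC[OF that] by (simp only: live_def base_def) simp
  moreover have "current (\<lambda>v i. v) [] C = C" for C :: "'a set" by (simp add: current_def)
  ultimately show ?thesis
    by (intro fired.intro) (simp_all add: K0 base_def)
qed

text \<open>With \<open>c\<close> the current version of \<open>v\<close>, the edge
  \<open>{c, N}\<close> is subdivided at \<open>x\<close>. Current faces through \<open>N\<close>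
  are only renamed. A current face without \<open>N\<close> restarts at
  \<open>[:1, 1:] * base\<close> if it involves \<open>v\<close>, and otherwise gains
  \<open>[:0, 1:] * base\<close> with \<open>v\<close> added. Faces not joined to \<open>N\<close>
  keep their stars.\<close>

lemma fired_step:
  assumes st: "fired K0 N CC us K ver" and v: "v \<in> nbrs K0 N"
  shows "\<exists>K' ver'. fired K0 N CC (us @ [v]) K' ver'"
proof -
  let ?d = "DIM('a)"
  note D = fired.facts[OF st]
  note KD = abs_complexD[OF realizesD(1)[OF D(2)]]
  define c where "c = ver v (count_list us v)"
  have cN: "c \<noteq> N" and cK: "c \<in> \<Union>K" using D(5,6)[OF v, of "count_list us v"] by (auto simp: c_def)
  have "insert N {v} \<in> K0" using v by (simp add: nbrs_def)
  then have "{N, c} \<in> K" using D(10)[of "{v}"] v by (simp add: current_def c_def)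
  then have cNK: "{c, N} \<in> K" by (simp add: insert_commute)
  obtain x where x: "x \<notin> \<Union>K" and real: "realizes (sdiv K c N x)"
    using realizes_sdiv[OF D(2) cN cNK] by blast
  define K' where "K' = sdiv K c N x"
  define ver' where "ver' = ver(v := (ver v)(Suc (count_list us v) := x))"
  note A = realizesD(1)[OF D(2)]
  note A' = realizesD(1)[OF real, folded K'_def]
  note sdiv_facts = A x cN cNK
  have NK: "N \<in> \<Union>K" using cNK by blast
  have xN: "x \<noteq> N" and xc: "x \<noteq> c" using x NK cK by auto
  have old: "G \<in> K' \<longleftrightarrow> G \<in> K \<and> \<not> {c, N} \<subseteq> G" if "x \<notin> G" for G
    unfolding K'_def by (rule sdiv_old_iff[OF that])
  have new: "insert x G \<in> K' \<longleftrightarrow> insert c (insert N G) \<in> K \<and> \<not> {c, N} \<subseteq> G" if "x \<notin> G" for G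
    unfolding K'_def by (rule sdiv_new_iff[OF x that])
  have oldno: "G \<notin> K'" if "G \<notin> K" "G \<subseteq> \<Union>K" for G using old[of G] that x by blast
  \<comment> \<open>A face through \<open>c\<close> keeps its star anyway; for the others the
    correction term is the star of a nonface.\<close>
  have frozen: "G \<in> K' \<and> star_h ?d K' G = star_h ?d K G" if G: "G \<in> K" "N \<notin> G" "insert N G \<notin> K" for G
  proof (intro conjI)
    have xG: "x \<notin> G" using x G by blast
    show "G \<in> K'" using old[OF xG] G by blast
    show "star_h ?d K' G = star_h ?d K G"
    proof (cases "c \<in> G")
      case True
      then show ?thesis unfolding K'_def using star_h_sdiv_end[OF sdiv_facts G(1) True G(2)] by simp
    next
      case False
      have "G \<union> {c, N} \<notin> K" using KD(5)[of "G \<union> {c, N}" "insert N G"] G(3) by blast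
      then have "star_h ?d K (G \<union> {c, N}) = 0" by (rule star_h_nonface[OF A])
      then show ?thesis unfolding K'_def using star_h_sdiv_out[OF sdiv_facts G(1) False G(2)] by simp
    qed
  qed
  have cnt: "count_list (us @ [v]) w = count_list us w + (if w = v then 1 else 0)" for w by simp
  have ver_old: "ver' w i = ver w i" if "i \<le> count_list us w" for w i
    using that unfolding ver'_def by auto
  have ver_new: "ver' v (Suc (count_list us v)) = x" unfolding ver'_def by simp
  have ver_cases: "i \<le> count_list us w \<or> (w = v \<and> i = Suc (count_list us v))" if "i \<le> count_list (us @ [v]) w" for w i
    using that unfolding cnt by (cases "w = v") auto
  have cur_prefix: "current ver' us' C = current ver us' C" if "us = us' @ rest" for us' rest C
    unfolding current_def using that by (intro image_cong refl ver_old) simp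
  have cur_in: "v \<in> C \<Longrightarrow> current ver us C = insert c (current ver us (C - {v}))" for C
    unfolding current_def c_def by auto
  have cur'_in: "current ver' (us @ [v]) C = insert x (current ver us (C - {v}))" if "v \<in> C" for C
  proof -
    have "current ver' (us @ [v]) C = insert (ver' v (Suc (count_list us v))) ((\<lambda>w. ver' w (count_list (us @ [v]) w)) ` (C - {v}))"
      unfolding current_def using that by auto
    also have "(\<lambda>w. ver' w (count_list (us @ [v]) w)) ` (C - {v}) = current ver us (C - {v})"
      unfolding current_def by (intro image_cong refl) (auto simp: ver_old)
    finally show ?thesis unfolding ver_new .
  qed
  have cur'_out: "current ver' (us @ [v]) C = current ver us C" if "v \<notin> C" for C
    unfolding current_def using that by (intro image_cong refl) (auto simp: ver_old)
  have cur_sub: "current ver us C \<subseteq> \<Union>K" "N \<notin> current ver us C" "x \<notin> current ver us C" if "C \<subseteq> nbrs K0 N" for C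
  proof -
    show sub: "current ver us C \<subseteq> \<Union>K"
      unfolding current_def using D(5)[OF subsetD[OF that] order.refl] by (rule image_subsetI)
    show "N \<notin> current ver us C" 
      unfolding current_def using D(6)[OF subsetD[OF that] order.refl] by fastforce
    show "x \<notin> current ver us C" using sub x by (rule contra_subsetD)
  qed
  have cur_c: "c \<notin> current ver us C" if "C \<subseteq> nbrs K0 N" "v \<notin> C" for C
    using D(8)[OF v subsetD[OF that(1)]] that(2) unfolding current_def c_def by fastforce
  have nd: "C - {v} \<subseteq> nbrs K0 N" if "C \<subseteq> nbrs K0 N" for C using that by blast
  have "fired K0 N CC (us @ [v]) K' ver'"
  proof (rule fired.intro)
    show "set (us @ [v]) \<subseteq> nbrs K0 N" using D(1) v by simp
    show "realizes K'" unfolding K'_def by (rule real)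
    have sing: "{y} \<in> K'" if "y \<in> \<Union>K" for y
    proof -
      have "{y} \<in> K" using that KD(5) by blast
      moreover have "x \<notin> {y}" using x that by blast
      moreover have "\<not> {c, N} \<subseteq> {y}" using cN by blast
      ultimately show ?thesis using old by blast
    qed
    have UK: "\<Union>K \<subseteq> \<Union>K'" using sing by blast
    show "\<Union>K0 \<subseteq> \<Union>K'" using UK D(3) by blast
    have xK': "x \<in> \<Union>K'" using new[of "{}"] cNK by auto
    show "ver' w 0 = w" for w using D(4) ver_old[of 0] by simp
    fix w assume w: "w \<in> nbrs K0 N"
    show "ver' w i \<in> \<Union>K'" "ver' w i \<noteq> N" if "i \<le> count_list (us @ [v]) w" for i
      using ver_cases[OF that] ver_old ver_new D(5,6)[OF w, of i] xN UK xK' by (metis subsetD)+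
    show "ver' w i \<notin> \<Union>K0" if "i \<le> count_list (us @ [v]) w" "0 < i" for i
      using ver_cases[OF that(1)] ver_old ver_new D(7)[OF w, of i] that(2) x D(3) by (metis subsetD)
    show "{N, ver' w i} \<notin> K'" if i: "i < count_list (us @ [v]) w" for i
    proof (cases "i < count_list us w")
      case True
      have "ver w i \<in> \<Union>K" using D(5)[OF w, of i] True by simp
      then have "{N, ver w i} \<subseteq> \<Union>K" using NK by blast
      then show ?thesis using oldno[OF D(9)[OF w True]] ver_old[of i w] True by simp
    next
      case False
      then have "w = v" "i = count_list us v" using i unfolding cnt by (auto split: if_splits)
      then have "{N, ver' w i} = {c, N}" unfolding c_def using ver_old[of i v] by auto
      then show ?thesis using old[of "{c, N}"] xN xc by auto
    qed
    show "{ver' w i, y} \<notin> K'" if i: "i \<le> count_list (us @ [v]) w" "0 < i" and y: "y \<in> \<Union>K0" "y \<noteq> N" "{N, y} \<notin> K0" for i y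
    proof -
      have yK: "y \<in> \<Union>K" using y D(3) by blast
      consider "i \<le> count_list us w" | "w = v" "i = Suc (count_list us v)" using ver_cases[OF i(1)] by blast
      then show ?thesis
      proof cases
        case 1
        have "{ver w i, y} \<subseteq> \<Union>K" using D(5)[OF w 1] yK by blast
        then show ?thesis using oldno[OF D(16)[OF w 1 i(2) y]] ver_old[OF 1] by simp
      next
        case 2
        have "N \<in> \<Union>K0" using w by (auto simp: nbrs_def)
        then have "{N, y} \<subseteq> \<Union>K0" using y by blast
        then have "{N, y} \<notin> K" using D(13) y(3) by blast
        then have "insert c (insert N {y}) \<notin> K" using KD(5)[of "insert c (insert N {y})" "{N, y}"] by blast
        moreover have "x \<notin> {y}" using yK x by blast
        ultimately have "insert x {y} \<notin> K'" using new by blast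
        then show ?thesis using 2 ver_new by simp
      qed
    qed
    fix w' assume w': "w' \<in> nbrs K0 N"
    show "w = w' \<and> i = j" if i: "i \<le> count_list (us @ [v]) w" and j: "j \<le> count_list (us @ [v]) w'" and eq: "ver' w i = ver' w' j" for i j
    proof -
      have xx: "x \<noteq> ver p k" if "p \<in> nbrs K0 N" "k \<le> count_list us p" for p k using D(5)[OF that] x by blast
      show ?thesis
        using ver_cases[OF i] ver_cases[OF j] eq ver_old ver_new D(8)[OF w w', of i j] xx w w' by metis
    qed
    show "{ver' w i, ver' w' j} \<notin> K'" if nad: "{w, w'} \<notin> K0" and i: "i \<le> count_list (us @ [v]) w" and j: "j \<le> count_list (us @ [v]) w'" for i j
    proof -
      have newcase: "{x, ver q k} \<notin> K'" if q: "q \<in> nbrs K0 N" "{v, q} \<notin> K0" "k \<le> count_list us q" for q k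
      proof -
        have "{c, ver q k} \<notin> K" unfolding c_def using D(18)[OF v q(1,2) _ q(3)] by blast
        then have "insert c (insert N {ver q k}) \<notin> K" 
          using KD(5)[of "insert c (insert N {ver q k})" "{c, ver q k}"] by blast
        moreover have "x \<notin> {ver q k}" using D(5)[OF q(1,3)] x by blast
        ultimately show ?thesis using new by blast
      qed
      \<comment> \<open>A vertex counts as adjacent to itself, which rules out that both
        \<open>w\<close> and \<open>w'\<close> are \<open>v\<close>.\<close>
      have vv: "{v, v} \<in> K0" using v abs_complexD(5)[OF realizesD(1)[OF K0], of "{N, v}" "{v}"] unfolding nbrs_def by auto
      consider (a) "i \<le> count_list us w" "j \<le> count_list us w'"
        | (b) "w = v" "i = Suc (count_list us v)" "j \<le> count_list us w'"
        | (c) "w' = v" "j = Suc (count_list us v)" "i \<le> count_list us w"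
        | (d) "w = v" "w' = v"
        using ver_cases[OF i] ver_cases[OF j] by blast
      then show ?thesis
      proof cases
        case a
        have "{ver w i, ver w' j} \<subseteq> \<Union>K" using D(5)[OF w a(1)] D(5)[OF w' a(2)] by blast
        then show ?thesis using oldno[OF D(18)[OF w w' nad a]] ver_old[OF a(1)] ver_old[OF a(2)] by simp
      next
        case b then show ?thesis using newcase[OF w' _ b(3)] nad ver_new ver_old[OF b(3)] by simp
      next
        case c 
        have "{v, w} \<notin> K0" using nad c by (simp add: insert_commute)
        then show ?thesis using newcase[OF w _ c(3)] c ver_new ver_old[OF c(3)] by (simp add: insert_commute)
      next
        case d then show ?thesis using nad vv by simp
      qed
    qed
  next
    fix C assume C: "C \<subseteq> nbrs K0 N"
    note cs = cur_sub[OF C] and cs' = cur_sub[OF nd[OF C]]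
    have cnv: "c \<notin> current ver us (C - {v})" using cur_c[OF nd[OF C]] by blast
    show iff: "insert N (current ver' (us @ [v]) C) \<in> K' \<longleftrightarrow> insert N C \<in> K0"
    proof (cases "v \<in> C")
      case True
      have "insert N (current ver' (us @ [v]) C) = insert x (insert N (current ver us (C - {v})))"
        unfolding cur'_in[OF True] by (rule insert_commute)
      moreover have "insert c (insert N (insert N (current ver us (C - {v})))) = insert N (current ver us C)"
        unfolding cur_in[OF True] by auto
      ultimately show ?thesis using new[of "insert N (current ver us (C - {v}))"] cs' xN cnv cN D(10)[OF C] by simp
    next
      case False
      then show ?thesis unfolding cur'_out[OF False] using old[of "insert N (current ver us C)"] cs xN cur_c[OF C False] cN D(10)[OF C] by simp
    qed
    show "star_h ?d K' (insert N (current ver' (us @ [v]) C)) = base K0 N C"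
    proof (cases "insert N C \<in> K0")
      case False
      then have "insert N (current ver us C) \<notin> K" using D(10)[OF C] by blast
      then have "base K0 N C = 0" using D(11)[OF C] star_h_nonface[OF A] by metis
      moreover have "insert N (current ver' (us @ [v]) C) \<notin> K'" using iff False by blast
      ultimately show ?thesis using star_h_nonface[OF A'] by metis
    next
      case face: True
      then have f: "insert N (current ver us C) \<in> K" using D(10)[OF C] by blast
      show ?thesis
      proof (cases "v \<in> C")
        case True
        have e: "current ver us (C - {v}) \<union> {c, N} = insert N (current ver us C)" unfolding cur_in[OF True] by auto
        have "star_h ?d K' (insert x (insert N (current ver us (C - {v})))) = star_h ?d K (insert N (current ver us C))"
          unfolding K'_def e[symmetric]
          by (rule star_h_sdiv_new_end[OF sdiv_facts]) (use e f cnv cs' in auto)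
        then show ?thesis unfolding cur'_in[OF True] insert_commute[of N x] D(11)[OF C] .
      next
        case False
        then show ?thesis unfolding cur'_out[OF False] K'_def
          using star_h_sdiv_end'[OF sdiv_facts f] cur_c[OF C False] cN D(11)[OF C] by simp
      qed
    qed
  next
    fix C assume CCC: "C \<in> CC"
    have C: "C \<subseteq> nbrs K0 N" by (rule CC_nbrs[OF CCC])
    note cs = cur_sub[OF C] and cs' = cur_sub[OF nd[OF C]]
    have cnv: "c \<notin> current ver us (C - {v})" using cur_c[OF nd[OF C]] by blast
    have f: "insert N (current ver us C) \<in> K" using D(10)[OF C] CC[OF CCC] by blast
    have f': "current ver us C \<in> K" by (rule KD(5)[OF f]) blast
    show "star_h ?d K' (current ver' (us @ [v]) C) = live K0 N (us @ [v]) C"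
    proof (cases "v \<in> C")
      case True
      have e: "current ver us (C - {v}) \<union> {c, N} = insert N (current ver us C)" unfolding cur_in[OF True] by auto
      have "star_h ?d K' (insert x (current ver us (C - {v}))) = [:1, 1:] * star_h ?d K (insert N (current ver us C))"
        unfolding K'_def e[symmetric]
        by (rule star_h_sdiv_new[OF sdiv_facts]) (use e f cnv cs' in auto)
      then show ?thesis unfolding cur'_in[OF True] D(11)[OF C] live_def using True by simp
    next
      case False
      have e: "current ver us C \<union> {c, N} = insert N (current ver us (insert v C))"
        using cur_in[of "insert v C"] False by auto
      have iC: "insert v C \<subseteq> nbrs K0 N" using C v by blast
      have "star_h ?d K' (current ver us C) = live K0 N us C + [:0, 1:] * base K0 N (insert v C)"
        unfolding K'_def star_h_sdiv_out[OF sdiv_facts f' cur_c[OF C False] cs(2)] e D(11)[OF iC] D(12)[OF CCC] ..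
      then show ?thesis unfolding cur'_out[OF False] live_def using False by (simp add: algebra_simps)
    qed
  next
    show "G \<notin> K'" if "G \<subseteq> \<Union>K0" "G \<notin> K0" for G
      using oldno[OF D(13)[OF that]] that D(3) by blast
  next
    fix G assume G: "G \<in> K0" "N \<notin> G" "insert N G \<notin> K0"
    have "insert N G \<notin> K"
    proof -
      have "N \<in> \<Union>K0" using v by (auto simp: nbrs_def)
      then show ?thesis using D(13)[of "insert N G"] G by blast
    qed
    then show "G \<in> K' \<and> star_h ?d K' G = star_h ?d K0 G"
      using frozen[of G] D(14)[OF G] G(2) by simp
  next
    fix us' v' ws assume us: "us @ [v] = us' @ v' # ws"
    have pre: "current ver' us' C = current ver us' C" for C
      using us cur_prefix[of us' "[]"] cur_prefix[of us' "v' # butlast ws"]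
      by (cases ws rule: rev_cases) auto
    {
      fix C assume CCC: "C \<in> CC" and v': "v' \<in> C"
      have C: "C \<subseteq> nbrs K0 N" by (rule CC_nbrs[OF CCC])
      show "current ver' us' C \<in> K' \<and> star_h ?d K' (current ver' us' C) = live K0 N us' C \<and>
        insert (ver' v' (Suc (count_list us' v'))) (current ver' us' C) \<in> K' \<and>
        star_h ?d K' (insert (ver' v' (Suc (count_list us' v'))) (current ver' us' C)) = base K0 N C"
      proof (cases ws rule: rev_cases)
        \<comment> \<open>The face loses its contact with \<open>N\<close> at this very step: the
          edge from \<open>N\<close> to its vertex \<open>c\<close> is being subdivided. Its star is
          the value of \<open>live\<close> reached so far.\<close>
        case Nil
        then have eq: "us' = us" "v' = v" using us by auto
        note cs = cur_sub[OF C] and cs' = cur_sub[OF nd[OF C]]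
        have vC: "v \<in> C" using v' eq by simp
        have cnv: "c \<notin> current ver us (C - {v})" using cur_c[OF nd[OF C]] by blast
        have cin: "c \<in> current ver us C" unfolding cur_in[OF vC] by blast
        have f: "insert N (current ver us C) \<in> K" using D(10)[OF C] CC[OF CCC] by blast
        have f': "current ver us C \<in> K" by (rule KD(5)[OF f]) blast
        have "current ver us C \<in> K'" using old[OF cs(3)] f' cs(2) by blast
        moreover have "star_h ?d K' (current ver us C) = live K0 N us C"
          unfolding K'_def star_h_sdiv_end[OF sdiv_facts f' cin cs(2)] D(12)[OF CCC] ..
        moreover have "insert x (current ver us C) \<in> K'"
          using new[OF cs(3)] cs(2) f cin by (simp add: insert_absorb insert_commute)
        moreover have "star_h ?d K' (insert x (current ver us C)) = base K0 N C"
        proof -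
          have e: "current ver us (C - {v}) \<union> {N, c} = insert N (current ver us C)" unfolding cur_in[OF vC] by auto
          have "star_h ?d (sdiv K N c x) (insert x (insert c (current ver us (C - {v})))) = star_h ?d K (current ver us (C - {v}) \<union> {N, c})"
            by (rule star_h_sdiv_new_end) (use A x cN cNK e f cnv cs' in \<open>auto simp: insert_commute\<close>)
          moreover have "star_h ?d K (insert N (insert c (current ver us (C - {v})))) = base K0 N C"
            using D(11)[OF C] unfolding cur_in[OF vC] .
          ultimately show ?thesis unfolding K'_def sdiv_commute[of K c] e cur_in[OF vC] by (rule trans)
        qed
        ultimately show ?thesis unfolding pre unfolding eq ver_new by blast
      next
        \<comment> \<open>The face was frozen before: it contains an outdated version of
          \<open>v'\<close>, which is not adjacent to \<open>N\<close>.\<close>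
        case (snoc ws' z)
        then have eq: "us = us' @ v' # ws'" using us by auto
        have vn: "v' \<in> nbrs K0 N" using C v' by blast
        have less: "count_list us' v' < count_list us v'" unfolding eq by simp
        have vv: "ver' v' (Suc (count_list us' v')) = ver v' (Suc (count_list us' v'))"
          using ver_old less by simp
        have inn: "ver v' (count_list us' v') \<in> current ver us' C" unfolding current_def using v' by blast
        have nf: "insert N G \<notin> K" if "current ver us' C \<subseteq> G" for G
          using D(9)[OF vn less] KD(5)[of "insert N G" "{N, ver v' (count_list us' v')}"] inn that by blast
        have "count_list us' w \<le> count_list us w" for w unfolding eq by simp
        then have Nn: "N \<notin> current ver us' C" unfolding current_def using D(6) C by blast
        have Nn': "N \<notin> insert (ver v' (Suc (count_list us' v'))) (current ver us' C)"
          using Nn D(6)[OF vn, of "Suc (count_list us' v')"] less by auto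
        note E = D(15)[OF eq CCC v']
        show ?thesis unfolding pre vv
          using frozen[of "current ver us' C"] Nn nf[of "current ver us' C"]
            frozen[of "insert (ver v' (Suc (count_list us' v'))) (current ver us' C)"] Nn'
            nf[of "insert (ver v' (Suc (count_list us' v'))) (current ver us' C)"] E by auto
      qed
    }
    fix w i assume w: "w \<in> nbrs K0 N" and i: "i < count_list us' w"
    show "{ver' v' (Suc (count_list us' v')), ver' w i} \<notin> K'"
    proof (cases ws rule: rev_cases)
      case Nil
      then have eq: "us' = us" "v' = v" using us by auto
      have il: "i < count_list us w" using i eq by simp
      have "{N, ver w i} \<notin> K" by (rule D(9)[OF w il])
      then have "insert c (insert N {ver w i}) \<notin> K" using KD(5)[of "insert c (insert N {ver w i})" "{N, ver w i}"] by blast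
      moreover have "x \<notin> {ver w i}" using D(5)[OF w, of i] il x by auto
      ultimately have "insert x {ver w i} \<notin> K'" using new by blast
      then show ?thesis unfolding eq ver_new using ver_old[of i w] il by simp
    next
      case (snoc ws' z)
      then have eq: "us = us' @ v' # ws'" using us by auto
      have vn: "v' \<in> nbrs K0 N" using D(1) unfolding eq by simp
      have le: "Suc (count_list us' v') \<le> count_list us v'" "i \<le> count_list us w" unfolding eq using i by simp_all
      have "{ver v' (Suc (count_list us' v')), ver w i} \<subseteq> \<Union>K" using D(5)[OF vn le(1)] D(5)[OF w le(2)] by blast
      then show ?thesis using oldno[OF D(17)[OF eq w i]] ver_old[OF le(1)] ver_old[OF le(2)] by simp
    qed
  qed
  then show ?thesis by blast
qed

lemma fired_exists: "set us \<subseteq> nbrs K0 N \<Longrightarrow> \<exists>K ver. fired K0 N CC us K ver"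
proof (induction us rule: rev_induct)
  case Nil
  then show ?case using fired_Nil by blast
next
  case (snoc v us)
  then obtain K ver where "fired K0 N CC us K ver" by auto
  moreover have "v \<in> nbrs K0 N" using snoc.prems by simp
  ultimately show ?case by (rule fired_step)
qed

end

section \<open>The firing schedule\<close>

lemma count_list_replicate': "count_list (replicate n x) y = (if x = y then n else 0)"
  by (induction n) auto

lemma count_list_distinct: "distinct xs \<Longrightarrow> count_list xs x = (if x \<in> set xs then 1 else 0)"
  by (induction xs) auto

text \<open>The increments telescope: when the rounds \<open>n, ..., k\<close> are over, a set of
  size \<open>s \<ge> k\<close> has been fired \<open>m (s - k + 1) - m 0\<close> times in
  them.\<close>

definition round_list :: "(nat \<Rightarrow> nat) \<Rightarrow> 'a set list \<Rightarrow> nat \<Rightarrow> 'a set list" where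
  "round_list m Ls k = concat (map (\<lambda>T. if k \<le> card T
     then replicate (m (card T - k + 1) - m (card T - k)) T else []) Ls)"

fun rounds :: "(nat \<Rightarrow> nat) \<Rightarrow> 'a set list \<Rightarrow> nat \<Rightarrow> nat \<Rightarrow> 'a set list" where
  "rounds m Ls n 0 = []"
| "rounds m Ls n (Suc j) = rounds m Ls n j @ round_list m Ls (n - j)"

lemma round_list_append: "round_list m (xs @ ys) k = round_list m xs k @ round_list m ys k"
  by (simp add: round_list_def)

lemma set_round_list: "set (round_list m Ls k) \<subseteq> {T\<in>set Ls. k \<le> card T}"
  by (auto simp: round_list_def split: if_splits)

lemma count_round_list:
  "distinct Ls \<Longrightarrow> count_list (round_list m Ls k) U =
     (if U \<in> set Ls \<and> k \<le> card U then m (card U - k + 1) - m (card U - k) else 0)"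
  by (induction Ls) (auto simp: round_list_def count_list_replicate' count_list_0_iff)

lemma set_rounds: "set (rounds m Ls n j) \<subseteq> set Ls"
  by (induction j) (use set_round_list in fastforce)+

text \<open>For sets too small to have been reached yet, the truncated subtraction makes the
  right-hand side \<open>m 0 - m 0 = 0\<close>.\<close>

lemma count_rounds:
  assumes "distinct Ls" "U \<in> set Ls" "card U \<le> n" "j \<le> n" and m: "mono m"
  shows "count_list (rounds m Ls n j) U = m (card U - (n - j)) - m 0"
  using assms(4)
proof (induction j)
  case 0 then show ?case using assms(3) by simp
next
  case (Suc j)
  define k where "k = n - j"
  have k: "k \<ge> 1" "n - Suc j = k - 1" using Suc.prems by (auto simp: k_def)
  have IH: "count_list (rounds m Ls n j) U = m (card U - k) - m 0" using Suc by (simp add: k_def)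
  show ?case
  proof (cases "k \<le> card U")
    case True
    then have e: "card U - (k - 1) = card U - k + 1" using k by linarith
    have "m 0 \<le> m (card U - k)" "m (card U - k) \<le> m (card U - k + 1)" using m by (auto intro: monoD)
    moreover have "count_list (rounds m Ls n (Suc j)) U = (m (card U - k) - m 0) + (m (card U - k + 1) - m (card U - k))"
      using True IH by (simp add: k_def[symmetric] count_round_list assms)
    ultimately show ?thesis unfolding k(2) e by linarith
  next
    case False
    then show ?thesis using IH k by (simp add: k_def[symmetric] count_round_list assms)
  qed
qed

text \<open>
  After every set has been fired once, by increasing size, the rounds \<open>k = n, ..., 1\<close> ensure that, when
  a set \<open>T\<close> is fired for the second time, every larger set \<open>U\<close> has been fired \<open>m (card U - card T)\<close>
  times since the first firing of \<open>T\<close>.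
\<close>

definition schedule :: "(nat \<Rightarrow> nat) \<Rightarrow> 'a set list \<Rightarrow> nat \<Rightarrow> 'a set list" where
  "schedule m Ls n = Ls @ rounds m Ls n n"

lemma rounds_prefix: "j \<le> i \<Longrightarrow> \<exists>rest. rounds m Ls n i = rounds m Ls n j @ rest"
proof (induction i)
  case (Suc i)
  then show ?case by (cases "j = Suc i") auto
qed simp

lemma sorted_ex:
  assumes "finite S"
  shows "\<exists>Ls. distinct Ls \<and> set Ls = S \<and> sorted (map card Ls)"
proof -
  obtain xs where "set xs = S" "distinct xs" using finite_distinct_list[OF assms] by blast
  then show ?thesis by (intro exI[of _ "sort_key card xs"]) simp
qed

context
  fixes m :: "nat \<Rightarrow> nat" and Ls :: "'a set list" and n :: nat
  assumes d: "distinct Ls" and s: "sorted (map card Ls)" and le: "\<And>U. U \<in> set Ls \<Longrightarrow> 1 \<le> card U \<and> card U \<le> n"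
    and m: "mono m" "m 0 = 1" "m 0 < m 1"
begin

lemma count_schedule:
  assumes "U \<in> set Ls"
  shows "count_list (schedule m Ls n) U = m (card U)"
proof -
  have "m 0 \<le> m (card U)" using m(1) by (auto intro: monoD)
  then show ?thesis
    using assms le[OF assms] d m by (simp add: schedule_def count_rounds count_list_distinct)
qed

lemma schedule_first:
  assumes "T \<in> set Ls"
  obtains us ws where "schedule m Ls n = us @ T # ws" "distinct us" "sorted (map card us)"
    "set us \<subseteq> set Ls - {T}" "\<forall>U\<in>set us. card U \<le> card T" "\<forall>U\<in>set Ls. card U < card T \<longrightarrow> U \<in> set us"
proof -
  obtain us ws where Ls: "Ls = us @ T # ws" using split_list[OF assms] by blast
  have "\<forall>U\<in>set us. card U \<le> card T" "\<forall>U\<in>set ws. card T \<le> card U" using s unfolding Ls by (auto simp: sorted_append)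
  then have "\<forall>U\<in>set Ls. card U < card T \<longrightarrow> U \<in> set us" unfolding Ls by auto
  moreover have "distinct us" "sorted (map card us)" "set us \<subseteq> set Ls - {T}" using d s unfolding Ls by (auto simp: sorted_append)
  moreover have "schedule m Ls n = us @ T # (ws @ rounds m Ls n n)" by (simp add: schedule_def Ls)
  ultimately show thesis using that \<open>\<forall>U\<in>set us. card U \<le> card T\<close> by blast
qed

text \<open>After the first pass, \<open>T\<close> fires next in the round with index
  \<open>card T\<close>, where it does fire because \<open>m 0 < m 1\<close>. By then a larger set
  \<open>U\<close> has fired once in the first pass, after \<open>T\<close>, and
  \<open>m (card U - card T) - m 0\<close> times in the rounds; with \<open>m 0 = 1\<close> the
  total is as desired. Counts for other sets of the size of \<open>T\<close> are left open, since
  these are incomparable with \<open>T\<close>.\<close>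

lemma schedule_second:
  assumes T: "T \<in> set Ls"
  obtains us vs ws where "schedule m Ls n = us @ T # vs @ T # ws" "distinct us" 
    "set us \<subseteq> set Ls - {T}" "\<forall>U\<in>set Ls. card U < card T \<longrightarrow> U \<in> set us" "set vs \<subseteq> set Ls - {T}"
    "\<forall>U\<in>set Ls. card T < card U \<longrightarrow> count_list vs U = m (card U - card T)"
    "\<forall>U\<in>set Ls. card U < card T \<longrightarrow> count_list vs U = 0"
proof -
  define k where "k = card T"
  have k: "1 \<le> k" "k \<le> n" using le[OF T] by (auto simp: k_def)
  obtain us ws where Ls: "Ls = us @ T # ws" using split_list[OF T] by blast
  have us: "\<forall>U\<in>set us. card U \<le> k" and ws: "\<forall>U\<in>set ws. k \<le> card U"
    using s unfolding Ls by (auto simp: sorted_append k_def)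
  have dd: "distinct us" "distinct ws" "T \<notin> set us" "T \<notin> set ws" "set us \<inter> set ws = {}" using d unfolding Ls by auto
  obtain x where x: "m 1 - m 0 = Suc x" using m(3) by (metis Suc_diff_Suc)
  define vs where "vs = ws @ rounds m Ls n (n - k) @ round_list m us k"
  have "round_list m Ls k = round_list m us k @ replicate (Suc x) T @ round_list m ws k"
    unfolding Ls round_list_append x[symmetric] using round_list_append[of m "[T]" ws k]
    by (simp add: round_list_def k_def)
  then have rl: "round_list m Ls k = round_list m us k @ T # (replicate x T @ round_list m ws k)" by simp
  have "rounds m Ls n (Suc (n - k)) = rounds m Ls n (n - k) @ round_list m Ls k" using k by simp
  moreover have "Suc (n - k) \<le> n" using k by linarith
  then obtain rest where "rounds m Ls n n = rounds m Ls n (Suc (n - k)) @ rest"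
    using rounds_prefix[of "Suc (n - k)" n m Ls n] by blast
  ultimately have "schedule m Ls n = us @ T # vs @ T # (replicate x T @ round_list m ws k @ rest)"
    unfolding schedule_def vs_def by (subst (1) Ls) (simp add: rl)
  moreover have "\<forall>U\<in>set Ls. card U < card T \<longrightarrow> U \<in> set us" using ws unfolding Ls k_def by auto
  moreover have r: "count_list (rounds m Ls n (n - k)) U = m (card U - k) - m 0" if "U \<in> set Ls" for U
    using count_rounds[OF d that] le[OF that] m(1) k by simp
  have "T \<notin> set (rounds m Ls n (n - k))" using r[OF T] by (simp add: k_def count_list_0_iff)
  then have "set vs \<subseteq> set Ls - {T}"
    unfolding vs_def using set_rounds[of m Ls n "n - k"] set_round_list[of m us k] dd by (auto simp: Ls)
  moreover have "\<forall>U\<in>set Ls. card T < card U \<longrightarrow> count_list vs U = m (card U - card T)"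
  proof (intro ballI impI)
    fix U assume U: "U \<in> set Ls" "card T < card U"
    then have "U \<in> set ws" "U \<notin> set us" using us unfolding Ls k_def by auto
    then have "count_list vs U = 1 + (m (card U - k) - m 0)"
      unfolding vs_def using r[OF U(1)] dd by (simp add: count_list_distinct count_round_list)
    moreover have "m 0 \<le> m (card U - k)" using m(1) by (auto intro: monoD)
    ultimately show "count_list vs U = m (card U - card T)" using m(2) by (simp add: k_def)
  qed
  moreover have "\<forall>U\<in>set Ls. card U < card T \<longrightarrow> count_list vs U = 0"
  proof (intro ballI impI)
    fix U assume U: "U \<in> set Ls" "card U < card T"
    then have "U \<notin> set ws" using ws unfolding k_def by auto
    then show "count_list vs U = 0"
      unfolding vs_def using r[OF U(1)] U(2) dd by (simp add: count_round_list k_def)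
  qed
  moreover have "set us \<subseteq> set Ls - {T}" using dd unfolding Ls by auto
  ultimately show thesis using that dd(1) by blast
qed

end

section \<open>Sums over subsets and weights of chains\<close>

lemma sum_subsets_card:
  fixes f :: "nat \<Rightarrow> int poly"
  assumes "finite T"
  shows "(\<Sum>U\<in>Pow T. f (card U)) = (\<Sum>j\<le>card T. of_nat (card T choose j) * f j)"
proof -
  have "(\<Sum>U\<in>Pow T. f (card U)) = (\<Sum>j\<le>card T. \<Sum>U\<in>{U\<in>Pow T. card U = j}. f (card U))"
    using assms by (intro sum.group[symmetric]) (auto simp: card_mono)
  also have "\<dots> = (\<Sum>j\<le>card T. of_nat (card {U\<in>Pow T. card U = j}) * f j)"
    by (intro sum.cong refl) simp
  also have "\<dots> = (\<Sum>j\<le>card T. of_nat (card T choose j) * f j)"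
    using n_subsets[OF assms] by simp
  finally show ?thesis .
qed

lemma sum_interval_card:
  fixes f :: "nat \<Rightarrow> int poly"
  assumes "finite T" "S \<subseteq> T"
  shows "(\<Sum>U\<in>{U. S \<subseteq> U \<and> U \<subseteq> T}. f (card U - card S)) =
    (\<Sum>j\<le>card T - card S. of_nat ((card T - card S) choose j) * f j)"
proof -
  have fS: "finite S" using assms finite_subset by blast
  have "(\<Sum>U\<in>{U. S \<subseteq> U \<and> U \<subseteq> T}. f (card U - card S)) = (\<Sum>V\<in>Pow (T - S). f (card V))"
  proof (rule sum.reindex_bij_witness[of _ "\<lambda>V. V \<union> S" "\<lambda>U. U - S"])
    fix U assume U: "U \<in> {U. S \<subseteq> U \<and> U \<subseteq> T}"
    then show "f (card (U - S)) = f (card U - card S)" using fS by (simp add: card_Diff_subset)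
  qed (use assms in auto)
  also have "\<dots> = (\<Sum>j\<le>card T - card S. of_nat ((card T - card S) choose j) * f j)"
    using sum_subsets_card[of "T - S" f] assms fS by (simp add: card_Diff_subset)
  finally show ?thesis .
qed

lemma sum_list_count:
  fixes f :: "'b \<Rightarrow> int poly"
  assumes "finite S" "set xs \<subseteq> S"
  shows "sum_list (map f xs) = (\<Sum>x\<in>S. of_nat (count_list xs x) * f x)"
  using assms(2)
proof (induction xs)
  case (Cons a xs)
  have "(\<Sum>x\<in>S. of_nat (count_list (a # xs) x) * f x) = (\<Sum>x\<in>S. (if x = a then f x else 0) + of_nat (count_list xs x) * f x)"
    by (intro sum.cong) (auto simp: algebra_simps)
  also have "\<dots> = f a + (\<Sum>x\<in>S. of_nat (count_list xs x) * f x)"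
    using Cons.prems assms(1) by (simp add: sum.distrib)
  finally show ?case using Cons by simp
qed simp

text \<open>
  The weight of a chain of label sets of sizes \<open>s_1 < ... < s_k\<close>: its link is to look like the join
  of spheres with \<open>h\<close>-polynomials \<open>perm_h (s_(i+1) - s_i)\<close> and \<open>sphere_h r (n - s_k)\<close>.
\<close>

fun chain_weight :: "nat \<Rightarrow> nat \<Rightarrow> nat \<Rightarrow> nat list \<Rightarrow> int poly" where
  "chain_weight r n p [] = sphere_h r (n - p)"
| "chain_weight r n p (s # ss) = perm_h (s - p) * chain_weight r n s ss"

text \<open>The weight of a chain without its last factor, for splitting a chain at the place where
  a further set is inserted.\<close>

fun gap_weight :: "nat \<Rightarrow> nat list \<Rightarrow> int poly" where
  "gap_weight p [] = 1"
| "gap_weight p (s # ss) = perm_h (s - p) * gap_weight s ss"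

lemma chain_weight_append:
  "chain_weight r n p (xs @ ys) = gap_weight p xs * chain_weight r n (last (p # xs)) ys"
  by (induction xs arbitrary: p) (auto simp: mult.assoc)

lemma chain_weight_Suc: "chain_weight r (Suc n) (Suc p) (map Suc xs) = chain_weight r n p xs"
  by (induction xs arbitrary: p) auto

lemma perm_h_1: "perm_h (Suc 0) = 1"
  by (simp add: perm_h.simps(2))

lemma mult_at_0: "r \<ge> 1 \<Longrightarrow> mult_at r 0 = 1"
  by (simp add: mult_at_def)

text \<open>The additive form avoids truncated subtraction. It yields the monotonicity of the
  multiplicities and, for \<open>r \<ge> 2\<close>, the strict first increment that guarantees a
  second firing of every set.\<close>

lemma mult_at_Suc:
  assumes "r \<ge> 1"
  shows "mult_at r (Suc j) = r * mult_at r j + (r - 1) ^ Suc j"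
proof -
  obtain s where r: "r = Suc s" using assms by (cases r) auto
  have "s ^ Suc j \<le> r ^ Suc j" unfolding r by (intro power_mono) auto
  then obtain x where x: "r ^ Suc j = s ^ Suc j + x" by (metis le_Suc_ex)
  have "r ^ Suc (Suc j) = s ^ Suc (Suc j) + (s ^ Suc j + r * x)"
    using arg_cong[OF x, of "\<lambda>z. r * z"] unfolding r by (simp add: algebra_simps)
  then show ?thesis unfolding mult_at_def using x r by simp
qed

lemma mult_at_mono: "r \<ge> 1 \<Longrightarrow> mono (mult_at r)"
  unfolding mono_iff_le_Suc by (simp add: mult_at_Suc trans_le_add1)

lemma mult_at_1: "r \<ge> 2 \<Longrightarrow> mult_at r 0 < mult_at r 1"
  using mult_at_Suc[of r 0] by (simp add: mult_at_0)

section \<open>Passing to the next dimension\<close>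

definition chain_list :: "'a set \<Rightarrow> 'a set list \<Rightarrow> bool" where
  "chain_list A xs \<longleftrightarrow> sorted_wrt (\<subset>) xs \<and> set xs \<subseteq> Pow A - {{}}"

text \<open>For \<open>R\<close> a set of basis vectors, these are the faces of the cross-polytope
  in the directions \<open>R\<close>.\<close>

definition poles :: "'a::real_vector set \<Rightarrow> 'a set \<Rightarrow> bool" where
  "poles R J \<longleftrightarrow> J \<subseteq> R \<union> uminus ` R \<and> (\<forall>b\<in>R. \<not> {b, - b} \<subseteq> J)"

text \<open>
  All stages of the construction take place in full dimension: the complex is the join of the
  sphere built so far, in the directions \<open>A\<close>, with the cross-polytope on the remaining directions,
  whose vertices contribute the factors \<open>1 + t\<close>.
\<close>

definition labelled :: "nat \<Rightarrow> 'a::euclidean_space set \<Rightarrow> 'a set set \<Rightarrow> ('a set \<Rightarrow> 'a) \<Rightarrow> bool" where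
  "labelled r A K v \<longleftrightarrow> realizes K \<and> (\<forall>b\<in>Basis - A. {b, - b} \<notin> K) \<and>
     (\<forall>xs J. chain_list A xs \<longrightarrow> poles (Basis - A) J \<longrightarrow> v ` set xs \<union> J \<in> K \<and>
        star_h DIM('a) K (v ` set xs \<union> J) =
          chain_weight r (card A) 0 (map card xs) * [:1, 1:] ^ (DIM('a) - card A - card J)) \<and>
     inj_on v (Pow A - {{}}) \<and>
     (\<forall>S\<in>Pow A - {{}}. v S \<notin> (Basis - A) \<union> uminus ` (Basis - A)) \<and>
     (\<forall>S\<in>Pow A - {{}}. \<forall>T\<in>Pow A - {{}}. \<not> S \<subseteq> T \<longrightarrow> \<not> T \<subseteq> S \<longrightarrow> {v S, v T} \<notin> K)"

lemma Basis_neq_minus: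
  assumes "b \<in> Basis" "c \<in> Basis"
  shows "b \<noteq> - c"
proof
  assume "b = - c"
  then have "b \<bullet> c = - 1" using assms by (simp add: inner_Basis)
  then show False using assms by (simp add: inner_Basis split: if_splits)
qed

lemma card_poles:
  assumes "R \<subseteq> Basis" "poles R J"
  shows "inj_on (\<lambda>p. if p \<in> R then p else - p) J" "(\<lambda>p. if p \<in> R then p else - p) ` J \<subseteq> R"
    "finite J" "card J \<le> card R"
proof -
  have J: "J \<subseteq> R \<union> uminus ` R" "\<And>c. c \<in> R \<Longrightarrow> \<not> {c, - c} \<subseteq> J" using assms(2) by (auto simp: poles_def)
  have fR: "finite R" using assms(1) finite_Basis finite_subset by blast
  show inj: "inj_on (\<lambda>p. if p \<in> R then p else - p) J"
  proof (rule inj_onI)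
    fix p q assume p: "p \<in> J" and q: "q \<in> J" and eq: "(if p \<in> R then p else - p) = (if q \<in> R then q else - q)"
    have "p \<noteq> - q" if "p \<in> R" using J(2)[OF that] p q by auto
    moreover have "q \<noteq> - p" if "q \<in> R" using J(2)[OF that] p q by auto
    ultimately show "p = q" using eq by (metis minus_minus)
  qed
  show sub: "(\<lambda>p. if p \<in> R then p else - p) ` J \<subseteq> R" using J(1) by auto
  show "finite J" using J(1) fR by (meson finite_Un finite_imageI finite_subset)
  show "card J \<le> card R" by (rule card_inj_on_le[OF inj sub fR])
qed

text \<open>The members without \<open>b\<close> precede those with \<open>b\<close>. In
  \<open>ys\<close> the element \<open>b\<close> has been removed, so its first member may be empty
  or equal to the last member of \<open>xs1\<close>; for this reason the inclusions between the two
  parts are not strict.\<close>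

lemma chain_split:
  assumes "chain_list (insert b A) xs" "b \<notin> A"
  shows "\<exists>xs1 ys. xs = xs1 @ map (insert b) ys \<and> set xs1 \<subseteq> Pow A - {{}} \<and> set ys \<subseteq> Pow A \<and>
    sorted_wrt (\<subset>) xs1 \<and> sorted_wrt (\<subset>) ys \<and> (\<forall>x\<in>set xs1. \<forall>y\<in>set ys. x \<subseteq> y)"
  using assms(1)
proof (induction xs)
  case Nil then show ?case by (intro exI[of _ "[]"]) simp
next
  case (Cons x xs)
  have x: "x \<subseteq> insert b A" "x \<noteq> {}" "\<forall>y\<in>set xs. x \<subset> y" and ch: "chain_list (insert b A) xs"
    using Cons.prems by (auto simp: chain_list_def)
  obtain xs1 ys where IH: "xs = xs1 @ map (insert b) ys" "set xs1 \<subseteq> Pow A - {{}}" "set ys \<subseteq> Pow A"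
    "sorted_wrt (\<subset>) xs1" "sorted_wrt (\<subset>) ys" "\<forall>x\<in>set xs1. \<forall>y\<in>set ys. x \<subseteq> y"
    using Cons.IH[OF ch] by (elim exE conjE) (rule that)
  show ?case
  proof (cases "b \<in> x")
    case False
    then have xA: "x \<subseteq> A" using x(1) by blast
    have xy: "x \<subseteq> y" if "y \<in> set ys" for y
    proof -
      have "x \<subset> insert b y" using x(3) IH(1) that by simp
      then show ?thesis using False by blast
    qed
    show ?thesis
    proof (rule exI[of _ "x # xs1"], rule exI[of _ ys], intro conjI)
      show "sorted_wrt (\<subset>) (x # xs1)" using x(3) IH(1,4) by simp
      show "set (x # xs1) \<subseteq> Pow A - {{}}" using xA x(2) IH(2) by simp
      show "\<forall>z\<in>set (x # xs1). \<forall>y\<in>set ys. z \<subseteq> y" using xy IH(6) by simp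
    qed (simp_all add: IH(1,3,5))
  next
    case True
    have xs1: "xs1 = []"
    proof (rule ccontr)
      assume "xs1 \<noteq> []"
      then obtain z where "z \<in> set xs1" by (meson list.set_sel(1))
      then have "x \<subset> z" "z \<subseteq> A" using x(3) IH(1,2) by auto
      then show False using True assms(2) by blast
    qed
    have xy: "x - {b} \<subset> y" if y: "y \<in> set ys" for y
    proof -
      have "x \<subset> insert b y" using x(3) IH(1) y by simp
      moreover have "b \<notin> y" using IH(3) y assms(2) by blast
      ultimately have "x \<subset> insert b y" "b \<notin> y" by blast+
      then show ?thesis using True by blast
    qed
    show ?thesis
    proof (rule exI[of _ "[]"], rule exI[of _ "(x - {b}) # ys"], intro conjI)
      show "x # xs = [] @ map (insert b) ((x - {b}) # ys)" using IH(1) xs1 True by (simp add: insert_absorb)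
      show "set ((x - {b}) # ys) \<subseteq> Pow A" using IH(3) x(1) by auto
      show "sorted_wrt (\<subset>) ((x - {b}) # ys)" using IH(5) xy by simp
    qed simp_all
  qed
qed

lemma count_list_map_inj:
  "inj_on f S \<Longrightarrow> set xs \<subseteq> S \<Longrightarrow> x \<in> S \<Longrightarrow> count_list (map f xs) (f x) = count_list xs x"
  by (induction xs) (auto simp: inj_on_eq_iff)

lemma subset_last: "sorted_wrt (\<subset>) (xs :: 'a set list) \<Longrightarrow> x \<in> set xs \<Longrightarrow> x \<subseteq> last xs"
  by (induction xs rule: rev_induct) (auto simp: sorted_wrt_append)

lemma chain_last:
  assumes "chain_list A xs"
  shows "last ({} # xs) \<subseteq> A" "last ({} # xs) \<noteq> {} \<Longrightarrow> last ({} # xs) \<in> set xs \<and> last ({} # xs) \<in> Pow A - {{}}"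
proof -
  have "last ({} # xs) = last xs \<and> last xs \<in> set xs \<and> last xs \<in> Pow A - {{}}" if "xs \<noteq> []"
  proof -
    have l: "last xs \<in> set xs" by (rule last_in_set[OF that])
    moreover have "last xs \<in> Pow A - {{}}" by (rule subsetD[OF _ l]) (use assms in \<open>simp add: chain_list_def\<close>)
    ultimately show ?thesis using that by simp
  qed
  then show "last ({} # xs) \<subseteq> A" "last ({} # xs) \<noteq> {} \<Longrightarrow> last ({} # xs) \<in> set xs \<and> last ({} # xs) \<in> Pow A - {{}}"
    by (cases "xs = []"; simp)+
qed

lemma chain_insert:
  assumes "chain_list A (xs @ ys)" "last ({} # xs) \<subset> U" "U \<subseteq> A" "\<And>y. y \<in> set ys \<Longrightarrow> U \<subset> y"
  shows "chain_list A (xs @ U # ys)"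
proof -
  have s: "sorted_wrt (\<subset>) xs" "sorted_wrt (\<subset>) ys" "\<forall>x\<in>set xs. \<forall>y\<in>set ys. x \<subset> y"
    using assms(1) by (simp_all add: chain_list_def sorted_wrt_append)
  have "x \<subset> U" if "x \<in> set xs" for x
  proof -
    have "last ({} # xs) = last xs" using that by auto
    then show ?thesis using subset_last[OF s(1) that] assms(2) by simp
  qed
  moreover have "U \<noteq> {}" using assms(2) by blast
  ultimately show ?thesis using s assms by (simp add: chain_list_def sorted_wrt_append)
qed

context
  fixes r :: nat and A :: "'a::euclidean_space set" and b :: 'a and K0 :: "'a set set" and v :: "'a set \<Rightarrow> 'a"
  assumes lab: "labelled r A K0 v" and A: "A \<subseteq> Basis" and b: "b \<in> Basis" "b \<notin> A" and r: "r \<ge> 2"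
begin

abbreviation (input) "R' \<equiv> Basis - insert b A"

abbreviation (input) "lbl \<equiv> Pow A - {{}}"

abbreviation (input) "Y \<equiv> [:1, 1:] :: int poly"

text \<open>The tracked faces avoid the direction \<open>b\<close>, which is reserved for the
  suspension: \<open>b\<close> is the apex at which edges are subdivided and \<open>- b\<close> is
  the opposite one.\<close>

definition "CC = {v ` set xs \<union> J | xs J. chain_list A xs \<and> poles R' J}"

definition "free_exp J = DIM('a) - card A - 1 - card J" for J :: "'a set"

lemma finA: "finite A" using A finite_subset finite_Basis by blast

lemma labD:
  "realizes K0" "c \<in> Basis - A \<Longrightarrow> {c, - c} \<notin> K0"
  "chain_list A xs \<Longrightarrow> poles (Basis - A) J \<Longrightarrow> v ` set xs \<union> J \<in> K0"
  "chain_list A xs \<Longrightarrow> poles (Basis - A) J \<Longrightarrow> star_h DIM('a) K0 (v ` set xs \<union> J) =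
          chain_weight r (card A) 0 (map card xs) * Y ^ (DIM('a) - card A - card J)"
  "inj_on v lbl" "S \<in> lbl \<Longrightarrow> v S \<notin> (Basis - A) \<union> uminus ` (Basis - A)"
  "S \<in> lbl \<Longrightarrow> T \<in> lbl \<Longrightarrow> \<not> S \<subseteq> T \<Longrightarrow> \<not> T \<subseteq> S \<Longrightarrow> {v S, v T} \<notin> K0"
  using lab unfolding labelled_def by blast+

lemma card_R: "card R' = DIM('a) - card A - 1" "card A + 1 \<le> DIM('a)"
proof -
  have "card (insert b A) \<le> card (Basis :: 'a set)" using A b by (intro card_mono) auto
  then show "card A + 1 \<le> DIM('a)" using b finA by simp
  show "card R' = DIM('a) - card A - 1" using A b finA by (simp add: card_Diff_subset)
qed

lemma polesD:
  assumes "poles R' J"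
  shows "b \<notin> J" "- b \<notin> J" "poles (Basis - A) (insert b J)" "poles (Basis - A) (insert (- b) J)"
    "poles (Basis - A) J" "finite J" "card J \<le> DIM('a) - card A - 1"
proof -
  have J: "J \<subseteq> R' \<union> uminus ` R'" "\<forall>c\<in>R'. \<not> {c, - c} \<subseteq> J" using assms by (auto simp: poles_def)
  have ne: "c \<noteq> - b" "b \<noteq> - c" if "c \<in> Basis" for c using Basis_neq_minus b that by blast+
  have bR: "b \<notin> R' \<union> uminus ` R'" using ne by auto
  have mbR: "- b \<notin> R' \<union> uminus ` R'" using ne by auto
  show bJ: "b \<notin> J" "- b \<notin> J" using J(1) bR mbR by blast+
  have sub: "R' \<subseteq> Basis - A" by blast
  have "\<not> {c, - c} \<subseteq> insert b J" "\<not> {c, - c} \<subseteq> insert (- b) J" if c: "c \<in> Basis - A" for c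
  proof -
    have "c \<noteq> b \<Longrightarrow> c \<in> R'" using c by blast
    moreover have "c \<noteq> - b" "- c \<noteq> b" using ne[of c] c by auto
    moreover have "b \<noteq> - b" using ne b by blast
    ultimately show "\<not> {c, - c} \<subseteq> insert b J" "\<not> {c, - c} \<subseteq> insert (- b) J"
      using J(2) bJ by (cases "c = b"; auto)+
  qed
  then show "poles (Basis - A) (insert b J)" "poles (Basis - A) (insert (- b) J)" "poles (Basis - A) J"
    using J(1) b sub unfolding poles_def by blast+
  show "finite J" "card J \<le> DIM('a) - card A - 1"
    using card_poles(3,4)[OF _ assms] card_R by auto
qed

lemma v_neq_b: "S \<in> lbl \<Longrightarrow> v S \<noteq> b"
  using labD(6) b by blast

lemma v_notin_poles: "S \<in> lbl \<Longrightarrow> poles R' J \<Longrightarrow> v S \<notin> J"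
  using labD(6)[of S] unfolding poles_def by blast

lemma base_chain:
  assumes "chain_list A xs" "poles R' J"
  shows "insert b (v ` set xs \<union> J) \<in> K0"
    "base K0 b (v ` set xs \<union> J) = chain_weight r (card A) 0 (map card xs) * Y ^ free_exp J"
proof -
  note p = polesD[OF assms(2)]
  have e: "insert b (v ` set xs \<union> J) = v ` set xs \<union> insert b J" by blast
  show "insert b (v ` set xs \<union> J) \<in> K0" unfolding e using labD(3) assms(1) p(3) by blast
  have "card (insert b J) = Suc (card J)" using p by simp
  then show "base K0 b (v ` set xs \<union> J) = chain_weight r (card A) 0 (map card xs) * Y ^ free_exp J"
    unfolding base_def e labD(4)[OF assms(1) p(3)] free_exp_def by simp
qed

text \<open>Dropping \<open>b\<close> from the face leaves one more direction of the cross-polytope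
  free, which contributes the factor \<open>1 + t\<close>.\<close>

lemma CC_ok:
  assumes "C \<in> CC"
  shows "b \<notin> C \<and> insert b C \<in> K0 \<and> star_h DIM('a) K0 C = Y * star_h DIM('a) K0 (insert b C)"
proof -
  obtain xs J where C: "C = v ` set xs \<union> J" "chain_list A xs" "poles R' J" using assms by (auto simp: CC_def)
  note p = polesD[OF C(3)]
  have "b \<notin> v ` set xs" using C(2) v_neq_b unfolding chain_list_def by blast
  moreover have "DIM('a) - card A - card J = Suc (free_exp J)" unfolding free_exp_def using p(7) card_R by simp
  then have "star_h DIM('a) K0 C = Y * base K0 b C"
    unfolding C(1) base_chain(2)[OF C(2,3)] labD(4)[OF C(2) p(5)] by (simp only: power_Suc mult.left_commute)
  ultimately show ?thesis using C p base_chain(1)[OF C(2,3)] unfolding base_def by blast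
qed

text \<open>Labels of incomparable sets are not adjacent, so this is the star of a nonface. It
  reduces the sums over all fired sets to the sets comparable with the chain.\<close>

lemma base_incomparable:
  assumes "S \<in> lbl" "U \<in> lbl" "\<not> S \<subseteq> U" "\<not> U \<subseteq> S" "v S \<in> C"
  shows "base K0 b (insert (v U) C) = 0"
proof -
  have "insert b (insert (v U) C) \<notin> K0"
    using abs_complexD(5)[OF realizesD(1)[OF labD(1)], of "insert b (insert (v U) C)" "{v S, v U}"]
      labD(7)[OF assms(1-4)] assms(5) by blast
  then show ?thesis unfolding base_def using star_h_nonface[OF realizesD(1)[OF labD(1)]] by blast
qed

lemma v_mem: "U \<in> lbl \<Longrightarrow> chain_list A xs \<Longrightarrow> poles R' J \<Longrightarrow> v U \<in> v ` set xs \<union> J \<longleftrightarrow> U \<in> set xs"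
  using v_notin_poles inj_on_image_mem_iff[OF labD(5), of U "set xs"] unfolding chain_list_def by blast

text \<open>Only sets \<open>U\<close> properly above \<open>L\<close> contribute. Appending such a
  \<open>U\<close> to the chain inserts \<open>perm_h (card U - card L)\<close> and shortens the
  final factor; grouped by cardinality this is the sum in the recurrence of
  \<open>sphere_h\<close>.\<close>

lemma tail_sum:
  assumes xs: "chain_list A xs" and J: "poles R' J" and L: "L = last ({} # xs)"
    and us: "set us \<subseteq> lbl - {L}" "\<forall>U\<in>lbl. card L < card U \<longrightarrow> count_list us U = mult_at r (card U - card L)"
      "\<forall>U\<in>lbl. card U < card L \<longrightarrow> count_list us U = 0"
  shows "(\<Sum>w\<leftarrow>rev (map v us). base K0 b (insert w (v ` set xs \<union> J))) =
    gap_weight 0 (map card xs) * Y ^ free_exp J *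
     (\<Sum>j\<le>card A - card L. of_nat ((card A - card L) choose j) * of_nat (mult_at r j) * perm_h j * sphere_h r (card A - card L - j))"
proof -
  let ?C = "v ` set xs \<union> J" and ?n = "card A"
  let ?g = "gap_weight 0 (map card xs) * Y ^ free_exp J"
  let ?f = "\<lambda>j. of_nat (mult_at r j) * perm_h j * sphere_h r (?n - card L - j)"
  have Ls: "L \<subseteq> A" and Lx: "L \<noteq> {} \<Longrightarrow> L \<in> set xs \<and> L \<in> lbl" 
    using chain_last[OF xs] unfolding L by blast+
  have fin: "finite U" if "U \<subseteq> A" for U using that finA finite_subset by blast
  have lastc: "last (0 # map card xs) = card L" unfolding L by (simp add: last_map)
  have summand: "of_nat (count_list (rev us) U) * base K0 b (insert (v U) ?C) =
     (if L \<subseteq> U then ?g * ?f (card U - card L) else 0)" if U: "U \<in> lbl" for U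
  proof (cases "L \<subseteq> U")
    case True
    show ?thesis
    proof (cases "U = L")
      case True
      then have "count_list us U = 0" using us(1) by (auto simp: count_list_0_iff)
      then show ?thesis using True by simp
    next
      case False
      then have LU: "L \<subset> U" using True by blast
      then have less: "card L < card U" using fin U by (auto intro: psubset_card_mono)
      have "chain_list A (xs @ [U])"
        using chain_insert[of A xs "[]" U] xs U LU unfolding L by simp
      then have "base K0 b (insert (v U) ?C) = chain_weight r ?n 0 (map card (xs @ [U])) * Y ^ free_exp J"
        using base_chain(2)[OF _ J, of "xs @ [U]"] by simp
      also have "\<dots> = ?g * (perm_h (card U - card L) * sphere_h r (?n - card U))"
        unfolding map_append chain_weight_append lastc by simp
      finally have bU: "base K0 b (insert (v U) ?C) = ?g * (perm_h (card U - card L) * sphere_h r (?n - card U))" .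
      have nU: "?n - card U = ?n - card L - (card U - card L)" using less by simp
      have cnt: "count_list (rev us) U = mult_at r (card U - card L)" using us(2) U less by simp
      show ?thesis unfolding cnt bU nU if_P[OF True] by (simp only: ac_simps)
    qed
  next
    case False
    then have Lne: "L \<in> set xs" "L \<in> lbl" using Lx by auto
    show ?thesis
    proof (cases "card U < card L")
      case True then show ?thesis using us(3) U False by simp
    next
      case nl: False
      have nUL: "\<not> U \<subseteq> L"
      proof
        assume "U \<subseteq> L"
        then have "U = L" using nl fin[OF Ls] by (meson card_seteq not_less)
        then show False using False by simp
      qed
      have "base K0 b (insert (v U) ?C) = 0"
        by (rule base_incomparable[OF Lne(2) U False nUL]) (use Lne(1) in simp)
      then show ?thesis unfolding if_not_P[OF False] by simp
    qed
  qed
  have "(\<Sum>w\<leftarrow>rev (map v us). base K0 b (insert w ?C)) = (\<Sum>U\<leftarrow>rev us. base K0 b (insert (v U) ?C))"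
    by (simp add: rev_map comp_def)
  also have "\<dots> = (\<Sum>U\<in>lbl. of_nat (count_list (rev us) U) * base K0 b (insert (v U) ?C))"
    using us(1) finA by (intro sum_list_count) auto
  also have "\<dots> = (\<Sum>U\<in>lbl. if L \<subseteq> U then ?g * ?f (card U - card L) else 0)"
    by (intro sum.cong refl summand)
  also have "\<dots> = (\<Sum>U\<in>{U. L \<subseteq> U \<and> U \<subseteq> A}. ?g * ?f (card U - card L))"
  proof -
    have "(\<Sum>U\<in>lbl. if L \<subseteq> U then ?g * ?f (card U - card L) else 0) = (\<Sum>U\<in>{U\<in>lbl. L \<subseteq> U}. ?g * ?f (card U - card L))"
      using finA by (simp only: sum.inter_filter finite_Diff finite_Pow_iff)
    \<comment> \<open>If \<open>L\<close> is empty, the interval also contains the empty set, whose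
      summand has the factor \<open>perm_h 0 = 0\<close>.\<close>
    also have "\<dots> = (\<Sum>U\<in>{U. L \<subseteq> U \<and> U \<subseteq> A}. ?g * ?f (card U - card L))"
    proof (rule sum.mono_neutral_left)
      show "finite {U. L \<subseteq> U \<and> U \<subseteq> A}" using finA by (auto intro: finite_subset[of _ "Pow A"])
    qed auto
    finally show ?thesis .
  qed
  also have "\<dots> = ?g * (\<Sum>U\<in>{U. L \<subseteq> U \<and> U \<subseteq> A}. ?f (card U - card L))" by (simp only: sum_distrib_left)
  also have "(\<Sum>U\<in>{U. L \<subseteq> U \<and> U \<subseteq> A}. ?f (card U - card L)) = (\<Sum>j\<le>?n - card L. of_nat ((?n - card L) choose j) * ?f j)"
    by (rule sum_interval_card[OF finA Ls])
  finally show ?thesis by (simp only: mult.assoc)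
qed

text \<open>The sets strictly between \<open>L\<close> and \<open>T\<close>, each fired once, divide
  this gap in two, which gives the quadratic sum in the recurrence of \<open>perm_h\<close>. The
  ends \<open>U = L\<close> and \<open>U = T\<close> of the interval carry a factor
  \<open>perm_h 0 = 0\<close>.\<close>

lemma middle_sum:
  assumes xs: "chain_list A (xs @ T # ys)" and J: "poles R' J" and L: "L = last ({} # xs)"
    and us: "distinct us" "set us \<subseteq> lbl - {L, T}" "\<forall>U\<in>set us. card L \<le> card U \<and> card U \<le> card T"
      "\<forall>U\<in>lbl. card L < card U \<longrightarrow> card U < card T \<longrightarrow> U \<in> set us"
  shows "(\<Sum>w\<leftarrow>rev (map v us). base K0 b (insert w (v ` set (xs @ T # ys) \<union> J))) =
    gap_weight 0 (map card xs) * chain_weight r (card A) (card T) (map card ys) * Y ^ free_exp J *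
     (\<Sum>j\<le>card T - card L. of_nat ((card T - card L) choose j) * perm_h j * perm_h (card T - card L - j))"
proof -
  let ?C = "v ` set (xs @ T # ys) \<union> J" and ?n = "card A"
  let ?g = "gap_weight 0 (map card xs) * chain_weight r ?n (card T) (map card ys) * Y ^ free_exp J"
  let ?f = "\<lambda>j. perm_h j * perm_h (card T - card L - j)"
  have xs': "chain_list A xs" using xs unfolding chain_list_def by (auto simp: sorted_wrt_append)
  have Lx: "L \<noteq> {} \<Longrightarrow> L \<in> set xs \<and> L \<in> lbl" 
    using chain_last[OF xs'] unfolding L by blast
  have T: "T \<in> lbl" using xs unfolding chain_list_def by auto
  have LT: "L \<subset> T"
  proof (cases "L = {}")
    case False
    then show ?thesis using Lx xs unfolding chain_list_def by (auto simp: sorted_wrt_append)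
  qed (use T in auto)
  have fin: "finite U" if "U \<subseteq> A" for U using that finA finite_subset by blast
  have finT: "finite T" using T fin by blast
  have finL: "finite L" using LT finT finite_subset by blast
  have lastc: "last (0 # map card xs) = card L" unfolding L by (simp add: last_map)
  have summand: "of_nat (count_list (rev us) U) * base K0 b (insert (v U) ?C) =
     (if L \<subseteq> U \<and> U \<subseteq> T then ?g * ?f (card U - card L) else 0)" if U: "U \<in> lbl" for U
  proof (cases "L \<subseteq> U \<and> U \<subseteq> T")
    case True
    show ?thesis
    proof (cases "U = L \<or> U = T")
      case True
      then have "count_list us U = 0" using us(2) by (auto simp: count_list_0_iff)
      then show ?thesis using True by auto
    next
      case False
      then have LU: "L \<subset> U" "U \<subset> T" using True by auto
      then have less: "card L < card U" "card U < card T" using finT fin U by (auto intro: psubset_card_mono)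
      then have cnt: "count_list (rev us) U = 1" using us(1,4) U by (simp add: count_list_distinct)
      have "chain_list A (xs @ U # T # ys)"
      proof (rule chain_insert[OF xs])
        show "last ({} # xs) \<subset> U" "U \<subseteq> A" using LU(1) U L by blast+
        show "U \<subset> y" if "y \<in> set (T # ys)" for y
          using that LU(2) xs by (auto simp: chain_list_def sorted_wrt_append)
      qed
      then have "base K0 b (v ` set (xs @ U # T # ys) \<union> J) = chain_weight r ?n 0 (map card (xs @ U # T # ys)) * Y ^ free_exp J"
        by (rule base_chain(2)[OF _ J])
      also have "v ` set (xs @ U # T # ys) \<union> J = insert (v U) ?C" by auto
      also have "chain_weight r ?n 0 (map card (xs @ U # T # ys)) * Y ^ free_exp J = ?g * (perm_h (card U - card L) * perm_h (card T - card U))"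
        unfolding map_append chain_weight_append lastc list.map chain_weight.simps by (simp only: ac_simps)
      finally have bU: "base K0 b (insert (v U) ?C) = ?g * (perm_h (card U - card L) * perm_h (card T - card U))" .
      have TU: "card T - card U = card T - card L - (card U - card L)" using less by simp
      show ?thesis unfolding cnt bU TU if_P[OF \<open>L \<subseteq> U \<and> U \<subseteq> T\<close>] by simp
    qed
  next
    case False
    show ?thesis
    proof (cases "U \<in> set us")
      case nu: False
      then have "count_list us U = 0" by (simp add: count_list_0_iff)
      then show ?thesis unfolding if_not_P[OF False] by simp
    next
      case True
      then have c: "card L \<le> card U" "card U \<le> card T" "U \<noteq> L" "U \<noteq> T" using us by auto
      have "base K0 b (insert (v U) ?C) = 0"
      proof (cases "L \<subseteq> U")
        case notsub: False
        then have Lne: "L \<in> set xs" "L \<in> lbl" using Lx by auto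
        have nUL: "\<not> U \<subseteq> L" using c card_seteq[OF finL] by blast
        show ?thesis by (rule base_incomparable[OF Lne(2) U notsub nUL]) (use Lne(1) in simp)
      next
        case sub: True
        then have nUT: "\<not> U \<subseteq> T" using False by blast
        have nTU: "\<not> T \<subseteq> U" using c card_seteq[of U T] fin U by blast
        show ?thesis by (rule base_incomparable[OF T U nTU nUT]) simp
      qed
      then show ?thesis unfolding if_not_P[OF False] by simp
    qed
  qed
  have "(\<Sum>w\<leftarrow>rev (map v us). base K0 b (insert w ?C)) = (\<Sum>U\<leftarrow>rev us. base K0 b (insert (v U) ?C))"
    by (simp add: rev_map comp_def)
  also have "\<dots> = (\<Sum>U\<in>lbl. of_nat (count_list (rev us) U) * base K0 b (insert (v U) ?C))"
    using us(2) finA by (intro sum_list_count) auto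
  also have "\<dots> = (\<Sum>U\<in>lbl. if L \<subseteq> U \<and> U \<subseteq> T then ?g * ?f (card U - card L) else 0)"
    by (intro sum.cong refl summand)
  also have "\<dots> = (\<Sum>U\<in>{U\<in>lbl. L \<subseteq> U \<and> U \<subseteq> T}. ?g * ?f (card U - card L))"
    using finA by (simp only: sum.inter_filter finite_Diff finite_Pow_iff)
  also have "\<dots> = (\<Sum>U\<in>{U. L \<subseteq> U \<and> U \<subseteq> T}. ?g * ?f (card U - card L))"
  proof (rule sum.mono_neutral_left)
    show "finite {U. L \<subseteq> U \<and> U \<subseteq> T}" using finT by (auto intro: finite_subset[of _ "Pow T"])
  qed (use T in auto)
  also have "\<dots> = ?g * (\<Sum>U\<in>{U. L \<subseteq> U \<and> U \<subseteq> T}. ?f (card U - card L))" by (simp only: sum_distrib_left)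
  also have "(\<Sum>U\<in>{U. L \<subseteq> U \<and> U \<subseteq> T}. ?f (card U - card L)) = (\<Sum>j\<le>card T - card L. of_nat ((card T - card L) choose j) * ?f j)"
    by (rule sum_interval_card[OF finT]) (use LT in blast)
  finally show ?thesis by (simp only: mult.assoc)
qed

lemma takeWhile_rev_map:
  assumes "chain_list A xs" "poles R' J" "us = ps @ L # qs" "L \<in> set xs" "set qs \<subseteq> lbl - set xs"
  shows "takeWhile (\<lambda>w. w \<notin> v ` set xs \<union> J) (rev (map v us)) = rev (map v qs)"
proof -
  have "w \<notin> v ` set xs \<union> J" if "w \<in> set (rev (map v qs))" for w
    using that assms(5) v_mem[OF _ assms(1,2)] by auto
  then have "takeWhile (\<lambda>w. w \<notin> v ` set xs \<union> J) (rev (map v qs) @ v L # rev (map v ps)) =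
      rev (map v qs) @ takeWhile (\<lambda>w. w \<notin> v ` set xs \<union> J) (v L # rev (map v ps))"
    by (rule takeWhile_append2)
  then show ?thesis using assms(3,4) by simp
qed

lemma takeWhile_rev_map_all:
  assumes "chain_list A xs" "poles R' J" "set qs \<subseteq> lbl - set xs"
  shows "takeWhile (\<lambda>w. w \<notin> v ` set xs \<union> J) (rev (map v qs)) = rev (map v qs)"
  using assms(3) v_mem[OF _ assms(1,2)] by (intro takeWhile_eq_all_conv[THEN iffD2]) auto

lemma current_chain:
  assumes "chain_list A xs" "poles R' J" "set us \<subseteq> lbl" "\<And>x. ver x 0 = x"
  shows "current ver (map v us) (v ` set xs \<union> J) = (\<lambda>U. ver (v U) (count_list us U)) ` set xs \<union> J"
proof -
  have "count_list (map v us) (v U) = count_list us U" if "U \<in> set xs" for U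
    using count_list_map_inj[OF labD(5) assms(3)] that assms(1) unfolding chain_list_def by blast
  moreover have "v x \<notin> J" if "x \<in> set us" for x using v_notin_poles assms(2,3) that by blast
  then have "count_list (map v us) j = 0" if "j \<in> J" for j
    using that by (auto simp: count_list_0_iff)
  ultimately show ?thesis unfolding current_def using assms(4) by (force simp: image_Un image_image)
qed

text \<open>The recurrence of \<open>sphere_h\<close>, multiplied by the weights of the gaps: the
  final factor passes from \<open>card A - card L\<close> to the next index.\<close>

lemma live_tail:
  assumes xs: "chain_list A xs" and J: "poles R' J" and L: "L = last ({} # xs)"
    and us: "set us \<subseteq> lbl - {L}" "\<forall>U\<in>lbl. card L < card U \<longrightarrow> count_list us U = mult_at r (card U - card L)"
      "\<forall>U\<in>lbl. card U < card L \<longrightarrow> count_list us U = 0"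
  shows "Y * base K0 b (v ` set xs \<union> J) + [:0, 1:] * (\<Sum>w\<leftarrow>rev (map v us). base K0 b (insert w (v ` set xs \<union> J))) =
    chain_weight r (Suc (card A)) 0 (map card xs) * Y ^ free_exp J"
proof -
  have "card L \<le> card A" using chain_last(1)[OF xs] finA unfolding L by (simp add: card_mono)
  then have n: "Suc (card A) - card L = Suc (card A - card L)" by simp
  have lastc: "last (0 # map card xs) = card L" unfolding L by (simp add: last_map)
  have w: "chain_weight r n 0 (map card xs) = gap_weight 0 (map card xs) * sphere_h r (n - card L)" for n
    using chain_weight_append[of r n 0 "map card xs" "[]"] unfolding lastc by simp
  define g where "g = gap_weight 0 (map card xs)"
  define Z where "Z = (\<Sum>j\<le>card A - card L. of_nat ((card A - card L) choose j) * of_nat (mult_at r j) * perm_h j * sphere_h r (card A - card L - j))"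
  show ?thesis
    unfolding tail_sum[OF assms] base_chain(2)[OF xs J] w n sphere_h.simps(2) g_def[symmetric] Z_def[symmetric]
    by (simp only: distrib_left distrib_right ac_simps)
qed

text \<open>The recurrence of \<open>perm_h\<close> for the gap between \<open>L\<close> and
  \<open>T\<close>, which becomes longer by one. Its initial term is absent because the gap is
  nonempty.\<close>

lemma live_middle:
  assumes xs: "chain_list A (xs @ T # ys)" and J: "poles R' J" and L: "L = last ({} # xs)"
    and us: "distinct us" "set us \<subseteq> lbl - {L, T}" "\<forall>U\<in>set us. card L \<le> card U \<and> card U \<le> card T"
      "\<forall>U\<in>lbl. card L < card U \<longrightarrow> card U < card T \<longrightarrow> U \<in> set us"
    and lt: "card L < card T"
  shows "Y * base K0 b (v ` set (xs @ T # ys) \<union> J) + [:0, 1:] * (\<Sum>w\<leftarrow>rev (map v us). base K0 b (insert w (v ` set (xs @ T # ys) \<union> J))) =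
    gap_weight 0 (map card xs) * perm_h (Suc (card T) - card L) * chain_weight r (card A) (card T) (map card ys) * Y ^ free_exp J"
proof -
  have n: "Suc (card T) - card L = Suc (card T - card L)" and ne: "card T - card L \<noteq> 0" using lt by simp_all
  have lastc: "last (0 # map card xs) = card L" unfolding L by (simp add: last_map)
  have w: "chain_weight r (card A) 0 (map card (xs @ T # ys)) =
      gap_weight 0 (map card xs) * (perm_h (card T - card L) * chain_weight r (card A) (card T) (map card ys))"
    unfolding map_append chain_weight_append lastc by simp
  define g where "g = gap_weight 0 (map card xs)"
  define h where "h = chain_weight r (card A) (card T) (map card ys)"
  define Z where "Z = (\<Sum>j\<le>card T - card L. of_nat ((card T - card L) choose j) * perm_h j * perm_h (card T - card L - j))"
  show ?thesis
    unfolding middle_sum[OF assms(1-7)] base_chain(2)[OF xs J] w n perm_h.simps(2) if_not_P[OF ne] g_def[symmetric] h_def[symmetric] Z_def[symmetric]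
    by (simp only: distrib_left distrib_right ac_simps add_0_left)
qed

lemma pole_single: "c \<in> Basis \<Longrightarrow> c \<in> R \<Longrightarrow> R \<subseteq> Basis \<Longrightarrow> poles R {c} \<and> poles R {- c}"
  using Basis_neq_minus[of c c] unfolding poles_def by auto

lemma poles_empty: "poles R {}"
  by (simp add: poles_def)

lemma v_nbrs: "S \<in> lbl \<Longrightarrow> v S \<in> nbrs K0 b"
proof -
  assume S: "S \<in> lbl"
  have "chain_list A [S]" using S by (simp add: chain_list_def)
  then have "insert b (v ` set [S] \<union> {}) \<in> K0" by (rule base_chain(1)) (rule poles_empty)
  then show "v S \<in> nbrs K0 b" using v_neq_b[OF S] by (simp add: nbrs_def)
qed

lemma card_lbl: "U \<in> lbl \<Longrightarrow> 1 \<le> card U \<and> card U \<le> card A"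
  using finA by (auto simp: card_mono Suc_le_eq card_gt_0_iff finite_subset)

lemma psubset_card: "U \<subseteq> A \<Longrightarrow> S \<subset> U \<Longrightarrow> card S < card U"
  using finA by (meson finite_subset psubset_card_mono)

section \<open>The labels for the next dimension\<close>

context
  fixes Ls :: "'a set list" and K :: "'a set set" and ver :: "'a \<Rightarrow> nat \<Rightarrow> 'a" and sched :: "'a set list"
  assumes Ls: "distinct Ls" "sorted (map card Ls)" "set Ls = lbl"
    and sched: "sched = schedule (mult_at r) Ls (card A)"
    and fired: "fired K0 b CC (map v sched) K ver"
begin

lemmas FD = fired.facts[OF fired]

lemma r1: "r \<ge> 1" using r by simp

lemma Ls_card: "U \<in> set Ls \<Longrightarrow> 1 \<le> card U \<and> card U \<le> card A"
  using card_lbl Ls(3) by blast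

lemmas sched_params = Ls(1,2) Ls_card mult_at_mono[OF r1] mult_at_0[OF r1] mult_at_1[OF r]

lemma set_sched: "set sched = lbl"
  unfolding sched schedule_def using set_rounds[of "mult_at r" Ls "card A" "card A"] Ls(3) by auto

lemma map_split: "sched = us @ T # ws \<Longrightarrow> map v sched = map v us @ v T # map v ws"
  by simp

lemma CC_I: "chain_list A xs \<Longrightarrow> poles R' J \<Longrightarrow> v ` set xs \<union> J \<in> CC"
  unfolding CC_def by blast

text \<open>
  The stars of these vertices are the right ones because of the time at which they are frozen:
  \<open>v T\<close> just before the first firing of \<open>T\<close>, and the first new version of \<open>v S\<close> just before
  the second firing of \<open>S\<close>. The vertex \<open>- b\<close> is the other apex of the suspension.
\<close>

definition "new_label S = (if b \<notin> S then ver (v S) 1 else if S = {b} then - b else v (S - {b}))"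

lemma new_label_simps:
  "S \<in> lbl \<Longrightarrow> new_label S = ver (v S) 1"
  "S \<in> lbl \<Longrightarrow> new_label (insert b S) = v S"
  "new_label {b} = - b"
proof -
  show "S \<in> lbl \<Longrightarrow> new_label S = ver (v S) 1" using b unfolding new_label_def by auto
  assume S: "S \<in> lbl"
  then have "insert b S \<noteq> {b}" "insert b S - {b} = S" using b by auto
  then show "new_label (insert b S) = v S" unfolding new_label_def by simp
qed (simp add: new_label_def)

lemma map_card_insert:
  assumes "set (T # ys) \<subseteq> Pow A"
  shows "map card (map (insert b) (T # ys)) = Suc (card T) # map Suc (map card ys)"
proof -
  have "card (insert b y) = Suc (card y)" if "y \<in> set (T # ys)" for y
  proof -
    have "y \<subseteq> A" using that assms by blast
    then have "finite y" "b \<notin> y" using finA finite_subset b by blast+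
    then show ?thesis by simp
  qed
  then show ?thesis by simp
qed

text \<open>No label occurs in the face, so every firing of the whole schedule counts,
  \<open>mult_at r (card U)\<close> times for each \<open>U\<close>; this is the tail computation
  with \<open>L\<close> empty.\<close>

lemma empty_case:
  assumes J: "poles R' J"
  shows "J \<in> K \<and> star_h DIM('a) K J = chain_weight r (Suc (card A)) 0 [] * Y ^ free_exp J"
proof -
  have ch: "chain_list A []" by (simp add: chain_list_def)
  have C: "J \<in> CC" using CC_I[OF ch J] by simp
  have cur: "current ver (map v sched) J = J"
    using current_chain[OF ch J, of sched ver] set_sched FD(4) by simp
  have "J \<subseteq> nbrs K0 b" by (rule CC_nbrs[OF labD(1) CC_ok C])
  then have "insert b J \<in> K" using FD(10)[of J] CC_ok[OF C] unfolding cur by simp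
  then have "J \<in> K" using abs_complexD(5)[OF realizesD(1)[OF FD(2)]] by blast
  moreover have "star_h DIM('a) K J = live K0 b (map v sched) J" using FD(12)[OF C] unfolding cur .
  moreover have tw: "takeWhile (\<lambda>w. w \<notin> J) (rev (map v sched)) = rev (map v sched)"
    using takeWhile_rev_map_all[OF ch J, of sched] set_sched by simp
  moreover have "\<forall>U\<in>lbl. count_list sched U = mult_at r (card U)"
    using count_schedule[OF sched_params] Ls(3) unfolding sched by blast
  then have "Y * base K0 b (v ` set [] \<union> J) + [:0, 1:] * (\<Sum>w\<leftarrow>rev (map v sched). base K0 b (insert w (v ` set [] \<union> J))) =
    chain_weight r (Suc (card A)) 0 (map card ([] :: 'a set list)) * Y ^ free_exp J"
    using set_sched by (intro live_tail[OF ch J, where L = "{}"]) simp_all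
  ultimately show ?thesis unfolding live_def tw by simp
qed

text \<open>Up to the second firing of the largest member \<open>S\<close>, every member has fired
  exactly once, so the current versions are the new labels. Since the first firing of
  \<open>S\<close> only sets of at least its size have fired, the larger ones with the
  multiplicities of the tail sum.\<close>

lemma old_case:
  assumes xs: "chain_list A xs" and ne: "xs \<noteq> []" and J: "poles R' J"
  shows "new_label ` set xs \<union> J \<in> K \<and>
    star_h DIM('a) K (new_label ` set xs \<union> J) = chain_weight r (Suc (card A)) 0 (map card xs) * Y ^ free_exp J"
proof -
  define S where "S = last xs"
  have Sx: "S \<in> set xs" using ne by (simp add: S_def)
  have SL: "S = last ({} # xs)" using ne by (simp add: S_def)
  have xl: "set xs \<subseteq> lbl" using xs by (simp add: chain_list_def)
  have Sl: "S \<in> lbl" using Sx xl by blast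
  then have SLs: "S \<in> set Ls" by (simp add: Ls(3))
  obtain us vs ws where sp: "sched = us @ S # vs @ S # ws" "distinct us" 
    "set us \<subseteq> set Ls - {S}" "\<forall>U\<in>set Ls. card U < card S \<longrightarrow> U \<in> set us" "set vs \<subseteq> set Ls - {S}"
    "\<forall>U\<in>set Ls. card S < card U \<longrightarrow> count_list vs U = mult_at r (card U - card S)"
    "\<forall>U\<in>set Ls. card U < card S \<longrightarrow> count_list vs U = 0"
    using schedule_second[OF sched_params SLs] unfolding sched by blast
  note sp' = sp(3-7)[unfolded Ls(3)]
  let ?us = "us @ S # vs" and ?C = "v ` set xs \<union> J"
  have C: "?C \<in> CC" by (rule CC_I[OF xs J])
  have ul: "set ?us \<subseteq> lbl" using sp'(1,3) Sl by auto
  have vU: "v S \<in> ?C" using Sx by blast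
  have less: "card U < card S" if "U \<in> set xs" "U \<noteq> S" for U
  proof -
    have "U \<subseteq> S" using subset_last[of xs U] xs that unfolding S_def chain_list_def by blast
    then show ?thesis using psubset_card[of S U] that Sl by blast
  qed
  have cnt: "count_list ?us U = 1" if U: "U \<in> set xs" for U
  proof (cases "U = S")
    case True
    have "count_list us S = 0" "count_list vs S = 0" using sp'(1,3) by (auto simp: count_list_0_iff)
    then show ?thesis using True by simp
  next
    case False
    have "U \<in> lbl" using U xl by blast
    then show ?thesis using less[OF U False] sp'(2,5) sp(2) False by (simp add: count_list_distinct)
  qed
  have split: "map v sched = map v ?us @ v S # map v ws" unfolding sp(1) by simp
  have cur: "current ver (map v ?us) ?C = new_label ` set xs \<union> J"
  proof -
    have "(\<lambda>U. ver (v U) (count_list ?us U)) ` set xs = new_label ` set xs"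
    proof (intro image_cong refl)
      fix U assume "U \<in> set xs"
      then show "ver (v U) (count_list ?us U) = new_label U" using cnt new_label_simps(1) xl by (metis subsetD)
    qed
    then show ?thesis using current_chain[OF xs J ul, of ver] FD(4) by simp
  qed
  have tw: "takeWhile (\<lambda>w. w \<notin> ?C) (rev (map v ?us)) = rev (map v vs)"
  proof (rule takeWhile_rev_map[OF xs J refl Sx])
    have "U \<notin> set xs" if "U \<in> set vs" for U
    proof
      assume U: "U \<in> set xs"
      have "U \<noteq> S" "U \<in> lbl" using that sp'(3) by auto
      then have "count_list vs U = 0" using less[OF U] sp'(5) by blast
      then show False using that by (simp add: count_list_0_iff)
    qed
    then show "set vs \<subseteq> lbl - set xs" using sp'(3) by blast
  qed
  note E = FD(15)[OF split C vU]
  have "live K0 b (map v ?us) ?C = chain_weight r (Suc (card A)) 0 (map card xs) * Y ^ free_exp J"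
    unfolding live_def tw by (rule live_tail[OF xs J SL sp'(3,4,5)])
  then show ?thesis using E unfolding cur by simp
qed

lemma first_fire:
  assumes T: "T \<in> lbl"
  obtains us ws where "sched = us @ T # ws" "distinct us" "sorted (map card us)"
    "set us \<subseteq> lbl - {T}" "\<forall>U\<in>set us. card U \<le> card T" "\<forall>U\<in>lbl. card U < card T \<longrightarrow> U \<in> set us"
proof -
  have TL: "T \<in> set Ls" using T by (simp add: Ls(3))
  show thesis using schedule_first[OF sched_params TL] that unfolding sched Ls(3) by blast
qed

text \<open>Just before the first firing of \<open>T\<close> the members below \<open>T\<close>
  carry their first new versions, and those from \<open>T\<close> on are still the original
  vertices. These are the labels of sets without and with \<open>b\<close>, respectively.\<close>

lemma current_first:
  assumes us: "distinct us" "set us \<subseteq> lbl - {T}" "\<forall>U\<in>set us. card U \<le> card T" "\<forall>U\<in>lbl. card U < card T \<longrightarrow> U \<in> set us"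
    and ch: "chain_list A (xs @ T # ys)" and J: "poles R' J"
  shows "current ver (map v us) (v ` set (xs @ T # ys) \<union> J) = new_label ` set (xs @ map (insert b) (T # ys)) \<union> J"
proof -
  have l: "set xs \<subseteq> lbl" "set ys \<subseteq> lbl" "T \<in> lbl" using ch by (auto simp: chain_list_def)
  have lt: "x \<subset> T" if "x \<in> set xs" for x using ch that by (auto simp: chain_list_def sorted_wrt_append)
  have gt: "T \<subset> y" if "y \<in> set ys" for y using ch that by (auto simp: chain_list_def sorted_wrt_append)
  have cx: "ver (v U) (count_list us U) = new_label U" if U: "U \<in> set xs" for U
  proof -
    have Ul: "U \<in> lbl" using U l by blast
    have "card U < card T" using psubset_card[of T U] lt[OF U] l(3) by blast
    then have "count_list us U = 1" using us(1,4) Ul by (simp add: count_list_distinct)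
    then show ?thesis using new_label_simps(1)[OF Ul] by simp
  qed
  have cy: "ver (v U) (count_list us U) = new_label (insert b U)" if U: "U \<in> set (T # ys)" for U
  proof -
    have Ul: "U \<in> lbl" using U l by auto
    have "U \<notin> set us"
    proof (cases "U = T")
      case False
      then have "T \<subset> U" using gt U by simp
      then have "card T < card U" using psubset_card[of U T] Ul by blast
      then show ?thesis using us(3) by auto
    qed (use us(2) in auto)
    then have "count_list us U = 0" by (simp add: count_list_0_iff)
    then show ?thesis using new_label_simps(2)[OF Ul] FD(4) by simp
  qed
  have "set us \<subseteq> lbl" using us(2) by blast
  then have "current ver (map v us) (v ` set (xs @ T # ys) \<union> J) =
      (\<lambda>U. ver (v U) (count_list us U)) ` set (xs @ T # ys) \<union> J"
    by (rule current_chain[OF ch J]) (rule FD(4))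
  also have "(\<lambda>U. ver (v U) (count_list us U)) ` set (xs @ T # ys) =
     (\<lambda>U. ver (v U) (count_list us U)) ` set xs \<union> (\<lambda>U. ver (v U) (count_list us U)) ` set (T # ys)"
    by (simp only: set_append image_Un)
  also have "(\<lambda>U. ver (v U) (count_list us U)) ` set xs = new_label ` set xs"
    by (rule image_cong[OF refl cx])
  also have "(\<lambda>U. ver (v U) (count_list us U)) ` set (T # ys) = (\<lambda>U. new_label (insert b U)) ` set (T # ys)"
    by (rule image_cong[OF refl cy])
  also have "new_label ` set xs \<union> (\<lambda>U. new_label (insert b U)) ` set (T # ys) = new_label ` set (xs @ map (insert b) (T # ys))"
    by (simp only: set_append image_Un set_map image_image)
  finally show ?thesis .
qed

text \<open>Between the first firings of \<open>L\<close> and \<open>T\<close> all sets of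
  intermediate size fire once. The gap of length \<open>card T - card L\<close> thus grows by one,
  which is the distance from \<open>L\<close> to \<open>insert b T\<close>; the later gaps and the
  final factor keep their lengths because \<open>b\<close> is added on both sides.\<close>

lemma gap_case:
  assumes ch: "chain_list A (xs @ T # ys)" and J: "poles R' J"
  shows "new_label ` set (xs @ map (insert b) (T # ys)) \<union> J \<in> K \<and>
    star_h DIM('a) K (new_label ` set (xs @ map (insert b) (T # ys)) \<union> J) =
      chain_weight r (Suc (card A)) 0 (map card (xs @ map (insert b) (T # ys))) * Y ^ free_exp J"
proof -
  let ?C = "v ` set (xs @ T # ys) \<union> J"
  define L where "L = last ({} # xs)"
  have l: "set xs \<subseteq> lbl" "set ys \<subseteq> lbl" "T \<in> lbl" using ch by (auto simp: chain_list_def)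
  have chx: "chain_list A xs" using ch by (auto simp: chain_list_def sorted_wrt_append)
  have lt: "x \<subset> T" if "x \<in> set xs" for x using ch that by (auto simp: chain_list_def sorted_wrt_append)
  have gt: "T \<subset> y" if "y \<in> set ys" for y using ch that by (auto simp: chain_list_def sorted_wrt_append)
  obtain us ws where us: "sched = us @ T # ws" "distinct us" "sorted (map card us)"
    "set us \<subseteq> lbl - {T}" "\<forall>U\<in>set us. card U \<le> card T" "\<forall>U\<in>lbl. card U < card T \<longrightarrow> U \<in> set us"
    using first_fire[OF l(3)] by blast
  have C: "?C \<in> CC" by (rule CC_I[OF ch J])
  have vT: "v T \<in> ?C" by simp
  note cur = current_first[OF us(2,4,5,6) ch J]
  note E = FD(15)[OF map_split[OF us(1)] C vT, unfolded cur]
  have LT: "card L < card T"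
  proof (cases "L = {}")
    case True then show ?thesis using card_lbl[OF l(3)] by simp
  next
    case False
    then have "L \<in> set xs" using chain_last(2)[OF chx] unfolding L_def by blast
    then show ?thesis using lt psubset_card[of T L] l(3) by blast
  qed
  \<comment> \<open>The list \<open>qs\<close> is the part of the first pass after \<open>L\<close>,
    or all of it before \<open>T\<close> if the chain has no member below \<open>T\<close>.\<close>
  have "\<exists>qs. takeWhile (\<lambda>w. w \<notin> ?C) (rev (map v us)) = rev (map v qs) \<and> distinct qs \<and> set qs \<subseteq> lbl - {L, T} \<and>
     (\<forall>U\<in>set qs. card L \<le> card U \<and> card U \<le> card T) \<and>
     (\<forall>U\<in>lbl. card L < card U \<longrightarrow> card U < card T \<longrightarrow> U \<in> set qs)"
  proof (cases "xs = []")
    case True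
    then have L: "L = {}" by (simp add: L_def)
    have "U \<notin> set ([] @ T # ys)" if "U \<in> set us" for U
    proof
      assume "U \<in> set ([] @ T # ys)"
      then have "T \<subset> U" using us(4) that gt by auto
      then have "card T < card U" using psubset_card[of U T] us(4) that by blast
      then show False using us(5) that by auto
    qed
    then have "takeWhile (\<lambda>w. w \<notin> ?C) (rev (map v us)) = rev (map v us)"
      using takeWhile_rev_map_all[OF ch J, of us] us(4) True by blast
    then show ?thesis using us(2,4,5,6) unfolding L by (intro exI[of _ us]) auto
  next
    case False
    then have Lx: "L \<in> set xs" by (simp add: L_def)
    then have "L \<in> lbl" using l(1) by blast
    then have "L \<in> set us" using us(6) LT by blast
    then obtain ps qs where pq: "us = ps @ L # qs" using split_list by metis
    have qs: "distinct qs" "L \<notin> set qs" "set qs \<subseteq> lbl - {T}" "\<forall>U\<in>set qs. card L \<le> card U \<and> card U \<le> card T"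
      and ps: "\<forall>U\<in>set ps. card U \<le> card L"
      using us(2-5) unfolding pq by (auto simp: sorted_append)
    have "U \<notin> set (xs @ T # ys)" if U: "U \<in> set qs" for U
    proof
      assume "U \<in> set (xs @ T # ys)"
      then consider "U \<in> set xs" | "U = T" | "U \<in> set ys" by auto
      then show False
      proof cases
        case 1
        then have "U \<subseteq> L" using subset_last[of xs U] chx False unfolding L_def chain_list_def by simp
        moreover have "U \<noteq> L" using U qs(2) by blast
        ultimately have "card U < card L" using psubset_card[of L U] \<open>L \<in> lbl\<close> by blast
        then show False using qs(4) U by auto
      next
        case 2 then show False using U qs(3) by blast
      next
        case 3
        then have "card T < card U" using gt psubset_card[of U T] l(2) by blast
        then show False using qs(4) U by auto
      qed
    qed
    then have "takeWhile (\<lambda>w. w \<notin> ?C) (rev (map v us)) = rev (map v qs)"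
      using Lx qs(3) by (intro takeWhile_rev_map[OF ch J pq]) auto
    moreover have "U \<in> set qs" if U: "U \<in> lbl" "card L < card U" "card U < card T" for U
    proof -
      have "U \<in> set us" using us(6) U by blast
      then show ?thesis using ps U(2) unfolding pq by auto
    qed
    ultimately show ?thesis using qs by (intro exI[of _ qs]) auto
  qed
  then obtain qs where tw: "takeWhile (\<lambda>w. w \<notin> ?C) (rev (map v us)) = rev (map v qs)"
    and qs: "distinct qs" "set qs \<subseteq> lbl - {L, T}" "\<forall>U\<in>set qs. card L \<le> card U \<and> card U \<le> card T"
     "\<forall>U\<in>lbl. card L < card U \<longrightarrow> card U < card T \<longrightarrow> U \<in> set qs" by blast
  have "live K0 b (map v us) ?C = gap_weight 0 (map card xs) * perm_h (Suc (card T) - card L) *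
      chain_weight r (card A) (card T) (map card ys) * Y ^ free_exp J"
    unfolding live_def tw by (rule live_middle[OF ch J L_def qs LT])
  also have "gap_weight 0 (map card xs) * perm_h (Suc (card T) - card L) * chain_weight r (card A) (card T) (map card ys) =
      chain_weight r (Suc (card A)) 0 (map card (xs @ map (insert b) (T # ys)))"
  proof -
    have y: "set (T # ys) \<subseteq> Pow A" using l by auto
    have lastc: "last (0 # map card xs) = card L" unfolding L_def by (simp add: last_map)
    show ?thesis unfolding map_append map_card_insert[OF y] chain_weight_append lastc chain_weight.simps
        chain_weight_Suc by (simp only: mult.assoc)
  qed
  finally show ?thesis using E by simp
qed

text \<open>\<open>T\<close> and \<open>insert b T\<close> are labelled by the new and the old
  version of \<open>v T\<close>, which become adjacent when \<open>T\<close> first fires; the face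
  through both receives the star \<open>base\<close>. The additional gap has length 1 and weight
  \<open>perm_h 1 = 1\<close>.\<close>

lemma repeat_case:
  assumes ch: "chain_list A (xs @ T # ys)" and J: "poles R' J"
  shows "new_label ` set ((xs @ [T]) @ map (insert b) (T # ys)) \<union> J \<in> K \<and>
    star_h DIM('a) K (new_label ` set ((xs @ [T]) @ map (insert b) (T # ys)) \<union> J) =
      chain_weight r (Suc (card A)) 0 (map card ((xs @ [T]) @ map (insert b) (T # ys))) * Y ^ free_exp J"
proof -
  let ?C = "v ` set (xs @ T # ys) \<union> J"
  have l: "set xs \<subseteq> lbl" "set ys \<subseteq> lbl" "T \<in> lbl" using ch by (auto simp: chain_list_def)
  obtain us ws where us: "sched = us @ T # ws" "distinct us" "sorted (map card us)"
    "set us \<subseteq> lbl - {T}" "\<forall>U\<in>set us. card U \<le> card T" "\<forall>U\<in>lbl. card U < card T \<longrightarrow> U \<in> set us"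
    using first_fire[OF l(3)] by blast
  have C: "?C \<in> CC" by (rule CC_I[OF ch J])
  have vT: "v T \<in> ?C" by simp
  note cur = current_first[OF us(2,4,5,6) ch J]
  have "count_list (map v us) (v T) = count_list us T"
    using us(4) l(3) by (intro count_list_map_inj[OF labD(5)]) auto
  also have "\<dots> = 0" using us(4) by (auto simp: count_list_0_iff)
  finally have c0: "ver (v T) (Suc (count_list (map v us) (v T))) = new_label T"
    using new_label_simps(1)[OF l(3)] by simp
  note E = FD(15)[OF map_split[OF us(1)] C vT, unfolded cur c0]
  have s: "new_label ` set ((xs @ [T]) @ map (insert b) (T # ys)) \<union> J =
     insert (new_label T) (new_label ` set (xs @ map (insert b) (T # ys)) \<union> J)" by auto
  have y: "set (T # ys) \<subseteq> Pow A" using l by auto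
  have "chain_weight r (Suc (card A)) 0 (map card ((xs @ [T]) @ map (insert b) (T # ys))) =
      chain_weight r (card A) 0 (map card (xs @ T # ys))"
  proof -
    have e: "map card ((xs @ [T]) @ map (insert b) (T # ys)) = map card xs @ card T # Suc (card T) # map Suc (map card ys)"
      unfolding map_append map_card_insert[OF y] by simp
    have "Suc (card T) - card T = Suc 0" by simp
    then show ?thesis unfolding e unfolding map_append list.map chain_weight_append chain_weight.simps chain_weight_Suc
      by (simp only: perm_h_1 mult_1)
  qed
  then show ?thesis using E unfolding s base_chain(2)[OF ch J] by simp
qed

text \<open>The opposite apex \<open>- b\<close> is not adjacent to \<open>b\<close>, so no firing
  affects the faces through it. The first gap, from the empty set to \<open>{b}\<close>, has weight
  \<open>perm_h 1 = 1\<close>.\<close>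

lemma pole_case:
  assumes ch: "chain_list A ys" and J: "poles R' J"
  shows "new_label ` set (map (insert b) ({} # ys)) \<union> J \<in> K \<and>
    star_h DIM('a) K (new_label ` set (map (insert b) ({} # ys)) \<union> J) =
      chain_weight r (Suc (card A)) 0 (map card (map (insert b) ({} # ys))) * Y ^ free_exp J"
proof -
  note p = polesD[OF J]
  have l: "set ys \<subseteq> lbl" using ch by (simp add: chain_list_def)
  have img: "new_label ` set (map (insert b) ({} # ys)) \<union> J = v ` set ys \<union> insert (- b) J"
  proof -
    have "(\<lambda>y. new_label (insert b y)) ` set ys = v ` set ys"
      using new_label_simps(2) l by (intro image_cong refl) blast
    then show ?thesis using new_label_simps(3) by (simp add: image_image)
  qed
  let ?G = "v ` set ys \<union> insert (- b) J"
  have G: "?G \<in> K0" by (rule labD(3)[OF ch p(4)])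
  have "b \<noteq> - b" using Basis_neq_minus b by blast
  then have bG: "b \<notin> ?G" using p(1) v_neq_b l by blast
  have "insert b ?G \<notin> K0"
    using abs_complexD(5)[OF realizesD(1)[OF labD(1)], of "insert b ?G" "{b, - b}"] labD(2)[of b] b by blast
  then have "?G \<in> K \<and> star_h DIM('a) K ?G = star_h DIM('a) K0 ?G" using FD(14)[OF G bG] by blast
  moreover have "card (insert (- b) J) = Suc (card J)" using p by simp
  then have "star_h DIM('a) K0 ?G = chain_weight r (card A) 0 (map card ys) * Y ^ free_exp J"
    unfolding labD(4)[OF ch p(4)] free_exp_def by simp
  moreover have y: "set ({} # ys) \<subseteq> Pow A" using l by auto
  have "chain_weight r (Suc (card A)) 0 (map card (map (insert b) ({} # ys))) = chain_weight r (card A) 0 (map card ys)"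
    unfolding map_card_insert[OF y] chain_weight.simps card.empty chain_weight_Suc by (simp add: perm_h_1)
  ultimately show ?thesis unfolding img by simp
qed

text \<open>The cases are distinguished by the smallest member containing \<open>b\<close>: there is
  none, it is \<open>{b}\<close>, or it is \<open>insert b T\<close> with \<open>T\<close> nonempty
  and either in the chain or not.\<close>

lemma new_chain:
  assumes ch: "chain_list (insert b A) xs" and J: "poles R' J"
  shows "new_label ` set xs \<union> J \<in> K \<and>
    star_h DIM('a) K (new_label ` set xs \<union> J) = chain_weight r (Suc (card A)) 0 (map card xs) * Y ^ free_exp J"
proof -
  obtain xs1 ys where sp: "xs = xs1 @ map (insert b) ys" "set xs1 \<subseteq> lbl" "set ys \<subseteq> Pow A"
    "sorted_wrt (\<subset>) xs1" "sorted_wrt (\<subset>) ys" "\<forall>x\<in>set xs1. \<forall>y\<in>set ys. x \<subseteq> y"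
    using chain_split[OF ch b(2)] by (elim exE conjE) (rule that)
  have ch1: "chain_list A xs1" using sp(2,4) by (simp add: chain_list_def)
  show ?thesis
  proof (cases ys)
    case Nil
    then have xs: "xs = xs1" using sp(1) by simp
    show ?thesis
    proof (cases "xs1 = []")
      case True then show ?thesis using empty_case[OF J] xs by simp
    next
      case False then show ?thesis using old_case[OF ch1 False J] xs by simp
    qed
  next
    case (Cons T zs)
    have zs: "\<forall>z\<in>set zs. T \<subset> z" "sorted_wrt (\<subset>) zs" "set zs \<subseteq> Pow A" "T \<subseteq> A" using sp(3,5) Cons by auto
    have zl: "set zs \<subseteq> lbl" using zs by auto
    show ?thesis
    proof (cases "T = {}")
      case True
      have "xs1 = []"
      proof (rule ccontr)
        assume "xs1 \<noteq> []"
        then have "hd xs1 \<in> set xs1" by simp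
        moreover from this have "hd xs1 \<subseteq> {}" using sp(6) Cons True by auto
        ultimately show False using sp(2) by auto
      qed
      moreover have "chain_list A zs" using zs zl by (simp add: chain_list_def)
      ultimately show ?thesis using pole_case[OF _ J, of zs] sp(1) Cons True by simp
    next
      case False
      then have Tl: "T \<in> lbl" using zs(4) by blast
      have xT: "\<forall>x\<in>set xs1. x \<subseteq> T" "\<forall>x\<in>set xs1. \<forall>z\<in>set zs. x \<subset> z" using sp(6) zs(1) Cons by auto
      show ?thesis
      proof (cases "T \<in> set xs1")
        case False
        then have "\<forall>x\<in>set xs1. x \<subset> T" using xT(1) by blast
        then have "chain_list A (xs1 @ T # zs)"
          using sp(2,4) zs zl Tl xT by (simp add: chain_list_def sorted_wrt_append)
        then show ?thesis using gap_case[OF _ J, of xs1 T zs] sp(1) Cons by simp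
      next
        case True
        have "last xs1 = T"
          using subset_last[OF sp(4) True] xT(1) True by (metis last_in_set list.set(1) empty_iff subset_antisym)
        then obtain ws where ws: "xs1 = ws @ [T]" using True by (metis append_butlast_last_id list.set(1) empty_iff)
        then have "chain_list A (ws @ T # zs)"
          using sp(2,4) zs zl Tl xT by (simp add: chain_list_def sorted_wrt_append)
        then show ?thesis using repeat_case[OF _ J, of ws T zs] sp(1) Cons ws by simp
      qed
    qed
  qed
qed

lemma label_cases:
  assumes "S \<in> Pow (insert b A) - {{}}"
  obtains "S \<in> lbl" "b \<notin> S" | "S = {b}" | T where "T \<in> lbl" "S = insert b T"
proof (cases "b \<in> S")
  case False then show thesis using that(1) assms by blast
next
  case True
  then have e: "S = insert b (S - {b})" by blast
  show thesis
  proof (cases "S - {b} = {}")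
    case True then show thesis using that(2) e by auto
  next
    case False
    then have "S - {b} \<in> lbl" using assms by blast
    then show thesis using that(3) e by blast
  qed
qed

lemma count_pos: "S \<in> lbl \<Longrightarrow> 1 \<le> count_list (map v sched) (v S)"
  using set_sched by (metis count_list_0_iff image_eqI less_one list.set_map not_less)

lemma v_old: "S \<in> lbl \<Longrightarrow> v S \<in> \<Union>K0"
  using v_nbrs unfolding nbrs_def by blast

lemma pole_old: "c \<in> Basis - A \<Longrightarrow> c \<in> \<Union>K0 \<and> - c \<in> \<Union>K0"
proof -
  assume c: "c \<in> Basis - A"
  have p: "poles (Basis - A) {c}" "poles (Basis - A) {- c}" using pole_single[of c "Basis - A"] c by auto
  have ch: "chain_list A []" by (simp add: chain_list_def)
  show ?thesis using labD(3)[OF ch p(1)] labD(3)[OF ch p(2)] by auto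
qed

lemma new_fresh: "S \<in> lbl \<Longrightarrow> ver (v S) 1 \<notin> \<Union>K0"
  using FD(7)[OF v_nbrs count_pos] by simp

lemma labelled_new: "labelled r (insert b A) K new_label"
proof -
  have mb: "- b \<in> \<Union>K0" using pole_old b by blast
  have mv: "- b \<noteq> v S" if "S \<in> lbl" for S
  proof -
    have "- b \<in> uminus ` (Basis - A)" using b by blast
    then show ?thesis using labD(6)[OF that] by auto
  qed
  \<comment> \<open>The new versions are not vertices of \<open>K0\<close>, whereas the other labels
    are; among the latter, \<open>- b\<close> is a pole and no \<open>v P\<close> is.\<close>
  have inj: "S = T" if S: "S \<in> Pow (insert b A) - {{}}" and T: "T \<in> Pow (insert b A) - {{}}"
    and eq: "new_label S = new_label T" for S T
  proof -
    have vinj: "P = Q" if "v P = v Q" "P \<in> lbl" "Q \<in> lbl" for P Q using labD(5) that by (meson inj_onD)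
    show ?thesis
      using S
    proof (cases rule: label_cases)
      case 1
      show ?thesis using T
      proof (cases rule: label_cases)
        case q1: 1
        have "v S = v T"
          using FD(8)[OF v_nbrs[OF 1(1)] v_nbrs[OF q1(1)] count_pos[OF 1(1)] count_pos[OF q1(1)]] eq
            new_label_simps(1)[OF 1(1)] new_label_simps(1)[OF q1(1)] by simp
        then show ?thesis using vinj 1 q1 by blast
      next
        case 2
        then show ?thesis using eq 1 new_fresh[OF 1(1)] mb new_label_simps by metis
      next
        case (3 T')
        then show ?thesis using eq 1 new_fresh[OF 1(1)] v_old new_label_simps by metis
      qed
    next
      case 2
      show ?thesis using T
      proof (cases rule: label_cases)
        case 1
        then show ?thesis using eq 2 new_fresh[OF 1(1)] mb new_label_simps by metis
      next
        case (3 T')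
        then show ?thesis using eq 2 mv new_label_simps by metis
      qed (use 2 in simp)
    next
      case (3 S')
      show ?thesis using T
      proof (cases rule: label_cases)
        case 1
        then show ?thesis using eq 3 new_fresh[OF 1(1)] v_old new_label_simps by metis
      next
        case 2
        then show ?thesis using eq 3 mv new_label_simps by metis
      next
        case q3: (3 T')
        then show ?thesis using eq 3 vinj new_label_simps by metis
      qed
    qed
  qed
  have avoid: "new_label S \<notin> R' \<union> uminus ` R'" if S: "S \<in> Pow (insert b A) - {{}}" for S
    using S
  proof (cases rule: label_cases)
    case 1
    have "p \<in> \<Union>K0" if p: "p \<in> R' \<union> uminus ` R'" for p
    proof -
      obtain c where "c \<in> Basis - A" "p = c \<or> p = - c" using p by auto
      then show ?thesis using pole_old[of c] by blast
    qed
    then show ?thesis using new_fresh[OF 1(1)] new_label_simps(1)[OF 1(1)] by metis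
  next
    case 2
    have "- b \<noteq> c" "- b \<noteq> - c" if "c \<in> R'" for c using that Basis_neq_minus[of c b] b by auto
    then show ?thesis using 2 new_label_simps(3) by auto
  next
    case (3 T)
    then show ?thesis using labD(6)[OF 3(1)] new_label_simps(2)[OF 3(1)] by auto
  qed
  \<comment> \<open>The assumption \<open>bb\<close> keeps only one of the two mixed cases; the
    other one follows by symmetry in \<open>nonadj'\<close>.\<close>
  have nonadj: "{new_label S, new_label T} \<notin> K" if S: "S \<in> Pow (insert b A) - {{}}" and T: "T \<in> Pow (insert b A) - {{}}"
    and inc: "\<not> S \<subseteq> T" "\<not> T \<subseteq> S" and bb: "b \<notin> S \<or> b \<in> T" for S T
  proof -
    show ?thesis using S
    proof (cases rule: label_cases)
      case 1
      show ?thesis using T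
      proof (cases rule: label_cases)
        case q1: 1
        then show ?thesis
          using FD(18)[OF v_nbrs[OF 1(1)] v_nbrs[OF q1(1)] labD(7)[OF 1(1) q1(1) inc] count_pos[OF 1(1)] count_pos[OF q1(1)]]
            new_label_simps(1)[OF 1(1)] new_label_simps(1)[OF q1(1)] by simp
      next
        case 2
        have "- b \<noteq> b" using Basis_neq_minus[OF b(1) b(1)] by simp
        moreover have "{b, - b} \<notin> K0" using labD(2) b by blast
        ultimately show ?thesis
          using FD(16)[OF v_nbrs[OF 1(1)] count_pos[OF 1(1)] _ mb] 2 new_label_simps(1)[OF 1(1)] new_label_simps(3) by simp
      next
        case (3 T')
        show ?thesis
        proof (cases "T' \<subseteq> S")
          case False
          have "\<not> S \<subseteq> T'" using inc 3 by blast
          then have "{v S, v T'} \<notin> K0" using labD(7)[OF 1(1) 3(1)] False by blast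
          then have "{ver (v S) 1, ver (v T') 0} \<notin> K"
            using FD(18)[OF v_nbrs[OF 1(1)] v_nbrs[OF 3(1)] _ count_pos[OF 1(1)], of 0] by blast
          then show ?thesis using FD(4) 3 new_label_simps(1)[OF 1(1)] new_label_simps(2)[OF 3(1)] by simp
        next
          \<comment> \<open>Here \<open>v S\<close> and \<open>v T'\<close> may be adjacent in
            \<open>K0\<close>. But the smaller set \<open>T'\<close> has fired before
            \<open>S\<close>, so \<open>v T'\<close> is already outdated when the first new version
            of \<open>v S\<close> is created, and the two do not become adjacent.\<close>
          case True
          then have "T' \<subset> S" using inc 3 by blast
          then have less: "card T' < card S" using psubset_card[of S T'] 1 by blast
          obtain us ws where us: "sched = us @ S # ws" "distinct us" "sorted (map card us)"
            "set us \<subseteq> lbl - {S}" "\<forall>U\<in>set us. card U \<le> card S" "\<forall>U\<in>lbl. card U < card S \<longrightarrow> U \<in> set us"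
            using first_fire[OF 1(1)] by blast
          have usl: "set us \<subseteq> lbl" using us(4) by blast
          have "count_list (map v us) (v S) = count_list us S" "count_list (map v us) (v T') = count_list us T'"
            using count_list_map_inj[OF labD(5) usl] 1(1) 3(1) by blast+
          moreover have "count_list us S = 0" using us(4) by (auto simp: count_list_0_iff)
          moreover have "count_list us T' = 1" using us(2,6) less 3(1) by (simp add: count_list_distinct)
          ultimately have "{ver (v S) 1, ver (v T') 0} \<notin> K"
            using FD(17)[OF map_split[OF us(1)] v_nbrs[OF 3(1)], of 0] by simp
          then show ?thesis using FD(4) 3 new_label_simps(1)[OF 1(1)] new_label_simps(2)[OF 3(1)] by simp
        qed
      qed
    next
      case 2
      then have "b \<in> T" using bb by blast
      then show ?thesis using inc 2 by blast
    next
      case (3 S')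
      then have "b \<in> T" using bb by blast
      show ?thesis using T
      proof (cases rule: label_cases)
        case q3: (3 T')
        have "\<not> S' \<subseteq> T'" "\<not> T' \<subseteq> S'" using inc 3 q3 by blast+
        then have "{v S', v T'} \<notin> K0" using labD(7)[OF 3(1) q3(1)] by blast
        moreover have "{v S', v T'} \<subseteq> \<Union>K0" using v_old[OF 3(1)] v_old[OF q3(1)] by blast
        ultimately have "{v S', v T'} \<notin> K" using FD(13) by blast
        then show ?thesis using 3 q3 new_label_simps(2) by simp
      qed (use \<open>b \<in> T\<close> inc 3 in blast)+
    qed
  qed
  have nonadj': "{new_label S, new_label T} \<notin> K" if S: "S \<in> Pow (insert b A) - {{}}" and T: "T \<in> Pow (insert b A) - {{}}"
    and inc: "\<not> S \<subseteq> T" "\<not> T \<subseteq> S" for S T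
    using nonadj[OF S T inc] nonadj[OF T S inc(2,1)] by (cases "b \<notin> S \<or> b \<in> T") (auto simp: insert_commute)
  have cardA: "card (insert b A) = Suc (card A)" using finA b by simp
  show ?thesis
    unfolding labelled_def
  proof (intro conjI ballI allI impI)
    show "realizes K" by (rule FD(2))
    show "{c, - c} \<notin> K" if c: "c \<in> R'" for c
    proof -
      have "{c, - c} \<subseteq> \<Union>K0" using pole_old[of c] c by blast
      then show ?thesis using FD(13) labD(2)[of c] c by blast
    qed
    fix xs J assume "chain_list (insert b A) xs" "poles R' J"
    note N = new_chain[OF this]
    show "new_label ` set xs \<union> J \<in> K" using N by blast
    have "DIM('a) - Suc (card A) - card J = free_exp J" by (simp add: free_exp_def)
    then show "star_h DIM('a) K (new_label ` set xs \<union> J) =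
          chain_weight r (card (insert b A)) 0 (map card xs) * Y ^ (DIM('a) - card (insert b A) - card J)"
      unfolding cardA using N by simp
  next
    show "inj_on new_label (Pow (insert b A) - {{}})" using inj by (rule inj_onI)
    show "new_label S \<notin> R' \<union> uminus ` R'" if "S \<in> Pow (insert b A) - {{}}" for S by (rule avoid[OF that])
    show "{new_label S, new_label T} \<notin> K" if "S \<in> Pow (insert b A) - {{}}" "T \<in> Pow (insert b A) - {{}}" "\<not> S \<subseteq> T" "\<not> T \<subseteq> S" for S T
      by (rule nonadj'[OF that])
  qed
qed

end

lemma labelled_step: "\<exists>K v'. labelled r (insert b A) K v'"
proof -
  have "finite (Pow A - {{}})" using finA by simp
  then obtain Ls where Ls: "distinct Ls" "set Ls = Pow A - {{}}" "sorted (map card Ls)" using sorted_ex by metis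
  define sched where "sched = schedule (mult_at r) Ls (card A)"
  have "set sched \<subseteq> Pow A - {{}}"
    unfolding sched_def schedule_def using set_rounds[of "mult_at r" Ls "card A" "card A"] Ls(2) by auto
  then have "set (map v sched) \<subseteq> nbrs K0 b" using v_nbrs by auto
  then obtain K ver where F: "fired K0 b CC (map v sched) K ver"
    using fired_exists[OF labD(1) CC_ok] by metis
  show ?thesis using labelled_new[OF Ls(1,3,2) sched_def F] by blast
qed

end

section \<open>The cross-polytope and the theorem\<close>

definition cross_complex :: "'a::euclidean_space set set" where
  "cross_complex = {J. poles Basis J}"

lemma cross_mono: "J \<in> cross_complex \<Longrightarrow> G \<subseteq> J \<Longrightarrow> G \<in> cross_complex"
  unfolding cross_complex_def poles_def by blast

lemma abs_complex_cross: "abs_complex DIM('a) (cross_complex :: 'a::euclidean_space set set)"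
proof -
  have "(cross_complex :: 'a set set) \<subseteq> Pow (Basis \<union> uminus ` Basis)" by (auto simp: cross_complex_def poles_def)
  then have "finite (cross_complex :: 'a set set)" by (rule finite_subset) simp
  moreover have "{} \<in> (cross_complex :: 'a set set)" by (simp add: cross_complex_def poles_def)
  moreover have "finite F \<and> card F \<le> DIM('a)" if "F \<in> (cross_complex :: 'a set set)" for F
    using card_poles[of Basis F] that by (simp add: cross_complex_def)
  ultimately show ?thesis unfolding abs_complex_def using cross_mono by blast
qed

lemma flag_cross: "flag_abs (cross_complex :: 'a::euclidean_space set set)"
  unfolding flag_abs_def
proof (intro allI impI)
  fix V :: "'a set" assume "finite V" and V: "\<forall>G\<subseteq>V. card G \<le> 2 \<longrightarrow> G \<in> cross_complex"
  have "x \<in> Basis \<union> uminus ` Basis" if "x \<in> V" for x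
  proof -
    have "{x} \<in> cross_complex" using V that by simp
    then show ?thesis by (simp add: cross_complex_def poles_def)
  qed
  moreover have "\<not> {c, - c} \<subseteq> V" if "c \<in> Basis" for c
  proof
    assume "{c, - c} \<subseteq> V"
    then have "{c, - c} \<in> cross_complex" using V by (simp add: card_insert_if)
    then show False using that by (auto simp: cross_complex_def poles_def)
  qed
  ultimately show "V \<in> cross_complex" unfolding cross_complex_def poles_def by blast
qed

lemma sign_choice:
  fixes P :: "'a::euclidean_space \<Rightarrow> bool"
  defines "h \<equiv> \<lambda>b. if P b then - b else b"
  shows "h ` Basis \<in> cross_complex" "inj_on h Basis" "card (h ` Basis) = DIM('a)"
proof -
  show inj: "inj_on h Basis"
  proof (rule inj_onI)
    fix x y :: 'a assume x: "x \<in> Basis" and y: "y \<in> Basis" and eq: "h x = h y"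
    show "x = y" using eq Basis_neq_minus[OF x y] Basis_neq_minus[OF y x] by (auto simp: h_def split: if_splits)
  qed
  then show "card (h ` Basis) = DIM('a)" by (simp add: card_image)
  have "\<not> {c, - c} \<subseteq> h ` Basis" if c: "c \<in> Basis" for c
  proof
    assume "{c, - c} \<subseteq> h ` Basis"
    then obtain b b' where bb: "b \<in> Basis" "b' \<in> Basis" "c = h b" "- c = h b'" by auto
    have "b = c" using bb Basis_neq_minus[OF c bb(1)] by (auto simp: h_def split: if_splits)
    moreover have "b' = c" using bb Basis_neq_minus[OF bb(2) c] by (auto simp: h_def split: if_splits)
    ultimately show False using bb Basis_neq_minus[OF c c] by simp
  qed
  then show "h ` Basis \<in> cross_complex" unfolding cross_complex_def poles_def h_def by auto
qed

lemma cross_pure: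
  assumes "G \<in> (cross_complex :: 'a::euclidean_space set set)"
  shows "\<exists>F\<in>cross_complex. G \<subseteq> F \<and> card F = DIM('a)"
proof (intro bexI conjI)
  let ?F = "(\<lambda>b. if - b \<in> G then - b else b) ` (Basis :: 'a set)"
  show "G \<subseteq> ?F"
  proof
    fix p assume p: "p \<in> G"
    then consider "p \<in> Basis" | b where "b \<in> Basis" "p = - b" using assms by (auto simp: cross_complex_def poles_def)
    then show "p \<in> ?F"
    proof cases
      case 1
      then have "- p \<notin> G" using assms p by (auto simp: cross_complex_def poles_def)
      then show ?thesis using 1 by (intro image_eqI[of _ _ p]) auto
    next
      case 2 then show ?thesis using p by (intro image_eqI[of _ _ b]) auto
    qed
  qed
qed (rule sign_choice)+

text \<open>The vertices of a facet are orthonormal, so the sum of their inner products with a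
  vector takes the value 1 on each of them. Every other vertex is the negative of one of them and
  has the value \<open>- 1\<close>.\<close>

lemma cross_facet:
  assumes "F \<in> (cross_complex :: 'a::euclidean_space set set)" "card F = DIM('a)"
  shows "independent F" "\<exists>f::'a \<Rightarrow> real. linear f \<and> (\<forall>v\<in>F. f v = 1) \<and> (\<forall>v\<in>\<Union>cross_complex - F. f v < 1)"
proof -
  have F: "F \<subseteq> Basis \<union> uminus ` Basis" "\<And>c. c \<in> Basis \<Longrightarrow> \<not> {c, - c} \<subseteq> F"
    using assms(1) by (auto simp: cross_complex_def poles_def)
  have fin: "finite F" using card_poles(3)[of Basis F] assms(1) by (simp add: cross_complex_def)
  have orth: "p \<bullet> q = 0" if pq: "p \<in> F" "q \<in> F" "p \<noteq> q" for p q
  proof -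
    obtain b c where bc: "b \<in> Basis" "p = b \<or> p = - b" "c \<in> Basis" "q = c \<or> q = - c" using F(1) pq by blast
    have "b \<noteq> c"
    proof
      assume "b = c"
      then have "{b, - b} \<subseteq> F" using bc pq by auto
      then show False using F(2) bc by blast
    qed
    then have "b \<bullet> c = 0" using bc inner_not_same_Basis by blast
    then show ?thesis using bc by auto
  qed
  have one: "p \<bullet> p = 1" if "p \<in> F" for p
    using F(1) that inner_same_Basis by fastforce
  have "0 \<notin> F" using one[of 0] by auto
  then show "independent F"
    using orth by (intro pairwise_orthogonal_independent) (auto simp: pairwise_def orthogonal_def)
  define f where "f v = (\<Sum>p\<in>F. p \<bullet> v)" for v
  have f1: "f v = 1" if "v \<in> F" for v
  proof -
    have "f v = (\<Sum>p\<in>F. if p = v then 1 else 0)" unfolding f_def using orth one that by (intro sum.cong) auto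
    then show ?thesis using that fin by simp
  qed
  have lin: "linear f" unfolding f_def by (intro linear_compose_sum ballI bounded_linear.linear bounded_linear_inner_right)
  have "f v < 1" if v: "v \<in> \<Union>cross_complex - F" for v
  proof -
    obtain G where "G \<in> cross_complex" "v \<in> G" using v by blast
    then obtain b where b: "b \<in> Basis" "v = b \<or> v = - b" unfolding cross_complex_def poles_def by blast
    let ?g = "\<lambda>p. if p \<in> Basis then p else - p"
    have "poles Basis F" using assms(1) by (simp add: cross_complex_def)
    note cp = card_poles[OF subset_refl this]
    have "?g ` F = Basis" using cp(2) card_image[OF cp(1)] assms(2) by (intro card_subset_eq) auto
    then have "b \<in> ?g ` F" using b by simp
    then obtain p where "b = ?g p" "p \<in> F" by (rule imageE)
    then have "b \<in> F \<or> - b \<in> F" by (auto split: if_splits)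
    then have "- v \<in> F" using b v by auto
    then have "f (- v) = 1" by (rule f1)
    then show ?thesis using linear_neg[OF lin, of v] by simp
  qed
  then show "\<exists>f::'a \<Rightarrow> real. linear f \<and> (\<forall>v\<in>F. f v = 1) \<and> (\<forall>v\<in>\<Union>cross_complex - F. f v < 1)"
    using f1 lin by blast
qed

text \<open>The signs of the coordinates of \<open>y\<close> select the orthant, and the absolute
  values of the coordinates are the coefficients.\<close>

lemma cross_cone: "\<exists>F\<in>cross_complex. (y :: 'a::euclidean_space) \<in> cone_of F"
proof (intro bexI)
  let ?h = "\<lambda>b. if y \<bullet> b < 0 then - b else (b :: 'a)"
  show "?h ` Basis \<in> cross_complex" by (rule sign_choice)
  show "y \<in> cone_of (?h ` Basis)"
  proof (rule cone_ofI[of _ "\<lambda>v. y \<bullet> v"])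
    show "0 \<le> y \<bullet> v" if "v \<in> ?h ` Basis" for v using that by (auto split: if_splits)
    have "(\<Sum>v\<in>?h ` Basis. (y \<bullet> v) *\<^sub>R v) = (\<Sum>b\<in>Basis. (y \<bullet> ?h b) *\<^sub>R ?h b)"
      by (subst sum.reindex[OF sign_choice(2)]) (simp add: comp_def)
    also have "\<dots> = (\<Sum>b\<in>Basis. (y \<bullet> b) *\<^sub>R b)" by (intro sum.cong) auto
    finally show "y = (\<Sum>v\<in>?h ` Basis. (y \<bullet> v) *\<^sub>R v)" by (simp add: euclidean_representation)
  qed
qed

lemma realizes_cross: "realizes (cross_complex :: 'a::euclidean_space set set)"
  unfolding realizes_def using abs_complex_cross flag_cross cross_pure cross_facet cross_cone by blast

text \<open>A face over \<open>J\<close> is a member of \<open>R\<close>, alone or extended by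
  \<open>b\<close> or by \<open>- b\<close>: the link of \<open>J\<close> is the suspension of the
  link of \<open>insert b J\<close>.\<close>

lemma star_h_cross_insert:
  fixes J :: "'a::euclidean_space set"
  assumes J: "J \<in> cross_complex" and b: "b \<in> Basis" "b \<notin> J" "- b \<notin> J"
  shows "star_h DIM('a) cross_complex J = [:1, 1:] * star_h DIM('a) cross_complex (insert b J)"
proof -
  let ?d = "DIM('a)"
  define R where "R = {F\<in>cross_complex. J \<subseteq> F \<and> b \<notin> F \<and> - b \<notin> F}"
  have ne: "b \<noteq> - b" by (rule Basis_neq_minus[OF b(1) b(1)])
  have cb: "c \<noteq> - b" "- c \<noteq> b" "b \<noteq> - c" "- c = - b \<longleftrightarrow> c = b" if "c \<in> Basis" for c
    using Basis_neq_minus[OF that b(1)] Basis_neq_minus[OF b(1) that] by auto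
  have fin: "finite (cross_complex :: 'a set set)" using abs_complexD(1)[OF abs_complex_cross] .
  have fR: "finite R" unfolding R_def using fin by simp
  have ins: "insert b F \<in> cross_complex" "insert (- b) F \<in> cross_complex" if "F \<in> R" for F
    using that cb b(1) unfolding R_def cross_complex_def poles_def by (auto simp: image_iff)
  have eqb: "{F\<in>cross_complex. insert b J \<subseteq> F} = insert b ` R"
  proof (intro equalityI subsetI)
    fix F assume F: "F \<in> {F\<in>cross_complex. insert b J \<subseteq> F}"
    then have "- b \<notin> F" using b(1) by (auto simp: cross_complex_def poles_def)
    then have "F - {b} \<in> R" "F = insert b (F - {b})" using F b cross_mono[of F "F - {b}"] by (auto simp: R_def)
    then show "F \<in> insert b ` R" by blast
  qed (use ins in \<open>auto simp: R_def\<close>)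
  have eqm: "{F\<in>cross_complex. insert (- b) J \<subseteq> F} = insert (- b) ` R"
  proof (intro equalityI subsetI)
    fix F assume F: "F \<in> {F\<in>cross_complex. insert (- b) J \<subseteq> F}"
    then have "b \<notin> F" using b(1) by (auto simp: cross_complex_def poles_def)
    then have "F - {- b} \<in> R" "F = insert (- b) (F - {- b})" using F b cross_mono[of F "F - {- b}"] by (auto simp: R_def)
    then show "F \<in> insert (- b) ` R" by blast
  qed (use ins in \<open>auto simp: R_def\<close>)
  have all: "{F\<in>cross_complex. J \<subseteq> F} = R \<union> (insert b ` R \<union> insert (- b) ` R)"
  proof (rule set_eqI)
    fix F
    have "F \<in> insert b ` R \<longleftrightarrow> F \<in> cross_complex \<and> b \<in> F \<and> J \<subseteq> F" "F \<in> insert (- b) ` R \<longleftrightarrow> F \<in> cross_complex \<and> - b \<in> F \<and> J \<subseteq> F"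
      using arg_cong[OF eqb, of "\<lambda>X. F \<in> X"] arg_cong[OF eqm, of "\<lambda>X. F \<in> X"] by simp_all
    moreover have "F \<in> R \<longleftrightarrow> F \<in> cross_complex \<and> J \<subseteq> F \<and> b \<notin> F \<and> - b \<notin> F" unfolding R_def by simp
    ultimately show "F \<in> {F\<in>cross_complex. J \<subseteq> F} \<longleftrightarrow> F \<in> R \<union> (insert b ` R \<union> insert (- b) ` R)"
      unfolding Un_iff mem_Collect_eq by argo
  qed
  have mem: "F \<in> R \<Longrightarrow> b \<notin> F \<and> - b \<notin> F" "F \<in> insert b ` R \<Longrightarrow> b \<in> F \<and> - b \<notin> F" "F \<in> insert (- b) ` R \<Longrightarrow> - b \<in> F" for F
    using ne by (auto simp: R_def)
  have disj: "R \<inter> (insert b ` R \<union> insert (- b) ` R) = {}" "insert b ` R \<inter> insert (- b) ` R = {}"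
    using mem by (meson UnE disjoint_iff)+
  have R: "finite F" "card (insert b F) = Suc (card F)" "card (insert (- b) F) = Suc (card F)" "card J \<le> card F" "Suc (card F) \<le> ?d" if "F \<in> R" for F
  proof -
    show f: "finite F" using that abs_complexD(3)[OF abs_complex_cross] by (auto simp: R_def)
    show c: "card (insert b F) = Suc (card F)" "card (insert (- b) F) = Suc (card F)" using f that by (auto simp: R_def)
    show "card J \<le> card F" using f that by (auto simp: R_def card_mono)
    show "Suc (card F) \<le> ?d" using abs_complexD(4)[OF abs_complex_cross ins(1)[OF that]] c by simp
  qed
  have inj: "inj_on (insert p) R" if p: "p = b \<or> p = - b" for p
  proof (rule inj_onI)
    fix F G assume "F \<in> R" "G \<in> R" "insert p F = insert p G"
    moreover from this have "p \<notin> F" "p \<notin> G" using mem(1) p by blast+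
    ultimately show "F = G" using insert_ident by metis
  qed
  have im: "(\<Sum>F\<in>insert p ` R. h_term ?d g (card F)) = (\<Sum>F\<in>R. h_term ?d g (Suc (card F)))" if "p = b \<or> p = - b" for p g
    unfolding sum.reindex[OF inj[OF that]] comp_def using that R by (intro sum.cong) auto
  have "star_h ?d cross_complex J = (\<Sum>F\<in>R. h_term ?d (card J) (card F)) + ((\<Sum>F\<in>R. h_term ?d (card J) (Suc (card F))) + (\<Sum>F\<in>R. h_term ?d (card J) (Suc (card F))))"
    unfolding star_h_def all using fR disj by (simp add: sum.union_disjoint im)
  also have "\<dots> = (\<Sum>F\<in>R. [:1, 1:] * h_term ?d (Suc (card J)) (Suc (card F)))"
    unfolding sum.distrib[symmetric]
  proof (intro sum.cong refl)
    \<comment> \<open>As \<open>h_term\<close> depends only on differences of its arguments, all of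
      them may be raised by one. In dimension \<open>Suc ?d\<close> the relation applies, since its
      bound then reads \<open>card F + 2 \<le> Suc ?d\<close>.\<close>
    fix F assume F: "F \<in> R"
    show "h_term ?d (card J) (card F) + (h_term ?d (card J) (Suc (card F)) + h_term ?d (card J) (Suc (card F))) =
       [:1, 1:] * h_term ?d (Suc (card J)) (Suc (card F))"
      using h_term_rel(2)[of "card J" "card F" "Suc ?d"] R(4,5)[OF F] by (simp add: h_term_def)
  qed
  also have "\<dots> = [:1, 1:] * (\<Sum>F\<in>R. h_term ?d (Suc (card J)) (Suc (card F)))" by (simp only: sum_distrib_left)
  also have "(\<Sum>F\<in>R. h_term ?d (Suc (card J)) (Suc (card F))) = star_h ?d cross_complex (insert b J)"
  proof -
    have "finite J" using J abs_complexD(3)[OF abs_complex_cross] by blast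
    then show ?thesis unfolding star_h_def eqb using im[of b] b by simp
  qed
  finally show ?thesis .
qed

lemma star_h_cross:
  fixes J :: "'a::euclidean_space set"
  assumes "J \<in> cross_complex"
  shows "star_h DIM('a) cross_complex J = [:1, 1:] ^ (DIM('a) - card J)"
  using assms
proof (induction "DIM('a) - card J" arbitrary: J)
  case 0
  note K = abs_complexD[OF abs_complex_cross[where 'a='a]]
  have c: "card J = DIM('a)" using K(4)[OF 0(2)] 0 by simp
  have "F = J" if "F \<in> cross_complex" "J \<subseteq> F" for F
    using card_seteq[OF K(3)[OF that(1)] that(2)] K(4)[OF that(1)] c by simp
  then have "{F\<in>cross_complex. J \<subseteq> F} = {J}" using 0(2) by blast
  then show ?case unfolding star_h_def using c by (simp add: h_term_def monom_altdef)
next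
  case (Suc k)
  note K = abs_complexD[OF abs_complex_cross[where 'a='a]]
  have "\<exists>b\<in>Basis. b \<notin> J \<and> - b \<notin> J"
  proof (rule ccontr)
    assume no: "\<not> (\<exists>b\<in>Basis. b \<notin> J \<and> - b \<notin> J)"
    have "(\<lambda>b. if - b \<in> J then - b else b) ` Basis \<subseteq> J" using no by auto
    then have "DIM('a) \<le> card J" using sign_choice(3)[of "\<lambda>b. - b \<in> J"] card_mono[OF K(3)[OF Suc(3)]] by metis
    then show False using Suc(2) by simp
  qed
  then obtain b where b: "b \<in> Basis" "b \<notin> J" "- b \<notin> J" by blast
  have cb: "c \<noteq> - b" "- c \<noteq> b" "b \<noteq> - c" "- c = - b \<longleftrightarrow> c = b" if "c \<in> Basis" for c
    using Basis_neq_minus[OF that b(1)] Basis_neq_minus[OF b(1) that] by auto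
  have "insert b J \<in> cross_complex" using Suc(3) b cb unfolding cross_complex_def poles_def by (auto simp: image_iff)
  moreover have "card (insert b J) = Suc (card J)" using K(3)[OF Suc(3)] b by simp
  moreover from this have "k = DIM('a) - card (insert b J)" using Suc(2) by linarith
  ultimately have "star_h DIM('a) cross_complex (insert b J) = [:1, 1:] ^ k" using Suc(1)[of "insert b J"] by simp
  then show ?case unfolding star_h_cross_insert[OF Suc(3) b] Suc(2)[symmetric] by simp
qed

lemma labelled_cross: "labelled r {} (cross_complex :: 'a::euclidean_space set set) v"
  unfolding labelled_def
proof (intro conjI allI ballI impI)
  show "realizes (cross_complex :: 'a set set)" by (rule realizes_cross)
  show "{c, - c} \<notin> (cross_complex :: 'a set set)" if "c \<in> Basis - {}" for c
    using that by (auto simp: cross_complex_def poles_def)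
  fix xs :: "'a set list" and J :: "'a set" assume xs: "chain_list {} xs" and "poles (Basis - {}) J"
  then have J: "J \<in> cross_complex" by (simp add: cross_complex_def)
  have nil: "xs = []" using xs by (cases xs) (auto simp: chain_list_def)
  show "v ` set xs \<union> J \<in> cross_complex" using nil J by simp
  show "star_h DIM('a) cross_complex (v ` set xs \<union> J) =
      chain_weight r (card ({} :: 'a set)) 0 (map card xs) * [:1, 1:] ^ (DIM('a) - card ({} :: 'a set) - card J)"
    using nil star_h_cross[OF J] by simp
qed simp_all

lemma labelled_exists:
  assumes "r \<ge> 2" "A \<subseteq> (Basis :: 'a::euclidean_space set)"
  shows "\<exists>K v. labelled r A K v"
proof -
  have "finite A" using assms(2) finite_subset finite_Basis by blast
  then show ?thesis using assms(2)
  proof (induction A rule: finite_induct)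
    case empty then show ?case using labelled_cross by blast
  next
    case (insert b A)
    then obtain K v where "labelled r A K v" by auto
    then show ?case using labelled_step[of r A K v b] insert assms(1) by auto
  qed
qed

lemma sphere_exists:
  assumes "r \<ge> 2"
  shows "\<exists>K :: 'a::euclidean_space set set. realizes K \<and> star_h DIM('a) K {} = sphere_h r DIM('a)"
proof -
  obtain K and v :: "'a set \<Rightarrow> 'a" where l: "labelled r Basis K v" using labelled_exists[OF assms subset_refl] by blast
  have "chain_list Basis ([] :: 'a set list)" "poles (Basis - Basis) ({} :: 'a set)" by (simp_all add: chain_list_def poles_def)
  then have "star_h DIM('a) K (v ` set [] \<union> {}) = chain_weight r DIM('a) 0 (map card ([] :: 'a set list)) * [:1, 1:] ^ (DIM('a) - DIM('a) - card ({} :: 'a set))"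
    using l unfolding labelled_def by blast
  then show ?thesis using l unfolding labelled_def by (intro exI[of _ K]) simp
qed

theorem theorem1p2:
  fixes n r :: nat
  assumes "n \<ge> 1" and "r \<ge> 2"
    and "DIM('a::euclidean_space) = n"
  shows "\<exists>Aplus Aminus :: int poly.
      binomial_eulerian_A n r = Aplus + Aminus \<and>
      gamma_positive n Aplus \<and>
      gamma_positive (n + 1) Aminus \<and> coeff Aminus 0 = 0 \<and>
      (\<exists>P :: 'a set. simplicial_polytope P \<and> aff_dim P = int n \<and>
         flag_complex (boundary_complex P) \<and>
         Aplus = h_polynomial (boundary_complex P))"
proof -
  have r: "r \<ge> 1" using assms(2) by simp
  obtain K :: "'a set set" where K: "realizes K" and h: "star_h DIM('a) K {} = sphere_h r DIM('a)"
    using sphere_exists[OF assms(2)] by blast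
  let ?P = "convex hull (\<Union>K)"
  have "binomial_eulerian_A n r = sphere_h r n + minus_h r n"
    by (rule poly_eqI_infinite) (rule binomial_eulerian_eval[OF r _ eulerian_A_rec])
  moreover have "aff_dim ?P = int n" using aff_dim_hull[OF K] assms(3) by simp
  moreover have "sphere_h r n = h_polynomial (boundary_complex ?P)"
    using h_boundary[OF K] h assms(3) by simp
  ultimately show ?thesis
    using gamma_positive_sphere_h gamma_positive_minus_h coeff_minus_h_0 simplicial_boundary[OF K]
      flag_boundary[OF K] by blast
qed

end
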